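(* Let $\Gamma$ be a countable discrete group. The settings $\mathbb{A}$ and ${}^\bullet\mathbb{SIM}$ are dynamically generically-equivalent. That is, for every isomorphism-invariant property $P$ of measure-preserving $\Gamma$-actions on probability spaces, putting $$\mathbb{A}_P=\{\mathbf{T}\in\mathbb{A}\mid (\mathbf{T}:Y,\mathbf{m})\text{ has }P\},\qquad {}^\bullet\mathbb{SIM}_P=\{\widehat\mu\in{}^\bullet\mathbb{SIM}\mid(\mathbf{S}:\widehat Y,\widehat\mu)\text{ has }P\},$$ the set $\mathbb{A}_P$ is a Baire set (respectively: meager, residual) in $\mathbb{A}$ if and only if ${}^\bullet\mathbb{SIM}_P$ is a Baire set (respectively: meager, residual) in ${}^\bullet\mathbb{SIM}$.
   Context: $Y=[0,1)$ is topologized as the unit circle, $\mathcal{Y}$ is its Borel sigma-algebra and $\mathbf{m}$ is Lebesgue measure. The group $\Gamma$ is written additively (though possibly non-abelian). "Measure" means Borel probability measure. A $\Gamma$-action on a probability space $(X,\mathcal X,\mu)$, written $(\mathbf{T}:X,\mu)$, is a collection $\mathbf{T}=\{T^\gamma\mid\gamma\in\Gamma\}$ of $\mu$-measure-preserving transformations with $T^{\beta+\alpha}=T^\beta\circ T^\alpha$ and $(\gamma,x)\mapsto T^\gamma(x)$ measurable; transformations equal almost everywhere are identified. Two actions $(\mathbf{T}:X,\mu)$ and $(\mathbf{R}:X',\mu')$ are isomorphic if there is a bi-measure-preserving map $\varphi:(X,\mu)\to(X',\mu')$ (invertible modulo null sets, with $\varphi$ and $\varphi^{-1}$ measure preserving)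 such that $R^\gamma=\varphi T^\gamma\varphi^{-1}$ for all $\gamma\in\Gamma$. A property is isomorphism-invariant if whenever two actions are isomorphic, both or neither have it. $\mathbb{A}$ is the set of $\Gamma$-actions on $(Y,\mathcal Y,\mathbf{m})$, with the coarse topology: for measure-preserving transformations, $T_i\to R$ iff $\mathbf{m}(T_i^{-1}(E)\bigtriangleup R^{-1}(E))\to0$ for every measurable $E\subset Y$; and $\mathbf{T}_i\to\mathbf{R}$ in $\mathbb{A}$ iff $T_i^\gamma\to R^\gamma$ for every $\gamma\in\Gamma$ (net convergence). $\widehat Y=Y^{\times\Gamma}$ is the product space with the product topology; $\widehat y[\gamma]$ denotes the $\gamma$-th coordinate of $\widehat y$. The shift $\mathbf{S}=\{S^\alpha\mid\alpha\in\Gamma\}$ on $\widehat Y$ is defined by $S^\alpha(\widehat y)[\gamma]=\widehat y[\gamma+\alpha]$. ${}^\bullet\mathbb{SIM}$ is the set of Borel probability measures on $\widehat Y$ invariant under every $S^\alpha$, $\alpha\in\Gamma$, with the weak-$*$ topology; each $\widehat\mu\in{}^\bullet\mathbb{SIM}$ gives the action $(\mathbf{S}:\widehat Y,\widehat\mu)$. A setting is a topological space $\Omega$ together with a map from $\Omega$ to $\Gamma$-actions; two settings are dynamically generically-equivalent if isomorphism-invariant properties are Baire/meager/residual in one iff they are, respectively, Baire/meager/residual in the other. A subset of a topological space is meager if it is a countable union of nowhere-dense sets, residual if its complement is meager, and a Baire set if it equals $V\bigtriangleup M$ with $V$ open and $M$ meager. *)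

theory Defs
  imports "HOL-Probability.Probability"
begin

section \<open>Baire category in a topological space\<close>

definition nowhere_dense_in :: "'a topology \<Rightarrow> 'a set \<Rightarrow> bool" where
  "nowhere_dense_in X S \<longleftrightarrow> S \<subseteq> topspace X \<and> X interior_of (X closure_of S) = {}"

definition meager_in :: "'a topology \<Rightarrow> 'a set \<Rightarrow> bool" where
  "meager_in X S \<longleftrightarrow> (\<exists>N :: nat \<Rightarrow> 'a set. (\<forall>n. nowhere_dense_in X (N n)) \<and> S = (\<Union>n. N n))"

definition residual_in :: "'a topology \<Rightarrow> 'a set \<Rightarrow> bool" where
  "residual_in X S \<longleftrightarrow> S \<subseteq> topspace X \<and> meager_in X (topspace X - S)"

definition Baire_set_in :: "'a topology \<Rightarrow> 'a set \<Rightarrow> bool" where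
  "Baire_set_in X S \<longleftrightarrow> (\<exists>V M. openin X V \<and> meager_in X M \<and> S = sym_diff V M)"

definition borel_of :: "'a topology \<Rightarrow> 'a measure" where
  "borel_of X = sigma (topspace X) {U. openin X U}"


section \<open>Actions of a countable discrete group\<close>

text \<open>
  The group is a type of class \<open>{group_add, countable}\<close>; the class \<open>group_add\<close> does not
  assume commutativity.
\<close>

definition measure_preserving :: "'a measure \<Rightarrow> 'b measure \<Rightarrow> ('a \<Rightarrow> 'b) \<Rightarrow> bool" where
  "measure_preserving M N f \<longleftrightarrow> f \<in> M \<rightarrow>\<^sub>M N \<and> distr M N f = N"

text \<open>
  Transformations are identified when equal almost everywhere, so the action law is required
  almost everywhere. That \<open>T 0\<close> is the identity modulo null sets follows from the law
  \<open>T 0 = T 0 \<circ> T 0\<close>; see \<open>gaction_zero\<close> below.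
\<close>

definition gaction :: "'a measure \<Rightarrow> ('g::{group_add,countable} \<Rightarrow> 'a \<Rightarrow> 'a) \<Rightarrow> bool" where
  "gaction M T \<longleftrightarrow>
     prob_space M \<and>
     (\<forall>\<gamma>. measure_preserving M M (T \<gamma>)) \<and>
     (\<forall>\<beta> \<alpha>. AE x in M. T (\<beta> + \<alpha>) x = T \<beta> (T \<alpha> x)) \<and>
     (\<lambda>(\<gamma>, x). T \<gamma> x) \<in> count_space UNIV \<Otimes>\<^sub>M M \<rightarrow>\<^sub>M M"

definition isomorphic_actions ::
  "'a measure \<Rightarrow> ('g \<Rightarrow> 'a \<Rightarrow> 'a) \<Rightarrow> 'b measure \<Rightarrow> ('g \<Rightarrow> 'b \<Rightarrow> 'b) \<Rightarrow> bool" where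
  "isomorphic_actions M T N R \<longleftrightarrow>
     (\<exists>\<phi> \<psi>. measure_preserving M N \<phi> \<and> measure_preserving N M \<psi> \<and>
        (AE x in M. \<psi> (\<phi> x) = x) \<and> (AE y in N. \<phi> (\<psi> y) = y) \<and>
        (\<forall>\<gamma>. AE y in N. R \<gamma> y = \<phi> (T \<gamma> (\<psi> y))))"


section \<open>Isomorphism-invariant properties\<close>

text \<open>
  A property has to be evaluated both on actions on \<open>[0,1)\<close> and on actions on the product
  \<open>[0,1)\<^sup>\<Gamma>\<close>, which have different point types; the following type is the disjoint union of the
  two kinds of systems. All probability spaces (with any sigma-algebra) on the two point types are
  allowed. Including further point types would not change which pairs of sets of systems
  on \<open>[0,1)\<close> and \<open>[0,1)\<^sup>\<Gamma>\<close> are cut out by an isomorphism-invariant property, because an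
  invariant property of the systems below extends to all systems by closing it under isomorphism.
\<close>

datatype 'g system =
    Real_System "real measure" "'g \<Rightarrow> real \<Rightarrow> real"
  | Fun_System "('g \<Rightarrow> real) measure" "'g \<Rightarrow> ('g \<Rightarrow> real) \<Rightarrow> ('g \<Rightarrow> real)"

fun is_action :: "'g::{group_add,countable} system \<Rightarrow> bool" where
  "is_action (Real_System M T) = gaction M T"
| "is_action (Fun_System M T) = gaction M T"

fun isomorphic :: "'g system \<Rightarrow> 'g system \<Rightarrow> bool" where
  "isomorphic (Real_System M T) (Real_System N R) = isomorphic_actions M T N R"
| "isomorphic (Real_System M T) (Fun_System N R) = isomorphic_actions M T N R"
| "isomorphic (Fun_System M T) (Real_System N R) = isomorphic_actions M T N R"
| "isomorphic (Fun_System M T) (Fun_System N R) = isomorphic_actions M T N R"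

definition isomorphism_invariant :: "('g::{group_add,countable} system \<Rightarrow> bool) \<Rightarrow> bool" where
  "isomorphism_invariant P \<longleftrightarrow>
     (\<forall>A B. is_action A \<and> is_action B \<and> isomorphic A B \<longrightarrow> (P A \<longleftrightarrow> P B))"

text \<open>A setting is a topological space together with a map from its points to actions.\<close>

type_synonym ('w, 'g) setting = "'w topology \<times> ('w \<Rightarrow> 'g system)"

definition having :: "('w, 'g) setting \<Rightarrow> ('g system \<Rightarrow> bool) \<Rightarrow> 'w set" where
  "having \<Omega> P = {\<omega> \<in> topspace (fst \<Omega>). P (snd \<Omega> \<omega>)}"

definition dynamically_generically_equivalent ::
  "('w, 'g::{group_add,countable}) setting \<Rightarrow> ('v, 'g) setting \<Rightarrow> bool" where
  "dynamically_generically_equivalent \<Omega> \<Omega>' \<longleftrightarrow>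
     (\<forall>P. isomorphism_invariant P \<longrightarrow>
        (Baire_set_in (fst \<Omega>) (having \<Omega> P) \<longleftrightarrow> Baire_set_in (fst \<Omega>') (having \<Omega>' P)) \<and>
        (meager_in (fst \<Omega>) (having \<Omega> P) \<longleftrightarrow> meager_in (fst \<Omega>') (having \<Omega>' P)) \<and>
        (residual_in (fst \<Omega>) (having \<Omega> P) \<longleftrightarrow> residual_in (fst \<Omega>') (having \<Omega>' P)))"


section \<open>The space \<open>Y\<close> and the setting of actions on it\<close>

text \<open>\<open>[0,1)\<close> with the topology making \<open>t \<mapsto> exp (2\<pi>it)\<close> a homeomorphism onto the unit circle.\<close>

definition circle :: "real topology" where
  "circle = pullback_topology {0..<1} (\<lambda>t. cis (2 * pi * t)) euclidean"

definition Y_measure :: "real measure" where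
  "Y_measure = restrict_space lborel {0..<1}"

definition ae_equal :: "(('g::{group_add,countable} \<Rightarrow> real \<Rightarrow> real) \<times> ('g \<Rightarrow> real \<Rightarrow> real)) set" where
  "ae_equal = {(T, R). gaction Y_measure T \<and> gaction Y_measure R \<and>
                       (\<forall>\<gamma>. AE x in Y_measure. T \<gamma> x = R \<gamma> x)}"

definition Y_actions :: "('g::{group_add,countable} \<Rightarrow> real \<Rightarrow> real) set set" where
  "Y_actions = {T. gaction Y_measure T} // ae_equal"

text \<open>
  A representative of an almost-everywhere class. Nothing below depends on the choice: two
  representatives are isomorphic, and their preimages of a measurable set differ by a null set.
\<close>

definition rep :: "('g \<Rightarrow> real \<Rightarrow> real) set \<Rightarrow> 'g \<Rightarrow> real \<Rightarrow> real" where
  "rep c = (SOME T. T \<in> c)"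

definition coarse_dist :: "'g \<Rightarrow> real set \<Rightarrow> ('g \<Rightarrow> real \<Rightarrow> real) set \<Rightarrow> ('g \<Rightarrow> real \<Rightarrow> real) set \<Rightarrow> real" where
  "coarse_dist \<gamma> E c d =
     measure Y_measure
       (sym_diff (rep c \<gamma> -` E \<inter> space Y_measure) (rep d \<gamma> -` E \<inter> space Y_measure))"

text \<open>The topology is given by its convergent nets; \<open>limitin_coarse_topology\<close> shows that the one
  generated by the following sets has the right ones.\<close>

definition coarse_topology :: "('g::{group_add,countable} \<Rightarrow> real \<Rightarrow> real) set topology" where
  "coarse_topology =
     topology_generated_by
       {{c \<in> Y_actions. coarse_dist \<gamma> E c d < \<epsilon>} | \<gamma> E d \<epsilon>.
          E \<in> sets Y_measure \<and> d \<in> Y_actions \<and> 0 < \<epsilon>}"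

definition Y_setting :: "(('g::{group_add,countable} \<Rightarrow> real \<Rightarrow> real) set, 'g) setting" where
  "Y_setting = (coarse_topology, \<lambda>c. Real_System Y_measure (rep c))"


section \<open>The setting of shift-invariant measures\<close>

definition Y_hat :: "('g \<Rightarrow> real) topology" where
  "Y_hat = product_topology (\<lambda>_. circle) UNIV"

definition coord_shift :: "'g::group_add \<Rightarrow> ('g \<Rightarrow> real) \<Rightarrow> ('g \<Rightarrow> real)" where
  "coord_shift \<alpha> y = (\<lambda>\<gamma>. y (\<gamma> + \<alpha>))"

definition SIM :: "('g::{group_add,countable} \<Rightarrow> real) measure set" where
  "SIM = {\<mu>. sets \<mu> = sets (borel_of Y_hat) \<and> prob_space \<mu> \<and>
             (\<forall>\<alpha>. measure_preserving \<mu> \<mu> (coord_shift \<alpha>))}"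

definition weak_star_topology :: "('g::{group_add,countable} \<Rightarrow> real) measure topology" where
  "weak_star_topology =
     topology_generated_by
       {{\<mu> \<in> SIM. (\<integral>y. f y \<partial>\<mu>) \<in> U} | f U.
          continuous_map Y_hat euclideanreal f \<and> open U}"

definition SIM_setting :: "(('g::{group_add,countable} \<Rightarrow> real) measure, 'g) setting" where
  "SIM_setting = (weak_star_topology, \<lambda>\<mu>. Fun_System \<mu> coord_shift)"


section \<open>Consistency of the definitions\<close>

lemma space_borel_of: "space (borel_of X) = topspace X"
  unfolding borel_of_def by (rule space_measure_of) (auto dest: openin_subset)

lemma sets_borel_of: "sets (borel_of X) = sigma_sets (topspace X) {U. openin X U}"
  unfolding borel_of_def by (rule sets_measure_of) (auto dest: openin_subset)

lemma topspace_circle [simp]: "topspace circle = {0..<1}"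
  by (auto simp: circle_def topspace_pullback_topology)

lemma space_Y_measure [simp]: "space Y_measure = {0..<1}"
  by (simp add: Y_measure_def space_restrict_space)

lemma prob_space_Y_measure: "prob_space Y_measure"
  by (rule prob_spaceI) (simp add: Y_measure_def space_restrict_space emeasure_restrict_space)

lemma sets_Y_measure: "sets Y_measure = sets (borel_of circle)"
proof (rule antisym)
  let ?e = "\<lambda>t::real. cis (2 * pi * t)"
  have e: "?e \<in> borel_measurable borel"
    by (intro borel_measurable_continuous_onI continuous_intros)
  have Ye: "sets Y_measure = sets (restrict_space borel {0..<1::real})"
    by (simp add: Y_measure_def sets_restrict_space)
  have "U \<in> sets Y_measure" if "openin circle U" for U
  proof -
    from that obtain V where V: "open V" "U = ?e -` V \<inter> {0..<1}"
      by (auto simp: circle_def openin_pullback_topology)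
    have "?e -` V \<inter> space borel \<in> sets borel"
      by (rule measurable_sets[OF e]) (use V in auto)
    then show ?thesis using V unfolding Ye sets_restrict_space by auto
  qed
  then have "sigma_sets (space Y_measure) {U. openin circle U} \<subseteq> sets Y_measure"
    by (intro sets.sigma_sets_subset) auto
  then show "sets (borel_of circle) \<subseteq> sets Y_measure"
    by (simp add: sets_borel_of)
  interpret C: sigma_algebra "{0..<1::real}" "sets (borel_of circle)"
    using sets.sigma_algebra_axioms[of "borel_of circle"] by (simp add: space_borel_of)
  have opn: "W \<in> sets (borel_of circle)" if "openin circle W" for W
    using that by (auto simp: sets_borel_of)
  have zero: "{0} \<in> sets (borel_of circle)"
  proof -
    have "\<And>t::real. t \<in> {0..<1} \<Longrightarrow> ?e t = 1 \<Longrightarrow> t = 0"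
    proof -
      fix t :: real assume t: "t \<in> {0..<1}" "?e t = 1"
      then have "cos (2 * pi * t) = 1" by (metis cis.simps(1) one_complex.simps(1))
      then obtain n :: int where n: "2 * pi * t = of_int n * 2 * pi"
        by (auto simp: cos_one_2pi_int)
      then have "t = of_int n" by simp
      with t(1) show "t = 0" by auto
    qed
    then have eq: "{0..<1} - {0} = ?e -` (- {1}) \<inter> {0..<1}" by auto
    have "openin circle ({0..<1} - {0})"
      unfolding eq circle_def openin_pullback_topology by (rule exI[of _ "- {1}"]) auto
    from C.compl_sets[OF opn[OF this]] show ?thesis
      by (simp add: double_diff)
  qed
  have main: "W \<inter> {0..<1} \<in> sets (borel_of circle)" if W: "open W" for W :: "real set"
  proof -
    let ?g = "\<lambda>z. Arg2pi z / (2 * pi)"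
    have cont: "continuous_on (- \<real>\<^sub>\<ge>\<^sub>0) ?g"
      by (intro continuous_at_imp_continuous_on ballI continuous_intros continuous_at_Arg2pi) auto
    have "open (- (\<real>\<^sub>\<ge>\<^sub>0 :: complex set))" by (simp add: closed_nonneg_Reals_complex open_Compl)
    then have opV: "open (?g -` W \<inter> - \<real>\<^sub>\<ge>\<^sub>0)"
      using cont W by (subst Int_commute) (rule continuous_open_preimage)
    have arg: "?g (?e t) = t" if "t \<in> {0..<1}" for t
    proof -
      have "Arg2pi (?e t) = 2 * pi * t"
        by (rule Arg2pi_unique[of 1]) (use that in \<open>auto simp: cis_conv_exp mult.commute\<close>)
      then show ?thesis by simp
    qed
    have nr: "?e t \<in> \<real>\<^sub>\<ge>\<^sub>0 \<longleftrightarrow> t = 0" if "t \<in> {0..<1}" for t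
    proof
      assume "?e t \<in> \<real>\<^sub>\<ge>\<^sub>0"
      then have "Arg2pi (?e t) = 0"
        unfolding Arg2pi_eq_0 by (metis complex_is_Real_iff complex_nonneg_Reals_iff)
      with arg[OF that] show "t = 0" by simp
    qed auto
    have "W \<inter> {0<..<1} = ?e -` (?g -` W \<inter> - \<real>\<^sub>\<ge>\<^sub>0) \<inter> {0..<1}"
      using arg nr by fastforce
    then have "openin circle (W \<inter> {0<..<1})"
      using opV by (auto simp: circle_def openin_pullback_topology)
    then have 1: "W \<inter> {0<..<1} \<in> sets (borel_of circle)" by (rule opn)
    have 2: "W \<inter> {0} \<in> sets (borel_of circle)"
      using zero by (cases "0 \<in> W") auto
    have "W \<inter> {0..<1} = (W \<inter> {0<..<1}) \<union> (W \<inter> {0})" by auto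
    then show ?thesis using 1 2 by auto
  qed
  have "id \<in> borel_of circle \<rightarrow>\<^sub>M (borel :: real measure)"
    by (rule borel_measurableI) (use main in \<open>auto simp: space_borel_of\<close>)
  then have "A \<inter> {0..<1} \<in> sets (borel_of circle)" if "A \<in> sets borel" for A :: "real set"
    using measurable_sets[of id "borel_of circle" borel A] that by (simp add: space_borel_of)
  then show "sets Y_measure \<subseteq> sets (borel_of circle)"
    unfolding Ye sets_restrict_space by (auto simp: Int_commute)
qed

lemma gaction_zero:
  assumes T: "gaction Y_measure T"
  shows "AE x in Y_measure. T 0 x = x"
proof -
  have m: "T 0 \<in> Y_measure \<rightarrow>\<^sub>M Y_measure" and d: "distr Y_measure Y_measure (T 0) = Y_measure"
    using T by (auto simp: gaction_def measure_preserving_def)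
  have idm: "(\<lambda>x. x) \<in> Y_measure \<rightarrow>\<^sub>M (borel :: real measure)"
    by (simp add: Y_measure_def measurable_restrict_space1)
  have m': "T 0 \<in> Y_measure \<rightarrow>\<^sub>M (borel :: real measure)"
    using measurable_compose[OF m idm] by simp
  have P: "{x \<in> space Y_measure. T 0 x = x} \<in> sets Y_measure"
    using borel_measurable_eq[OF m' idm] by simp
  have "AE x in Y_measure. T (0 + 0) x = T 0 (T 0 x)"
    using T unfolding gaction_def by blast
  then have "AE x in Y_measure. T 0 (T 0 x) = T 0 x" by auto
  then have "AE x in distr Y_measure Y_measure (T 0). T 0 x = x"
    by (subst AE_distr_iff[OF m P])
  then show ?thesis unfolding d .
qed

lemma limitin_topology_generated_by:
  "limitin (topology_generated_by \<S>) f l F \<longleftrightarrow>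
     l \<in> \<Union>\<S> \<and> (\<forall>U\<in>\<S>. l \<in> U \<longrightarrow> eventually (\<lambda>i. f i \<in> U) F)"
proof
  assume "limitin (topology_generated_by \<S>) f l F"
  then show "l \<in> \<Union>\<S> \<and> (\<forall>U\<in>\<S>. l \<in> U \<longrightarrow> eventually (\<lambda>i. f i \<in> U) F)"
    by (auto simp: limitin_def intro: topology_generated_by_Basis)
next
  assume R: "l \<in> \<Union>\<S> \<and> (\<forall>U\<in>\<S>. l \<in> U \<longrightarrow> eventually (\<lambda>i. f i \<in> U) F)"
  have "l \<in> U \<longrightarrow> eventually (\<lambda>i. f i \<in> U) F" if "generate_topology_on \<S> U" for U
    using that
  proof induction
    case (UN K)
    show ?case
    proof
      assume "l \<in> \<Union>K"
      then obtain k where k: "k \<in> K" "l \<in> k" by auto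
      with UN have "eventually (\<lambda>i. f i \<in> k) F" by auto
      then show "eventually (\<lambda>i. f i \<in> \<Union>K) F" by (rule eventually_mono) (use k in auto)
    qed
  qed (use R in \<open>auto intro: eventually_conj\<close>)
  then show "limitin (topology_generated_by \<S>) f l F"
    using R by (auto simp: limitin_def openin_topology_generated_by_iff)
qed

lemma ae_equal_equiv:
  "equiv {T :: 'g::{group_add,countable} \<Rightarrow> real \<Rightarrow> real. gaction Y_measure T} ae_equal"
proof (rule equivI)
  show "trans (ae_equal :: (('g \<Rightarrow> real \<Rightarrow> real) \<times> _) set)"
  proof (rule transI)
    fix T R Q :: "'g \<Rightarrow> real \<Rightarrow> real"
    assume *: "(T, R) \<in> ae_equal" "(R, Q) \<in> ae_equal"
    have "AE x in Y_measure. T \<gamma> x = Q \<gamma> x" for \<gamma>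
    proof -
      have "AE x in Y_measure. T \<gamma> x = R \<gamma> x" "AE x in Y_measure. R \<gamma> x = Q \<gamma> x"
        using * by (auto simp: ae_equal_def)
      then show ?thesis by eventually_elim simp
    qed
    then show "(T, Q) \<in> ae_equal" using * by (auto simp: ae_equal_def)
  qed
  show "sym (ae_equal :: (('g \<Rightarrow> real \<Rightarrow> real) \<times> _) set)"
  proof (rule symI)
    fix T R :: "'g \<Rightarrow> real \<Rightarrow> real"
    assume *: "(T, R) \<in> ae_equal"
    have "AE x in Y_measure. R \<gamma> x = T \<gamma> x" for \<gamma>
    proof -
      have "AE x in Y_measure. T \<gamma> x = R \<gamma> x"
        using * by (auto simp: ae_equal_def)
      then show ?thesis by eventually_elim simp
    qed
    then show "(R, T) \<in> ae_equal" using * by (auto simp: ae_equal_def)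
  qed
qed (auto simp: ae_equal_def refl_on_def)

lemma rep_in:
  assumes "c \<in> Y_actions"
  shows "rep c \<in> c"
proof -
  have "c \<noteq> {}"
    using assms in_quotient_imp_non_empty[OF ae_equal_equiv] by (simp add: Y_actions_def)
  then show ?thesis
    unfolding rep_def by (simp add: some_in_eq)
qed

lemma gaction_rep:
  assumes "c \<in> Y_actions"
  shows "gaction Y_measure (rep c)"
proof -
  have "c \<subseteq> {T. gaction Y_measure T}"
    using assms in_quotient_imp_subset[OF ae_equal_equiv] by (simp add: Y_actions_def)
  then show ?thesis
    using rep_in[OF assms] by auto
qed

lemma ae_equal_rep:
  assumes "c \<in> Y_actions" "T \<in> c"
  shows "AE x in Y_measure. rep c \<gamma> x = T \<gamma> x"
proof -
  have "(rep c, T) \<in> ae_equal"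
    using assms rep_in[of c] in_quotient_imp_in_rel[OF ae_equal_equiv, of c "rep c" T]
    by (auto simp: Y_actions_def)
  then show ?thesis by (auto simp: ae_equal_def)
qed

lemma coarse_dist_representatives:
  assumes c: "c \<in> Y_actions" "T \<in> c" and d: "d \<in> Y_actions" "R \<in> d" and E: "E \<in> sets Y_measure"
  shows "coarse_dist \<gamma> E c d =
     measure Y_measure (sym_diff (T \<gamma> -` E \<inter> space Y_measure) (R \<gamma> -` E \<inter> space Y_measure))"
proof -
  have sub: "c \<subseteq> {T. gaction Y_measure T}" "d \<subseteq> {T. gaction Y_measure T}"
    using c(1) d(1) in_quotient_imp_subset[OF ae_equal_equiv] by (auto simp: Y_actions_def)
  have ms: "Q \<gamma> -` E \<inter> space Y_measure \<in> sets Y_measure" if "gaction Y_measure Q" for Q :: "'a \<Rightarrow> real \<Rightarrow> real"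
    using that E by (intro measurable_sets) (auto simp: gaction_def measure_preserving_def)
  have ga: "gaction Y_measure T" "gaction Y_measure R" using sub c d by auto
  note ga' = gaction_rep[OF c(1)] gaction_rep[OF d(1)]
  have "AE x in Y_measure.
      (x \<in> sym_diff (rep c \<gamma> -` E \<inter> space Y_measure) (rep d \<gamma> -` E \<inter> space Y_measure)) =
      (x \<in> sym_diff (T \<gamma> -` E \<inter> space Y_measure) (R \<gamma> -` E \<inter> space Y_measure))"
    using ae_equal_rep[OF c, of \<gamma>] ae_equal_rep[OF d, of \<gamma>] by eventually_elim auto
  then show ?thesis
    unfolding coarse_dist_def
    by (rule measure_eq_AE)
       (intro sets.Un sets.Diff ms ga ga')+
qed

lemma isomorphic_rep:
  assumes "c \<in> Y_actions" "T \<in> c"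
  shows "isomorphic (Real_System Y_measure (rep c)) (Real_System Y_measure T)"
proof -
  have "AE x in Y_measure. T \<gamma> x = rep c \<gamma> x" for \<gamma>
    using ae_equal_rep[OF assms, of \<gamma>] by eventually_elim simp
  moreover have "measure_preserving Y_measure Y_measure (\<lambda>x. x)"
    by (simp add: measure_preserving_def distr_id2)
  ultimately show ?thesis
    unfolding isomorphic.simps isomorphic_actions_def
    by (intro exI[of _ "\<lambda>x. x"]) simp
qed

lemma coarse_dist_self [simp]: "coarse_dist \<gamma> E c c = 0"
  by (simp add: coarse_dist_def)

lemma topspace_coarse_topology [simp]: 
  "topspace coarse_topology = (Y_actions :: ('g::{group_add,countable} \<Rightarrow> real \<Rightarrow> real) set set)"
proof
  show "topspace coarse_topology \<subseteq> (Y_actions :: ('g \<Rightarrow> real \<Rightarrow> real) set set)"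
    unfolding coarse_topology_def topology_generated_by_topspace by blast
  show "(Y_actions :: ('g \<Rightarrow> real \<Rightarrow> real) set set) \<subseteq> topspace coarse_topology"
  proof
    fix c :: "('g \<Rightarrow> real \<Rightarrow> real) set"
    assume c: "c \<in> Y_actions"
    have "openin coarse_topology {c' \<in> Y_actions. coarse_dist 0 {} c' c < 1}"
      unfolding coarse_topology_def
      by (rule topology_generated_by_Basis) (use c zero_less_one in blast)
    moreover have "c \<in> {c' \<in> Y_actions. coarse_dist 0 {} c' c < 1}" using c by simp
    ultimately show "c \<in> topspace coarse_topology" using openin_subset by blast
  qed
qed

lemma coarse_dist_triangle:
  assumes "c \<in> Y_actions" "d \<in> Y_actions" "e \<in> Y_actions" and E: "E \<in> sets Y_measure"
  shows "coarse_dist \<gamma> E c e \<le> coarse_dist \<gamma> E c d + coarse_dist \<gamma> E d e"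
proof -
  interpret prob_space Y_measure by (rule prob_space_Y_measure)
  have [measurable]: "rep q \<gamma> -` E \<inter> space Y_measure \<in> sets Y_measure" if "q \<in> Y_actions" for q
    using gaction_rep[OF that] E
    by (intro measurable_sets) (auto simp: gaction_def measure_preserving_def)
  define A B C where "A = rep c \<gamma> -` E \<inter> space Y_measure"
    and "B = rep d \<gamma> -` E \<inter> space Y_measure" and "C = rep e \<gamma> -` E \<inter> space Y_measure"
  have s: "A \<in> sets Y_measure" "B \<in> sets Y_measure" "C \<in> sets Y_measure"
    using assms unfolding A_def B_def C_def by measurable
  have "measure Y_measure (sym_diff A C) \<le> measure Y_measure (sym_diff A B \<union> sym_diff B C)"
    by (rule finite_measure_mono) (use s in auto)
  also have "\<dots> \<le> measure Y_measure (sym_diff A B) + measure Y_measure (sym_diff B C)"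
    by (rule measure_Un_le) (use s in auto)
  finally show ?thesis by (simp add: coarse_dist_def A_def B_def C_def)
qed

lemma limitin_coarse_topology:
  "limitin coarse_topology c d F \<longleftrightarrow>
     d \<in> Y_actions \<and> eventually (\<lambda>i. c i \<in> Y_actions) F \<and>
     (\<forall>\<gamma>. \<forall>E\<in>sets Y_measure. ((\<lambda>i. coarse_dist \<gamma> E (c i) d) \<longlongrightarrow> 0) F)"
proof safe
  assume L: "limitin coarse_topology c d F"
  then show d: "d \<in> Y_actions"
    using limitin_topspace by fastforce
  show "eventually (\<lambda>i. c i \<in> Y_actions) F"
    using L d openin_topspace[of coarse_topology] unfolding limitin_def by auto
  fix \<gamma> :: 'a and E assume E: "E \<in> sets Y_measure"
  show "((\<lambda>i. coarse_dist \<gamma> E (c i) d) \<longlongrightarrow> 0) F"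
  proof (rule tendstoI)
    fix \<epsilon> :: real assume "0 < \<epsilon>"
    then have "openin coarse_topology {c \<in> Y_actions. coarse_dist \<gamma> E c d < \<epsilon>}"
      unfolding coarse_topology_def using E d by (intro topology_generated_by_Basis) blast
    then have "eventually (\<lambda>i. c i \<in> {c \<in> Y_actions. coarse_dist \<gamma> E c d < \<epsilon>}) F"
      using L d \<open>0 < \<epsilon>\<close> unfolding limitin_def by auto
    then show "eventually (\<lambda>i. dist (coarse_dist \<gamma> E (c i) d) 0 < \<epsilon>) F"
      by eventually_elim (simp add: coarse_dist_def)
  qed
next
  assume d: "d \<in> Y_actions" and ev: "eventually (\<lambda>i. c i \<in> Y_actions) F"
    and lim: "\<forall>\<gamma>. \<forall>E\<in>sets Y_measure. ((\<lambda>i. coarse_dist \<gamma> E (c i) d) \<longlongrightarrow> 0) F"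
  have "eventually (\<lambda>i. c i \<in> {c \<in> Y_actions. coarse_dist \<gamma> E c e < \<epsilon>}) F"
    if E: "E \<in> sets Y_measure" and e: "e \<in> Y_actions" and less: "coarse_dist \<gamma> E d e < \<epsilon>"
    for \<gamma> E e \<epsilon>
  proof -
    have "eventually (\<lambda>i. coarse_dist \<gamma> E (c i) d < \<epsilon> - coarse_dist \<gamma> E d e) F"
      using lim E less by (intro order_tendstoD(2)[where y = 0]) auto
    with ev show ?thesis
    proof eventually_elim
      case (elim i)
      then show ?case using coarse_dist_triangle[OF elim(1) d e E, of \<gamma>] by auto
    qed
  qed
  moreover have "d \<in> topspace coarse_topology" using d by simp
  ultimately show "limitin coarse_topology c d F"
    unfolding coarse_topology_def limitin_topology_generated_by topology_generated_by_topspace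
    by auto
qed

lemma topspace_Y_hat: "topspace Y_hat = (UNIV :: 'g set) \<rightarrow>\<^sub>E {0..<1}"
  by (simp add: Y_hat_def)

lemma continuous_map_shift: "continuous_map Y_hat Y_hat (coord_shift \<alpha>)"
  unfolding Y_hat_def coord_shift_def
  by (subst continuous_map_componentwise)
     (auto intro!: continuous_map_product_projection)

lemma topspace_weak_star_topology [simp]: "topspace weak_star_topology = SIM"
proof -
  have "SIM \<in> {{\<mu> \<in> SIM. (\<integral>y. f y \<partial>\<mu>) \<in> U} | f U.
          continuous_map Y_hat euclideanreal f \<and> open U}"
    by (rule CollectI, rule exI[of _ "\<lambda>_. 0"], rule exI[of _ UNIV]) auto
  then show ?thesis
    unfolding weak_star_topology_def topology_generated_by_topspace by blast
qed

lemma limitin_weak_star_topology: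
  "limitin weak_star_topology \<mu> \<nu> F \<longleftrightarrow>
     \<nu> \<in> SIM \<and> eventually (\<lambda>i. \<mu> i \<in> SIM) F \<and>
     (\<forall>f. continuous_map Y_hat euclideanreal f \<longrightarrow>
        ((\<lambda>i. \<integral>y. f y \<partial>\<mu> i) \<longlongrightarrow> (\<integral>y. f y \<partial>\<nu>)) F)"
proof safe
  assume L: "limitin weak_star_topology \<mu> \<nu> F"
  then show n: "\<nu> \<in> SIM"
    using limitin_topspace by fastforce
  show "eventually (\<lambda>i. \<mu> i \<in> SIM) F"
    using L n openin_topspace[of weak_star_topology] unfolding limitin_def by auto
  fix f :: "('a \<Rightarrow> real) \<Rightarrow> real" assume f: "continuous_map Y_hat euclideanreal f"
  show "((\<lambda>i. \<integral>y. f y \<partial>\<mu> i) \<longlongrightarrow> (\<integral>y. f y \<partial>\<nu>)) F"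
  proof (rule topological_tendstoI)
    fix U :: "real set" assume U: "open U" "(\<integral>y. f y \<partial>\<nu>) \<in> U"
    then have "openin weak_star_topology {\<mu> \<in> SIM. (\<integral>y. f y \<partial>\<mu>) \<in> U}"
      unfolding weak_star_topology_def using f by (intro topology_generated_by_Basis) blast
    then have "eventually (\<lambda>i. \<mu> i \<in> {\<mu> \<in> SIM. (\<integral>y. f y \<partial>\<mu>) \<in> U}) F"
      using L n U unfolding limitin_def by auto
    then show "eventually (\<lambda>i. (\<integral>y. f y \<partial>\<mu> i) \<in> U) F"
      by eventually_elim simp
  qed
next
  assume n: "\<nu> \<in> SIM" and ev: "eventually (\<lambda>i. \<mu> i \<in> SIM) F"
    and lim: "\<forall>f. continuous_map Y_hat euclideanreal f \<longrightarrow>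
        ((\<lambda>i. \<integral>y. f y \<partial>\<mu> i) \<longlongrightarrow> (\<integral>y. f y \<partial>\<nu>)) F"
  have "eventually (\<lambda>i. \<mu> i \<in> {\<mu> \<in> SIM. (\<integral>y. f y \<partial>\<mu>) \<in> U}) F"
    if f: "continuous_map Y_hat euclideanreal f" and U: "open U" "(\<integral>y. f y \<partial>\<nu>) \<in> U" for f U
  proof -
    have "eventually (\<lambda>i. (\<integral>y. f y \<partial>\<mu> i) \<in> U) F"
      using lim f U by (auto dest: topological_tendstoD)
    with ev show ?thesis by eventually_elim simp
  qed
  moreover have "\<nu> \<in> topspace weak_star_topology" using n by simp
  ultimately show "limitin weak_star_topology \<mu> \<nu> F"
    unfolding weak_star_topology_def limitin_topology_generated_by topology_generated_by_topspace
    by auto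
qed

lemma is_action_Y_setting:
  "c \<in> topspace (fst Y_setting) \<Longrightarrow> is_action (snd Y_setting c)"
  by (simp add: Y_setting_def gaction_rep)

lemma is_action_SIM_setting:
  assumes "\<mu> \<in> topspace (fst SIM_setting)"
  shows "is_action (snd SIM_setting \<mu>)"
proof -
  have m: "\<mu> \<in> SIM" using assms by (simp add: SIM_setting_def)
  then have s: "\<And>\<alpha>. coord_shift \<alpha> \<in> \<mu> \<rightarrow>\<^sub>M \<mu>" by (auto simp: SIM_def measure_preserving_def)
  have "(\<lambda>(\<gamma>, x). coord_shift \<gamma> x) \<in> count_space UNIV \<Otimes>\<^sub>M \<mu> \<rightarrow>\<^sub>M \<mu>"
    by (rule measurable_pair_measure_countable1) (use s in auto)
  then show ?thesis
    using m by (simp add: SIM_setting_def gaction_def SIM_def coord_shift_def add.assoc)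
qed

end

(* An action c on [0,1) together with a continuous distribution function F yields the law of
   t |-> (Q (T^g t))_g, where T represents c and Q is the quantile function of F.  Since Q is
   injective, this shift-invariant measure is isomorphic to c, and F and c can be recovered from
   it, even topologically: the map (F, c) |-> law is a homeomorphism onto a set D of invariant
   measures.  D consists of the measures with atomless zeroth marginal under which the zeroth
   coordinate determines all others modulo null sets; each of these two conditions is a countable
   intersection of open ones.  D is dense: multiply a given invariant measure by Lebesgue measure,
   on which the group acts trivially, and perturb the zeroth coordinate slightly so that it encodes
   the whole point.  So D is residual.  On D an invariant property depends only on c, that is, it
   cuts out a cylinder over the corresponding set of actions, and the space of distribution
   functions is second countable and completely metrizable, so a Kuratowski--Ulam argument
   transfers Baire category between the cylinder and its base. *)

theory Submission
  imports Defs
begin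

section \<open>Meager sets\<close>

text \<open>A single distribution function would yield only measures with one prescribed zeroth
  marginal, too few for a residual set; hence F is a second parameter. Continuity of F is what makes
  the quantile function injective; flat pieces of F, where the quantile function jumps, are allowed.

  All category arguments rest on the factor of distribution functions: the section argument asks for
  countability and the Baire property of one factor only, and the coarse topology enters through its
  limits alone. Limits are therefore taken along arbitrary filters.

  The obstacle in recovering F is the gluing of 0 and 1: a test function on the circle has equal
  values at both ends, so it cannot tell mass near 0 from mass near 1. Continuity of the limiting F
  at 0 and 1 rules out a loss of mass there. The obstacle in recovering c is that coarse convergence
  concerns measurable sets and weak-* convergence continuous functions. Sets are replaced by
  Lipschitz functions of the quantile, since the effect of varying F is controlled in L1.\<close>

text \<open>Removing the closure of \<open>S\<close> from an open set leaves an open set that misses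
  \<open>S\<close>. In this form nowhere density passes to subspaces, images and products by
  shrinking open sets, without computing any closure there.\<close>

lemma nowhere_dense_in_iff_open_subset:
  "nowhere_dense_in X S \<longleftrightarrow> S \<subseteq> topspace X \<and>
     (\<forall>U. openin X U \<and> U \<noteq> {} \<longrightarrow> (\<exists>V. openin X V \<and> V \<noteq> {} \<and> V \<subseteq> U \<and> V \<inter> S = {}))"
proof (intro iffI conjI allI impI)
  assume nd: "nowhere_dense_in X S"
  then show "S \<subseteq> topspace X" by (simp add: nowhere_dense_in_def)
  fix U assume U: "openin X U \<and> U \<noteq> {}"
  have "U - X closure_of S \<noteq> {}"
    using nd U interior_of_maximal[of U "X closure_of S" X] by (auto simp: nowhere_dense_in_def)
  moreover have "openin X (U - X closure_of S)" using U by (simp add: openin_diff)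
  moreover have "(U - X closure_of S) \<inter> S = {}"
    using nd closure_of_subset[of S X] by (auto simp: nowhere_dense_in_def)
  ultimately show "\<exists>V. openin X V \<and> V \<noteq> {} \<and> V \<subseteq> U \<and> V \<inter> S = {}" by blast
next
  assume R: "S \<subseteq> topspace X \<and>
     (\<forall>U. openin X U \<and> U \<noteq> {} \<longrightarrow> (\<exists>V. openin X V \<and> V \<noteq> {} \<and> V \<subseteq> U \<and> V \<inter> S = {}))"
  have "X interior_of (X closure_of S) = {}"
  proof (rule ccontr)
    assume "X interior_of (X closure_of S) \<noteq> {}"
    then obtain V where V: "openin X V" "V \<noteq> {}" "V \<subseteq> X interior_of (X closure_of S)" "V \<inter> S = {}"
      using R openin_interior_of by metis
    then have "V \<inter> X closure_of S = {}" by (simp add: openin_Int_closure_of_eq_empty)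
    with V interior_of_subset[of X "X closure_of S"] show False by auto
  qed
  then show "nowhere_dense_in X S" using R by (simp add: nowhere_dense_in_def)
qed

lemma not_nowhere_dense_inE:
  assumes "\<not> nowhere_dense_in X S" "S \<subseteq> topspace X"
  obtains U where "openin X U" "U \<noteq> {}"
    "\<And>V. openin X V \<Longrightarrow> V \<noteq> {} \<Longrightarrow> V \<subseteq> U \<Longrightarrow> V \<inter> S \<noteq> {}"
proof -
  have "\<not> (\<forall>U. openin X U \<and> U \<noteq> {} \<longrightarrow> (\<exists>V. openin X V \<and> V \<noteq> {} \<and> V \<subseteq> U \<and> V \<inter> S = {}))"
    using assms unfolding nowhere_dense_in_iff_open_subset by simp
  then obtain U where "openin X U \<and> U \<noteq> {}"
    "\<not> (\<exists>V. openin X V \<and> V \<noteq> {} \<and> V \<subseteq> U \<and> V \<inter> S = {})" by auto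
  then show thesis by (intro that[of U]) auto
qed

lemma nowhere_dense_in_subset:
  "nowhere_dense_in X S \<Longrightarrow> S' \<subseteq> S \<Longrightarrow> nowhere_dense_in X S'"
  unfolding nowhere_dense_in_def
  using interior_of_mono[OF closure_of_mono[of S' S X], of X] by auto

lemma nowhere_dense_in_closure_of:
  "nowhere_dense_in X S \<Longrightarrow> nowhere_dense_in X (X closure_of S)"
  by (simp add: nowhere_dense_in_def closure_of_subset_topspace)

lemma meager_in_subset:
  assumes "meager_in X S" "S' \<subseteq> S"
  shows "meager_in X S'"
proof -
  obtain N :: "nat \<Rightarrow> _" where N: "\<And>n. nowhere_dense_in X (N n)" "S = (\<Union>n. N n)"
    using assms by (auto simp: meager_in_def)
  show ?thesis unfolding meager_in_def
    by (rule exI[of _ "\<lambda>n. N n \<inter> S'"])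
       (use N assms in \<open>auto intro: nowhere_dense_in_subset\<close>)
qed

lemma nowhere_dense_in_imp_meager_in: "nowhere_dense_in X S \<Longrightarrow> meager_in X S"
  unfolding meager_in_def by (rule exI[of _ "\<lambda>_. S"]) auto

lemma meager_in_empty [simp]: "meager_in X {}"
  by (rule nowhere_dense_in_imp_meager_in) (simp add: nowhere_dense_in_def)

lemma meager_in_UN:
  assumes "countable I" "\<And>i. i \<in> I \<Longrightarrow> meager_in X (S i)"
  shows "meager_in X (\<Union>i\<in>I. S i)"
proof (cases "I = {}")
  case False
  have "\<forall>i\<in>I. \<exists>N :: nat \<Rightarrow> _. (\<forall>n. nowhere_dense_in X (N n)) \<and> S i = (\<Union>n. N n)"
    using assms(2) by (simp add: meager_in_def)
  then obtain N :: "_ \<Rightarrow> nat \<Rightarrow> _"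
    where N: "\<And>i n. i \<in> I \<Longrightarrow> nowhere_dense_in X (N i n)" "\<And>i. i \<in> I \<Longrightarrow> S i = (\<Union>n. N i n)"
    by metis
  \<comment> \<open>One natural number encodes a pair: an index in \<open>I\<close>, enumerated
    possibly with repetitions (hence \<open>I\<close> nonempty), and a piece of that member.\<close>
  let ?N = "\<lambda>k. case prod_decode k of (a, b) \<Rightarrow> N (from_nat_into I a) b"
  have "(\<Union>i\<in>I. S i) = (\<Union>k. ?N k)"
  proof (intro equalityI subsetI)
    fix x assume "x \<in> (\<Union>i\<in>I. S i)"
    then obtain i where "i \<in> I" "x \<in> S i" by (rule UN_E)
    then obtain n where "x \<in> N i n" using N by auto
    moreover obtain a where "from_nat_into I a = i"
      using from_nat_into_surj[OF assms(1) \<open>i \<in> I\<close>] by auto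
    ultimately have "x \<in> ?N (prod_encode (a, n))" by simp
    then show "x \<in> (\<Union>k. ?N k)" by (intro UN_I[OF UNIV_I])
  next
    fix x assume "x \<in> (\<Union>k. ?N k)"
    then obtain k where x: "x \<in> ?N k" by (rule UN_E)
    obtain a b where ab: "prod_decode k = (a, b)" by fastforce
    have i: "from_nat_into I a \<in> I" by (rule from_nat_into[OF False])
    have "x \<in> S (from_nat_into I a)" using x unfolding ab N(2)[OF i] by auto
    then show "x \<in> (\<Union>i\<in>I. S i)" by (rule UN_I[OF i])
  qed
  moreover have "nowhere_dense_in X (?N k)" for k
    by (cases "prod_decode k") (simp add: N(1) from_nat_into[OF False])
  ultimately show ?thesis unfolding meager_in_def by (intro exI[of _ ?N] conjI allI)
qed auto

lemma meager_in_Un: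
  assumes "meager_in X S" "meager_in X S'"
  shows "meager_in X (S \<union> S')"
proof -
  have "meager_in X (\<Union>T\<in>{S, S'}. T)" by (rule meager_in_UN) (use assms in auto)
  then show ?thesis by simp
qed

text \<open>Symmetric difference with \<open>V\<close> is an involution, so the meager set in the
  definition is determined by \<open>S\<close> and \<open>V\<close>.\<close>

lemma Baire_set_in_iff_meager_sym_diff:
  "Baire_set_in X S \<longleftrightarrow> (\<exists>V. openin X V \<and> meager_in X (sym_diff S V))"
proof
  assume "Baire_set_in X S"
  then obtain V M where V: "openin X V" "meager_in X M" "S = sym_diff V M"
    by (auto simp: Baire_set_in_def)
  then have "sym_diff S V = M" by auto
  with V show "\<exists>V. openin X V \<and> meager_in X (sym_diff S V)" by auto
next
  assume "\<exists>V. openin X V \<and> meager_in X (sym_diff S V)"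
  then obtain V where V: "openin X V" "meager_in X (sym_diff S V)" by blast
  have "S = sym_diff V (sym_diff S V)" by auto
  with V show "Baire_set_in X S" unfolding Baire_set_in_def by blast
qed

section \<open>Meager sets in subspaces, dense subspaces and homeomorphic images\<close>

text \<open>An open set that misses \<open>D\<close> misses every subset of \<open>D\<close>. One
  that meets \<open>D\<close> is shrunk inside \<open>D\<close>, and the smaller trace is extended
  to an open set of \<open>X\<close> and cut down to the given one.\<close>

lemma meager_in_subtopology_imp:
  assumes "meager_in (subtopology X D) S"
  shows "meager_in X S"
proof -
  have "nowhere_dense_in X N" if N: "nowhere_dense_in (subtopology X D) N" for N
    unfolding nowhere_dense_in_iff_open_subset
  proof (intro conjI allI impI)
    show "N \<subseteq> topspace X" using N by (auto simp: nowhere_dense_in_def)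
    fix U assume U: "openin X U \<and> U \<noteq> {}"
    show "\<exists>V. openin X V \<and> V \<noteq> {} \<and> V \<subseteq> U \<and> V \<inter> N = {}"
    proof (cases "U \<inter> D = {}")
      case True
      then have "U \<inter> N = {}" using N by (auto simp: nowhere_dense_in_def)
      then show ?thesis using U by auto
    next
      case False
      have "openin (subtopology X D) (U \<inter> D)"
        using U by (auto simp: openin_subtopology)
      then obtain V where V: "openin (subtopology X D) V" "V \<noteq> {}" "V \<subseteq> U \<inter> D" "V \<inter> N = {}"
        using N False unfolding nowhere_dense_in_iff_open_subset by meson
      then obtain W where W: "openin X W" "V = W \<inter> D" by (auto simp: openin_subtopology)
      have "N \<subseteq> D" using N by (auto simp: nowhere_dense_in_def)
      then have "W \<inter> U \<inter> N = {}" "W \<inter> U \<noteq> {}" using V W by auto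
      then show ?thesis using U W by (intro exI[of _ "W \<inter> U"]) auto
    qed
  qed
  then show ?thesis using assms unfolding meager_in_def by metis
qed

text \<open>The open set found in \<open>X\<close> must keep a nonempty trace on \<open>D\<close>;
  this is where density enters.\<close>

lemma meager_in_dense_subtopology:
  assumes M: "meager_in X S"
    and dense: "\<And>U. openin X U \<Longrightarrow> U \<noteq> {} \<Longrightarrow> U \<inter> D \<noteq> {}"
  shows "meager_in (subtopology X D) (S \<inter> D)"
proof -
  have nd: "nowhere_dense_in (subtopology X D) (N \<inter> D)" if N: "nowhere_dense_in X N" for N
    unfolding nowhere_dense_in_iff_open_subset
  proof (intro conjI allI impI)
    show "N \<inter> D \<subseteq> topspace (subtopology X D)" using N by (auto simp: nowhere_dense_in_def)
    fix U' assume "openin (subtopology X D) U' \<and> U' \<noteq> {}"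
    then obtain U where U: "openin X U" "U' = U \<inter> D" "U \<noteq> {}" by (auto simp: openin_subtopology)
    then obtain V where V: "openin X V" "V \<noteq> {}" "V \<subseteq> U" "V \<inter> N = {}"
      using N unfolding nowhere_dense_in_iff_open_subset by meson
    show "\<exists>V. openin (subtopology X D) V \<and> V \<noteq> {} \<and> V \<subseteq> U' \<and> V \<inter> (N \<inter> D) = {}"
      by (rule exI[of _ "V \<inter> D"])
         (use V U dense[OF V(1,2)] in \<open>auto simp: openin_subtopology\<close>)
  qed
  obtain N :: "nat \<Rightarrow> _" where N: "\<And>n. nowhere_dense_in X (N n)" "S = (\<Union>n. N n)"
    using M by (auto simp: meager_in_def)
  show ?thesis unfolding meager_in_def
    by (rule exI[of _ "\<lambda>n. N n \<inter> D"]) (use N nd in auto)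
qed

lemma meager_in_homeomorphic_image:
  assumes h: "homeomorphic_map X Y h" and M: "meager_in X S"
  shows "meager_in Y (h ` S)"
proof -
  have nd: "nowhere_dense_in Y (h ` N)" if N: "nowhere_dense_in X N" for N
    unfolding nowhere_dense_in_iff_open_subset
  proof (intro conjI allI impI)
    have surj: "h ` topspace X = topspace Y" and inj: "inj_on h (topspace X)"
      and cont: "continuous_map X Y h" and op: "open_map X Y h"
      using homeomorphic_imp_surjective_map[OF h] homeomorphic_imp_injective_map[OF h]
        homeomorphic_imp_continuous_map[OF h] homeomorphic_imp_open_map[OF h] by auto
    have NX: "N \<subseteq> topspace X" using N by (simp add: nowhere_dense_in_def)
    then show "h ` N \<subseteq> topspace Y" using surj by auto
    fix U assume U: "openin Y U \<and> U \<noteq> {}"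
    let ?U = "{x \<in> topspace X. h x \<in> U}"
    have "openin X ?U" using cont U by (simp add: openin_continuous_map_preimage)
    moreover have "?U \<noteq> {}"
    proof -
      obtain y where y: "y \<in> U" using U by auto
      then have "y \<in> h ` topspace X" using U surj openin_subset[of Y U] by auto
      then show ?thesis using y by auto
    qed
    ultimately obtain V where V: "openin X V" "V \<noteq> {}" "V \<subseteq> ?U" "V \<inter> N = {}"
      using N unfolding nowhere_dense_in_iff_open_subset by meson
    have "h ` V \<inter> h ` N = h ` (V \<inter> N)"
      using inj NX V openin_subset[OF V(1)] by (intro inj_on_image_Int[symmetric]) auto
    then show "\<exists>V. openin Y V \<and> V \<noteq> {} \<and> V \<subseteq> U \<and> V \<inter> h ` N = {}"
      using V op by (intro exI[of _ "h ` V"]) (auto simp: open_map_def)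
  qed
  obtain N :: "nat \<Rightarrow> _" where N: "\<And>n. nowhere_dense_in X (N n)" "S = (\<Union>n. N n)"
    using M by (auto simp: meager_in_def)
  show ?thesis unfolding meager_in_def
    by (rule exI[of _ "\<lambda>n. h ` N n"]) (use N nd in auto)
qed

section \<open>Products and a Kuratowski--Ulam argument\<close>

lemma openin_prod_topology_contains_box:
  assumes "openin (prod_topology X A) U" "U \<noteq> {}"
  obtains U1 U2 where "openin X U1" "openin A U2" "U1 \<noteq> {}" "U2 \<noteq> {}" "U1 \<times> U2 \<subseteq> U"
proof -
  obtain x a where xa: "(x, a) \<in> U" using assms(2) by auto
  have "\<exists>U1 U2. openin X U1 \<and> openin A U2 \<and> x \<in> U1 \<and> a \<in> U2 \<and> U1 \<times> U2 \<subseteq> U"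
    using assms(1)[unfolded openin_prod_topology_alt, rule_format, OF xa] .
  then obtain U1 U2 where "openin X U1 \<and> openin A U2 \<and> x \<in> U1 \<and> a \<in> U2 \<and> U1 \<times> U2 \<subseteq> U"
    by (elim exE)
  then show thesis by (intro that[of U1 U2]) auto
qed

lemma meager_in_cylinder:
  assumes "meager_in A S"
  shows "meager_in (prod_topology X A) (topspace X \<times> S)"
proof -
  have nd: "nowhere_dense_in (prod_topology X A) (topspace X \<times> N)" if N: "nowhere_dense_in A N" for N
    unfolding nowhere_dense_in_iff_open_subset
  proof (intro conjI allI impI)
    show "topspace X \<times> N \<subseteq> topspace (prod_topology X A)" using N by (auto simp: nowhere_dense_in_def)
    fix U assume U0: "openin (prod_topology X A) U \<and> U \<noteq> {}"
    obtain U1 U2 where U: "openin X U1" "openin A U2" "U1 \<noteq> {}" "U2 \<noteq> {}" "U1 \<times> U2 \<subseteq> U"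
      using openin_prod_topology_contains_box[OF conjunct1[OF U0] conjunct2[OF U0]] by metis
    then obtain V where V: "openin A V" "V \<noteq> {}" "V \<subseteq> U2" "V \<inter> N = {}"
      using N unfolding nowhere_dense_in_iff_open_subset by meson
    show "\<exists>V. openin (prod_topology X A) V \<and> V \<noteq> {} \<and> V \<subseteq> U \<and> V \<inter> (topspace X \<times> N) = {}"
      by (rule exI[of _ "U1 \<times> V"]) (use U V in \<open>auto simp: openin_prod_Times_iff\<close>)
  qed
  obtain N :: "nat \<Rightarrow> _" where N: "\<And>n. nowhere_dense_in A (N n)" "S = (\<Union>n. N n)"
    using assms by (auto simp: meager_in_def)
  show ?thesis unfolding meager_in_def
    by (rule exI[of _ "\<lambda>n. topspace X \<times> N n"]) (use N nd in auto)
qed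

text \<open>A variant of the Kuratowski--Ulam theorem in which only the factor \<open>X\<close> has to be second
  countable; the other factor is arbitrary.\<close>

lemma meager_in_sections_containing_open:
  assumes cnt: "countable \<B>" and opn: "\<And>u. u \<in> \<B> \<Longrightarrow> openin X u \<and> u \<noteq> {}"
    and pi: "\<And>U. openin X U \<Longrightarrow> U \<noteq> {} \<Longrightarrow> \<exists>u\<in>\<B>. u \<subseteq> U"
    and baire: "\<And>U. openin X U \<Longrightarrow> U \<noteq> {} \<Longrightarrow> \<not> meager_in X U"
    and M: "meager_in (prod_topology X A) M"
  shows "meager_in A {b \<in> topspace A. \<exists>U. openin X U \<and> U \<noteq> {} \<and> U \<times> {b} \<subseteq> M}"
proof -
  let ?P = "prod_topology X A"
  obtain N :: "nat \<Rightarrow> _" where N: "\<And>n. nowhere_dense_in ?P (N n)" "M = (\<Union>n. N n)"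
    using M by (auto simp: meager_in_def)
  \<comment> \<open>Closures of nowhere dense sets are again nowhere dense, and their sections are
    closed: a section of \<open>K n\<close> that is dense in an open set contains that open
    set.\<close>
  define K where "K n = ?P closure_of (N n)" for n
  have K: "nowhere_dense_in ?P (K n)" "closedin ?P (K n)" "N n \<subseteq> K n" for n
  proof -
    have "N n \<subseteq> topspace ?P" using N(1)[of n] by (simp add: nowhere_dense_in_def)
    then show "N n \<subseteq> K n" unfolding K_def by (rule closure_of_subset)
  qed (simp_all only: K_def nowhere_dense_in_closure_of[OF N(1)] closedin_closure_of)
  \<comment> \<open>These parameters form a nowhere dense set: the box over a cell \<open>u\<close>
    and an open \<open>V\<close> contains a smaller box that avoids \<open>K n\<close>, and no
    parameter of that smaller box can have all of \<open>u\<close> in its section.\<close>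
  let ?B = "\<lambda>n u. {b \<in> topspace A. u \<times> {b} \<subseteq> K n}"
  have "nowhere_dense_in A (?B n u)" if u: "u \<in> \<B>" for n u
    unfolding nowhere_dense_in_iff_open_subset
  proof (intro conjI allI impI)
    fix V assume V: "openin A V \<and> V \<noteq> {}"
    have "openin ?P (u \<times> V)" "u \<times> V \<noteq> {}" using V opn[OF u] by (auto simp: openin_prod_Times_iff)
    then obtain W where W: "openin ?P W" "W \<noteq> {}" "W \<subseteq> u \<times> V" "W \<inter> K n = {}"
      using K(1)[of n] unfolding nowhere_dense_in_iff_open_subset by meson
    obtain U1 V1 where UV: "openin X U1" "openin A V1" "U1 \<noteq> {}" "V1 \<noteq> {}" "U1 \<times> V1 \<subseteq> W"
      using openin_prod_topology_contains_box[OF W(1,2)] by metis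
    have "V1 \<inter> ?B n u = {}"
    proof (rule ccontr)
      assume "V1 \<inter> ?B n u \<noteq> {}"
      then obtain b where b: "b \<in> V1" "u \<times> {b} \<subseteq> K n" by auto
      obtain x where x: "x \<in> U1" using UV(3) by auto
      have "(x, b) \<in> W" using x b UV by auto
      then have "(x, b) \<in> u \<times> V" "(x, b) \<notin> K n" using W by auto
      then show False using b by auto
    qed
    moreover have "V1 \<subseteq> V" using UV W by auto
    ultimately show "\<exists>V'. openin A V' \<and> V' \<noteq> {} \<and> V' \<subseteq> V \<and> V' \<inter> ?B n u = {}"
      using UV by blast
  qed auto
  then have "meager_in A (\<Union>(n, u)\<in>UNIV \<times> \<B>. ?B n u)"
    using cnt by (intro meager_in_UN) (auto intro: nowhere_dense_in_imp_meager_in)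
  moreover have "{b \<in> topspace A. \<exists>U. openin X U \<and> U \<noteq> {} \<and> U \<times> {b} \<subseteq> M}
      \<subseteq> (\<Union>(n, u)\<in>UNIV \<times> \<B>. ?B n u)"
  proof clarify
    fix b U assume b: "b \<in> topspace A" and U: "openin X U" "U \<noteq> {}" "U \<times> {b} \<subseteq> M"
    \<comment> \<open>The countably many sections cover \<open>U\<close>, which is not meager, so
      one of them is somewhere dense.\<close>
    let ?S = "\<lambda>n. {x \<in> U. (x, b) \<in> K n}"
    have "U = (\<Union>n. ?S n)" using U(3) N(2) K(3) by blast
    then have "meager_in X U" if "\<forall>n. nowhere_dense_in X (?S n)"
      using that unfolding meager_in_def by (intro exI[of _ ?S] conjI)
    then obtain n where n: "\<not> nowhere_dense_in X (?S n)"
      using baire[OF U(1,2)] by blast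
    obtain U' where U': "openin X U'" "U' \<noteq> {}"
      "\<And>V. openin X V \<Longrightarrow> V \<noteq> {} \<Longrightarrow> V \<subseteq> U' \<Longrightarrow> V \<inter> ?S n \<noteq> {}"
    proof (rule not_nowhere_dense_inE[OF n])
      show "?S n \<subseteq> topspace X" using openin_subset[OF U(1)] by auto
    qed (rule that)
    have cl: "closedin X {x \<in> topspace X. (x, b) \<in> K n}"
      by (rule closedin_continuous_map_preimage[OF _ K(2)])
         (use b in \<open>auto intro: continuous_map_pairedI\<close>)
    have "U' \<times> {b} \<subseteq> K n"
    proof (rule ccontr)
      assume "\<not> U' \<times> {b} \<subseteq> K n"
      let ?V = "U' - {x \<in> topspace X. (x, b) \<in> K n}"
      have "?V \<noteq> {}" using \<open>\<not> U' \<times> {b} \<subseteq> K n\<close> by auto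
      moreover have "openin X ?V" using U'(1) cl by (simp add: openin_diff)
      ultimately have "?V \<inter> ?S n \<noteq> {}" using U'(3)[of ?V] by auto
      then show False using openin_subset[OF U'(1)] by auto
    qed
    moreover obtain u where "u \<in> \<B>" "u \<subseteq> U'" using pi[OF U'(1,2)] by auto
    ultimately have "b \<in> ?B n u" using b by blast
    with \<open>u \<in> \<B>\<close> show "b \<in> (\<Union>(n, u)\<in>UNIV \<times> \<B>. ?B n u)" by blast
  qed
  ultimately show ?thesis by (rule meager_in_subset)
qed

text \<open>The chain is \<open>A\<close>, the product, \<open>D\<close>, \<open>Z\<close>. Between
  \<open>A\<close> and the product a set corresponds to its cylinder, between the product and
  \<open>D\<close> the homeomorphism applies, and between \<open>D\<close> and \<open>Z\<close> only
  a meager complement is lost. The way back from cylinders to \<open>A\<close> is the one that uses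
  sections over \<open>X\<close>.\<close>

lemma category_transfer:
  assumes cnt: "countable \<B>" and opn: "\<And>u. u \<in> \<B> \<Longrightarrow> openin X u \<and> u \<noteq> {}"
    and pi: "\<And>U. openin X U \<Longrightarrow> U \<noteq> {} \<Longrightarrow> \<exists>u\<in>\<B>. u \<subseteq> U"
    and baire: "\<And>U. openin X U \<Longrightarrow> U \<noteq> {} \<Longrightarrow> \<not> meager_in X U" and ne: "topspace X \<noteq> {}"
    and h: "homeomorphic_map (prod_topology X A) (subtopology Z D) h"
    and D: "residual_in Z D" and dense: "\<And>U. openin Z U \<Longrightarrow> U \<noteq> {} \<Longrightarrow> U \<inter> D \<noteq> {}"
    and B: "B \<subseteq> topspace A" and C: "C \<subseteq> topspace Z"
    and CB: "C \<inter> D = h ` (topspace X \<times> B)"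
  shows "meager_in A B \<longleftrightarrow> meager_in Z C" and "Baire_set_in A B \<longleftrightarrow> Baire_set_in Z C"
proof -
  let ?P = "prod_topology X A" and ?S = "subtopology Z D"
  have KU: "meager_in A {b \<in> topspace A. \<exists>U. openin X U \<and> U \<noteq> {} \<and> U \<times> {b} \<subseteq> M}"
    if "meager_in ?P M" for M
    by (rule meager_in_sections_containing_open[where \<B> = \<B>]) (use cnt opn pi baire that in auto)
  have DZ: "D \<subseteq> topspace Z" "meager_in Z (topspace Z - D)" using D by (auto simp: residual_in_def)
  have surj: "h ` topspace ?P = D" and inj: "inj_on h (topspace ?P)"
    and cont: "continuous_map ?P ?S h" and op: "open_map ?P ?S h"
    using homeomorphic_imp_surjective_map[OF h] homeomorphic_imp_injective_map[OF h]
      homeomorphic_imp_continuous_map[OF h] homeomorphic_imp_open_map[OF h] DZ by auto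
  obtain k where hk: "homeomorphic_maps ?P ?S h k" using h by (auto simp: homeomorphic_map_maps)
  then have k: "homeomorphic_map ?S ?P k" and kh: "\<And>p. p \<in> topspace ?P \<Longrightarrow> k (h p) = p"
    using homeomorphic_maps_map[of ?P ?S h k] by (auto simp: homeomorphic_maps_def)
  have kim: "k ` (h ` Q) = Q" if "Q \<subseteq> topspace ?P" for Q
    using that kh by (force simp: image_image)
  have to_Z: "meager_in Z (h ` Q)" if "meager_in ?P Q" for Q
    using that h meager_in_homeomorphic_image meager_in_subtopology_imp by blast
  have of_Z: "meager_in ?P Q" if "meager_in Z R" "h ` Q \<subseteq> R" "Q \<subseteq> topspace ?P" for Q R
  proof -
    have "meager_in ?S (R \<inter> D)" using meager_in_dense_subtopology[OF that(1) dense] by simp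
    then have "meager_in ?S (h ` Q)"
      by (rule meager_in_subset) (use that surj in auto)
    from meager_in_homeomorphic_image[OF k this] show ?thesis using kim[OF that(3)] by simp
  qed
  have XB: "topspace X \<times> B \<subseteq> topspace ?P" using B by auto
  show "meager_in A B \<longleftrightarrow> meager_in Z C"
  proof
    assume "meager_in A B"
    then have "meager_in Z (C \<inter> D)" unfolding CB by (intro to_Z meager_in_cylinder)
    then have "meager_in Z ((C \<inter> D) \<union> (topspace Z - D))" using DZ by (intro meager_in_Un)
    then show "meager_in Z C" by (rule meager_in_subset) (use C in auto)
  next
    assume "meager_in Z C"
    then have "meager_in ?P (topspace X \<times> B)" by (rule of_Z) (use CB XB in auto)
    from KU[OF this] show "meager_in A B"
      by (rule meager_in_subset) (use B ne in \<open>auto intro!: exI[of _ "topspace X"]\<close>)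
  qed
  show "Baire_set_in A B \<longleftrightarrow> Baire_set_in Z C"
    unfolding Baire_set_in_iff_meager_sym_diff
  proof
    assume "\<exists>V. openin A V \<and> meager_in A (sym_diff B V)"
    then obtain V where V: "openin A V" "meager_in A (sym_diff B V)" by blast
    have VA: "V \<subseteq> topspace A" using V openin_subset by blast
    have "openin ?S (h ` (topspace X \<times> V))"
      using op V by (auto simp: open_map_def openin_prod_Times_iff)
    then obtain W where W: "openin Z W" "h ` (topspace X \<times> V) = W \<inter> D"
      by (auto simp: openin_subtopology)
    have "sym_diff (C \<inter> D) (W \<inter> D) = h ` (topspace X \<times> sym_diff B V)"
    proof -
      have XV: "topspace X \<times> V \<subseteq> topspace ?P" using VA by auto
      have "topspace X \<times> sym_diff B V = sym_diff (topspace X \<times> B) (topspace X \<times> V)" by auto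
      then have "h ` (topspace X \<times> sym_diff B V)
        = sym_diff (h ` (topspace X \<times> B)) (h ` (topspace X \<times> V))"
        using inj_on_image_set_diff[OF inj _ XV, of "topspace X \<times> B"]
          inj_on_image_set_diff[OF inj _ XB, of "topspace X \<times> V"] XB XV
        by (simp add: image_Un Diff_subset[THEN subset_trans] del: topspace_prod_topology)
      then show ?thesis using CB W by simp
    qed
    then have "meager_in Z (sym_diff (C \<inter> D) (W \<inter> D))"
      using V by (simp add: to_Z meager_in_cylinder)
    \<comment> \<open>Outside \<open>D\<close> nothing is known about \<open>C\<close> and
      \<open>W\<close>, but the complement of \<open>D\<close> is meager.\<close>
    then have "meager_in Z (sym_diff (C \<inter> D) (W \<inter> D) \<union> (topspace Z - D))"
      by (rule meager_in_Un) (rule DZ)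
    then have "meager_in Z (sym_diff C W)"
      by (rule meager_in_subset) (use C openin_subset[OF W(1)] in auto)
    with W show "\<exists>V. openin Z V \<and> meager_in Z (sym_diff C V)" by blast
  next
    assume "\<exists>V. openin Z V \<and> meager_in Z (sym_diff C V)"
    then obtain W where W: "openin Z W" "meager_in Z (sym_diff C W)" by blast
    let ?V = "{p \<in> topspace ?P. h p \<in> W}" and ?M = "sym_diff (topspace X \<times> B) {p \<in> topspace ?P. h p \<in> W}"
    have V: "openin ?P ?V"
    proof -
      have "continuous_map ?P Z h" using cont by (simp add: continuous_map_in_subtopology)
      then show ?thesis using W(1) by (rule openin_continuous_map_preimage)
    qed
    have hB: "h p \<in> C \<longleftrightarrow> p \<in> topspace X \<times> B" if p: "p \<in> topspace ?P" for p
    proof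
      assume "h p \<in> C"
      moreover have "h p \<in> D" using surj p by (metis imageI)
      ultimately have "h p \<in> h ` (topspace X \<times> B)" unfolding CB[symmetric] by simp
      then show "p \<in> topspace X \<times> B" by (rule inj_on_image_mem_iff[OF inj p XB, THEN iffD1])
    next
      assume "p \<in> topspace X \<times> B"
      then have "h p \<in> C \<inter> D" unfolding CB by simp
      then show "h p \<in> C" by simp
    qed
    have M: "meager_in ?P ?M"
      by (rule of_Z[OF W(2)]) (use hB XB in auto)
    \<comment> \<open>The projection of the open witness serves as open witness in \<open>A\<close>.
      A point of \<open>B\<close> outside \<open>?O\<close> has its full section in
      \<open>?M\<close>; a point of \<open>?O\<close> outside \<open>B\<close> has the nonempty open
      section of \<open>?V\<close> in \<open>?M\<close>. Both kinds of parameters are covered by the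
      section argument.\<close>
    let ?O = "snd ` ?V"
    have O: "openin A ?O" using V open_map_snd unfolding open_map_def by blast
    have "sym_diff B ?O \<subseteq> {b \<in> topspace A. \<exists>U. openin X U \<and> U \<noteq> {} \<and> U \<times> {b} \<subseteq> ?M}"
    proof safe
      fix b assume b: "b \<in> B" "b \<notin> ?O"
      then show "b \<in> topspace A" using B by auto
      have "topspace X \<times> {b} \<subseteq> ?M" using b B by force
      then show "\<exists>U. openin X U \<and> U \<noteq> {} \<and> U \<times> {b} \<subseteq> ?M" using ne by blast
    next
      fix x b assume b: "(x, b) \<in> topspace ?P" "h (x, b) \<in> W"
      then show "snd (x, b) \<in> topspace A" by auto
      assume nb: "snd (x, b) \<notin> B"
      let ?U = "{x' \<in> topspace X. (x', b) \<in> ?V}"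
      have "openin X ?U"
        by (rule openin_continuous_map_preimage[OF _ V])
           (use b in \<open>auto intro: continuous_map_pairedI\<close>)
      moreover have "x \<in> ?U" using b by auto
      moreover have "?U \<times> {b} \<subseteq> ?M" using nb by auto
      ultimately show "\<exists>U. openin X U \<and> U \<noteq> {} \<and> U \<times> {snd (x, b)} \<subseteq> ?M"
        by (intro exI[of _ ?U] conjI) auto
    qed
    with KU[OF M] have "meager_in A (sym_diff B ?O)" by (rule meager_in_subset)
    with O show "\<exists>V. openin A V \<and> meager_in A (sym_diff B V)" by blast
  qed
qed

section \<open>The circle and its powers\<close>

abbreviation circ :: "real \<Rightarrow> complex" where
  "circ t \<equiv> cis (2 * pi * t)"

lemma circ_range: "circ ` {0..<1} = sphere 0 1"
proof (intro equalityI subsetI)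
  fix z :: complex assume z: "z \<in> sphere 0 1"
  have "z = circ (Arg2pi z / (2 * pi))"
    using Arg2pi_eq[of z] z by (simp add: cis_conv_exp mult.commute)
  moreover have "Arg2pi z / (2 * pi) \<in> {0..<1}"
    using Arg2pi_ge_0[of z] Arg2pi_lt_2pi[of z] by (auto simp: field_simps)
  ultimately show "z \<in> circ ` {0..<1}" by (rule image_eqI)
qed auto

lemma circ_eq_imp:
  assumes "circ a = circ b"
  shows "a - b \<in> \<int>"
proof -
  have "circ (a - b) = circ a * inverse (circ b)"
    by (simp add: cis_mult right_diff_distrib)
  also have "\<dots> = 1" unfolding assms by (simp add: cis_mult)
  finally have "cos (2 * pi * (a - b)) = 1" by (metis cis.simps(1) one_complex.simps(1))
  then obtain n :: int where "2 * pi * (a - b) = of_int n * 2 * pi"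
    by (auto simp: cos_one_2pi_int)
  then have "a - b = of_int n" by simp
  then show ?thesis by (metis Ints_of_int)
qed

lemma Ints_imp_zero_if_abs_less_one:
  assumes "(x::real) \<in> \<int>" "\<bar>x\<bar> < 1"
  shows "x = 0"
  using assms by (auto elim!: Ints_cases simp flip: of_int_abs)

lemma inj_on_circ: "inj_on circ {0..<1}"
proof (rule inj_onI)
  fix a b :: real assume ab: "a \<in> {0..<1}" "b \<in> {0..<1}" "circ a = circ b"
  have "a - b = 0"
    by (rule Ints_imp_zero_if_abs_less_one[OF circ_eq_imp[OF ab(3)]]) (use ab in auto)
  then show "a = b" by simp
qed

lemma continuous_map_circ: "continuous_map circle euclidean circ"
  unfolding circle_def
  by (intro continuous_map_pullback[of euclidean euclidean "\<lambda>z. z", unfolded comp_def]) auto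

lemma homeomorphic_map_circ: "homeomorphic_map circle (subtopology euclidean (sphere 0 1)) circ"
proof (rule bijective_open_imp_homeomorphic_map)
  show "continuous_map circle (subtopology euclidean (sphere 0 1)) circ"
    using continuous_map_circ circ_range by (simp add: continuous_map_in_subtopology)
  show "open_map circle (subtopology euclidean (sphere 0 1)) circ"
    unfolding open_map_def
  proof (intro allI impI)
    fix U assume "openin circle U"
    then obtain W where W: "open W" "U = circ -` W \<inter> {0..<1}"
      by (auto simp: circle_def openin_pullback_topology)
    have "circ ` U = W \<inter> circ ` {0..<1}" using W by auto
    then show "openin (subtopology euclidean (sphere 0 1)) (circ ` U)"
      using W by (auto simp: circ_range openin_subtopology)
  qed
qed (simp_all add: circ_range inj_on_circ)

lemma compact_space_circle: "compact_space circle"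
proof -
  have "compact_space (subtopology euclidean (sphere (0::complex) 1))"
    by (simp add: compact_space_subtopology)
  then show ?thesis
    using homeomorphic_map_circ homeomorphic_compact_space homeomorphic_map_imp_homeomorphic_space
    by blast
qed

text \<open>The circle is the quotient of \<open>{0..1}\<close> by gluing its endpoints. A closed
  condition on \<open>{0..1}\<close> cuts out a compact set, whose image under \<open>circ\<close>
  is compact and so closed; its preimage is the required closed set.\<close>

lemma continuous_map_circle:
  fixes v :: "real \<Rightarrow> real"
  assumes v: "continuous_on {0..1} v" and v01: "v 0 = v 1"
  shows "continuous_map circle euclideanreal v"
  unfolding continuous_map_closedin
proof (intro conjI allI impI)
  fix C assume "closedin euclideanreal C"
  then have C: "closed C" by simp
  let ?K = "circ ` {t \<in> {0..1}. v t \<in> C}"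
  have "{t \<in> {0..1}. v t \<in> C} = {0..1} \<inter> v -` C" by auto
  then have "compact {t \<in> {0..1}. v t \<in> C}"
    using continuous_closed_preimage[OF v _ C] by (simp add: compact_Int_closed compact_eq_bounded_closed bounded_Int)
  then have "compact ?K" by (intro compact_continuous_image continuous_intros)
  then have "closed ?K" by (rule compact_imp_closed)
  then have "closedin circle {t \<in> topspace circle. circ t \<in> ?K}"
    by (intro closedin_continuous_map_preimage[OF continuous_map_circ]) simp
  moreover have "{t \<in> topspace circle. circ t \<in> ?K} = {t \<in> topspace circle. v t \<in> C}"
  proof (intro equalityI subsetI CollectI conjI)
    fix t assume t: "t \<in> {t \<in> topspace circle. circ t \<in> ?K}"
    then show "t \<in> topspace circle" by simp
    from t obtain s where s: "s \<in> {0..1}" "v s \<in> C" "circ t = circ s" by auto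
    show "v t \<in> C"
    proof (cases "s = 1")
      \<comment> \<open>The endpoint 1 represents the point 0 of the circle; here the equality of
        the two end values is used.\<close>
      case True
      then have "circ t = circ 0" using s by simp
      then have "t = 0" using t inj_on_circ by (auto simp: inj_on_def)
      then show ?thesis using True s v01 by simp
    next
      case False
      then have "t = s" using t s inj_on_circ by (auto simp: inj_on_def)
      then show ?thesis using s by simp
    qed
  qed auto
  ultimately show "closedin circle {t \<in> topspace circle. v t \<in> C}" by simp
qed simp

section \<open>Borel structure of the power of the circle\<close>

lemma mem_topspace_Y_hat: "y \<in> topspace Y_hat \<longleftrightarrow> (\<forall>g. 0 \<le> y g \<and> y g < 1)"
  by (auto simp: topspace_Y_hat)

lemma continuous_map_coordinate: "continuous_map Y_hat circle (\<lambda>y. y g)"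
  unfolding Y_hat_def by (rule continuous_map_product_projection) simp

lemma compact_space_Y_hat: "compact_space Y_hat"
  unfolding Y_hat_def by (simp add: compact_space_product_topology compact_space_circle)

lemma sets_Y_measure_restrict: "sets Y_measure = sets (restrict_space borel {0..<1})"
  by (simp add: Y_measure_def sets_restrict_space)

lemma measurable_Y_measure_iff:
  "u \<in> M \<rightarrow>\<^sub>M Y_measure \<longleftrightarrow> u \<in> borel_measurable M \<and> (\<forall>x\<in>space M. u x \<in> {0..<1})"
proof -
  have "u \<in> M \<rightarrow>\<^sub>M Y_measure \<longleftrightarrow> u \<in> M \<rightarrow>\<^sub>M restrict_space borel {0..<1}"
    by (rule arg_cong[of _ _ "\<lambda>S. u \<in> S"]) (rule measurable_cong_sets[OF refl sets_Y_measure_restrict])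
  then show ?thesis by (auto simp: measurable_restrict_space2_iff)
qed

lemma borel_measurable_Y_measure:
  "v \<in> borel_measurable borel \<Longrightarrow> v \<in> borel_measurable Y_measure"
  unfolding measurable_cong_sets[OF sets_Y_measure_restrict refl]
  by (rule measurable_restrict_space1)

text \<open>Applying \<open>circ\<close> in each coordinate embeds \<open>Y_hat\<close> in the
  function space of type \<open>'g \<Rightarrow> complex\<close> with its type class topology. There
  Borel measurability may be checked coordinatewise because \<open>'g\<close> is countable.\<close>

lemma openin_Y_hat_imp_preimage:
  fixes U :: "('g::countable \<Rightarrow> real) set"
  assumes U: "openin Y_hat U"
  shows "\<exists>O'. open O' \<and> U = {y \<in> topspace Y_hat. (\<lambda>g. circ (y g)) \<in> O'}"
proof -
  have "\<exists>O'. open O' \<and> (\<lambda>g. circ (x g)) \<in> O' \<and> {y \<in> topspace Y_hat. (\<lambda>g. circ (y g)) \<in> O'} \<subseteq> U"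
    if x: "x \<in> U" for x
  proof -
    obtain X where X: "x \<in> Pi\<^sub>E UNIV X" "\<And>g. openin circle (X g)" "finite {g. X g \<noteq> topspace circle}"
      "Pi\<^sub>E UNIV X \<subseteq> U"
      using product_topology_open_contains_basis[OF U[unfolded Y_hat_def] x] by auto
    \<comment> \<open>A full factor must be extended by \<open>UNIV\<close>, so that only finitely
      many factors of the product are proper and the product is open.\<close>
    have "\<exists>W. open W \<and> X g = circ -` W \<inter> {0..<1} \<and> (X g = {0..<1} \<longrightarrow> W = UNIV)" for g
    proof (cases "X g = {0..<1}")
      case False
      have "\<exists>W. open W \<and> X g = circ -` W \<inter> {0..<1}"
        using X(2)[of g] by (auto simp: circle_def openin_pullback_topology)
      with False show ?thesis by auto
    qed (intro exI[of _ UNIV], simp)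
    then obtain W where W: "\<And>g. open (W g)" "\<And>g. X g = circ -` W g \<inter> {0..<1}"
      "\<And>g. X g = {0..<1} \<Longrightarrow> W g = UNIV" by metis
    have "open (Pi\<^sub>E UNIV W)"
    proof (rule open_PiE)
      show "finite {g. W g \<noteq> UNIV}" by (rule finite_subset[OF _ X(3)]) (use W(3) in auto)
    qed (rule W)
    moreover have "(\<lambda>g. circ (x g)) \<in> Pi\<^sub>E UNIV W" using X(1) W(2) by auto
    moreover have "{y \<in> topspace Y_hat. (\<lambda>g. circ (y g)) \<in> Pi\<^sub>E UNIV W} \<subseteq> Pi\<^sub>E UNIV X"
      using W(2) by (auto simp: mem_topspace_Y_hat)
    ultimately show ?thesis using X(4) by (intro exI[of _ "Pi\<^sub>E UNIV W"]) auto
  qed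
  then have "\<forall>x\<in>U. \<exists>O'. open O' \<and> (\<lambda>g. circ (x g)) \<in> O' \<and>
      {y \<in> topspace Y_hat. (\<lambda>g. circ (y g)) \<in> O'} \<subseteq> U" by (intro ballI)
  from bchoice[OF this] obtain O' where O'0: "\<forall>x\<in>U. open (O' x) \<and> (\<lambda>g. circ (x g)) \<in> O' x \<and>
      {y \<in> topspace Y_hat. (\<lambda>g. circ (y g)) \<in> O' x} \<subseteq> U" by (elim exE)
  then have O': "\<And>x. x \<in> U \<Longrightarrow> open (O' x)" "\<And>x. x \<in> U \<Longrightarrow> (\<lambda>g. circ (x g)) \<in> O' x"
    "\<And>x. x \<in> U \<Longrightarrow> {y \<in> topspace Y_hat. (\<lambda>g. circ (y g)) \<in> O' x} \<subseteq> U" by simp_all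
  have "U = {y \<in> topspace Y_hat. (\<lambda>g. circ (y g)) \<in> (\<Union>x\<in>U. O' x)}"
  proof (intro equalityI subsetI)
    fix y assume y: "y \<in> U"
    then have "y \<in> topspace Y_hat" using openin_subset[OF U] by auto
    then show "y \<in> {y \<in> topspace Y_hat. (\<lambda>g. circ (y g)) \<in> (\<Union>x\<in>U. O' x)}"
      using O'(2)[OF y] y by auto
  next
    fix y assume "y \<in> {y \<in> topspace Y_hat. (\<lambda>g. circ (y g)) \<in> (\<Union>x\<in>U. O' x)}"
    then obtain x where x: "x \<in> U" and y: "y \<in> {y \<in> topspace Y_hat. (\<lambda>g. circ (y g)) \<in> O' x}" by auto
    show "y \<in> U" using O'(3)[OF x] y by (rule subsetD)
  qed
  moreover have "open (\<Union>x\<in>U. O' x)" using O'(1) by auto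
  ultimately show ?thesis by (intro exI[of _ "\<Union>x\<in>U. O' x"] conjI)
qed

text \<open>\<open>borel_of Y_hat\<close> is generated by all open sets, not just by cylinders;
  countability of the group bridges the difference. Every measurable map into \<open>Y_hat\<close>
  below is obtained this way.\<close>

lemma measurable_into_Y_hat:
  fixes u :: "'g::countable \<Rightarrow> 'a \<Rightarrow> real"
  assumes u: "\<And>g. u g \<in> M \<rightarrow>\<^sub>M Y_measure"
  shows "(\<lambda>x g. u g x) \<in> M \<rightarrow>\<^sub>M borel_of Y_hat"
proof (rule measurable_sigma_sets[OF sets_borel_of])
  show "{U. openin Y_hat U} \<subseteq> Pow (topspace Y_hat)" by (auto dest: openin_subset)
  have rng: "(\<lambda>g. u g x) \<in> topspace Y_hat" if "x \<in> space M" for x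
    using u that by (auto simp: mem_topspace_Y_hat measurable_Y_measure_iff)
  then show "(\<lambda>x g. u g x) \<in> space M \<rightarrow> topspace Y_hat" by auto
  fix U :: "('g \<Rightarrow> real) set" assume "U \<in> {U. openin Y_hat U}"
  then obtain O' where O': "open O'" "U = {y \<in> topspace Y_hat. (\<lambda>g. circ (y g)) \<in> O'}"
    using openin_Y_hat_imp_preimage by auto
  have "(\<lambda>x. circ (u g x)) \<in> borel_measurable M" for g
  proof -
    have ug: "u g \<in> borel_measurable M" using u by (simp add: measurable_Y_measure_iff)
    have "circ \<in> borel_measurable borel"
      by (intro borel_measurable_continuous_onI continuous_intros)
    from measurable_compose[OF ug this] show ?thesis .
  qed
  then have "(\<lambda>x g. circ (u g x)) \<in> borel_measurable M"
    by (rule measurable_coordinatewise_then_product)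
  then have "(\<lambda>x g. circ (u g x)) -` O' \<inter> space M \<in> sets M"
    by (rule measurable_sets) (simp add: O')
  moreover have "(\<lambda>x g. circ (u g x)) -` O' \<inter> space M = (\<lambda>x g. u g x) -` U \<inter> space M"
    using O' rng by auto
  ultimately show "(\<lambda>x g. u g x) -` U \<inter> space M \<in> sets M" by simp
qed

lemma measurable_borel_of_continuous_map:
  assumes "continuous_map X Z f"
  shows "f \<in> borel_of X \<rightarrow>\<^sub>M borel_of Z"
proof (rule measurable_sigma_sets[OF sets_borel_of])
  show "{U. openin Z U} \<subseteq> Pow (topspace Z)" by (auto dest: openin_subset)
  show "f \<in> space (borel_of X) \<rightarrow> topspace Z"
    using assms by (auto simp: space_borel_of continuous_map_def)
  fix U assume "U \<in> {U. openin Z U}"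
  then have "openin X {x \<in> topspace X. f x \<in> U}"
    using openin_continuous_map_preimage[OF assms, of U] by simp
  moreover have "f -` U \<inter> space (borel_of X) = {x \<in> topspace X. f x \<in> U}"
    by (auto simp: space_borel_of)
  ultimately show "f -` U \<inter> space (borel_of X) \<in> sets (borel_of X)"
    by (auto simp: sets_borel_of)
qed

lemma borel_of_euclidean: "sets (borel_of (euclidean :: 'a::topological_space topology)) = sets borel"
  by (simp add: sets_borel_of borel_def)

lemma borel_measurable_continuous_map:
  assumes "continuous_map X euclidean f"
  shows "f \<in> borel_measurable (borel_of X)"
  using measurable_borel_of_continuous_map[OF assms]
  by (subst (asm) measurable_cong_sets[OF refl borel_of_euclidean])

lemma measurable_coordinate: "(\<lambda>y. y g) \<in> borel_of Y_hat \<rightarrow>\<^sub>M Y_measure"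
  using measurable_borel_of_continuous_map[OF continuous_map_coordinate]
  by (subst measurable_cong_sets[OF refl sets_Y_measure])

lemma measurable_coordinate_real: "(\<lambda>y. y g) \<in> borel_measurable (borel_of Y_hat)"
  using measurable_coordinate[of g] by (simp add: measurable_Y_measure_iff)

section \<open>Continuous functions on the compact space \<open>Y_hat\<close>\<close>

lemma continuous_map_bounded:
  fixes f :: "'a \<Rightarrow> real"
  assumes "compact_space X" "continuous_map X euclideanreal f"
  shows "\<exists>B\<ge>0. \<forall>x\<in>topspace X. \<bar>f x\<bar> \<le> B"
proof -
  have "compactin euclideanreal (f ` topspace X)"
    using assms image_compactin[of X "topspace X" euclideanreal f] by (simp add: compact_space_def)
  then have "bounded (f ` topspace X)" by (simp add: compact_imp_bounded)
  then obtain B where "\<forall>x\<in>topspace X. \<bar>f x\<bar> \<le> B" by (auto simp: bounded_iff)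
  then show ?thesis by (intro exI[of _ "max B 0"]) auto
qed

text \<open>The chord has length \<open>2 * \<bar>sin (pi * (a - b))\<bar>\<close>, which is at most
  the length of the arc.\<close>

lemma norm_circ_diff_le: "norm (circ a - circ b) \<le> 2 * pi * \<bar>a - b\<bar>"
proof -
  have "circ a - circ b = circ b * (circ (a - b) - 1)"
    by (simp add: right_diff_distrib cis_mult)
  then have "norm (circ a - circ b) = norm (circ (a - b) - 1)"
    by (simp add: norm_mult)
  also have "\<dots> = 2 * \<bar>sin (pi * (a - b))\<bar>"
  proof -
    have "(cmod (circ (a - b) - 1))\<^sup>2 = (cos (2 * (pi * (a - b))) - 1)\<^sup>2 + (sin (2 * (pi * (a - b))))\<^sup>2"
      by (simp add: cmod_power2 mult.assoc)
    also have "\<dots> = 2 - 2 * cos (2 * (pi * (a - b)))"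
      using sin_cos_squared_add[of "2 * (pi * (a - b))"] by (simp add: power2_diff)
    also have "\<dots> = (2 * \<bar>sin (pi * (a - b))\<bar>)\<^sup>2"
      unfolding cos_double_sin by (simp add: power_mult_distrib)
    finally show ?thesis by (rule power2_eq_imp_eq) auto
  qed
  also have "\<dots> \<le> 2 * \<bar>pi * (a - b)\<bar>" using abs_sin_x_le_abs_x by simp
  finally show ?thesis by (simp add: abs_mult)
qed

text \<open>Pairs on which \<open>f\<close> differs by at least \<open>\<epsilon>\<close> form a
  compact set off the diagonal. Finitely many coordinates suffice to bound the distance from the
  diagonal from below there, and a large constant \<open>C\<close> then pays for the bounded
  oscillation of \<open>f\<close>. This reduces weak-* estimates to L1 estimates of single
  coordinates, in the ordinary distance of the line.\<close>

lemma continuous_Y_hat_modulus: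
  fixes f :: "('g \<Rightarrow> real) \<Rightarrow> real"
  assumes f: "continuous_map Y_hat euclideanreal f" and \<epsilon>: "0 < \<epsilon>"
  shows "\<exists>G C. finite G \<and> 0 \<le> C \<and> (\<forall>x\<in>topspace Y_hat. \<forall>y\<in>topspace Y_hat.
     \<bar>f x - f y\<bar> \<le> \<epsilon> + C * (\<Sum>g\<in>G. \<bar>x g - y g\<bar>))"
proof -
  let ?P = "prod_topology Y_hat Y_hat :: (('g \<Rightarrow> real) \<times> ('g \<Rightarrow> real)) topology"
  define dg where "dg g p = norm (circ (fst p g) - circ (snd p g))" for g and p :: "('g \<Rightarrow> real) \<times> ('g \<Rightarrow> real)"
  have c1: "continuous_map ?P euclidean (\<lambda>p. circ (fst p g))" "continuous_map ?P euclidean (\<lambda>p. circ (snd p g))" for g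
    using continuous_map_compose[OF continuous_map_fst continuous_map_compose[OF continuous_map_coordinate continuous_map_circ]]
      continuous_map_compose[OF continuous_map_snd continuous_map_compose[OF continuous_map_coordinate continuous_map_circ]]
    by (simp_all add: comp_def)
  have cdg: "continuous_map ?P euclideanreal (dg g)" for g
    unfolding dg_def by (intro continuous_map_norm continuous_map_diff c1)
  have cf: "continuous_map ?P euclideanreal (\<lambda>p. \<bar>f (fst p) - f (snd p)\<bar>)"
    using continuous_map_compose[OF continuous_map_fst f] continuous_map_compose[OF continuous_map_snd f]
    by (intro continuous_map_real_abs continuous_map_diff) (auto simp: comp_def)
  define K where "K = {p \<in> topspace ?P. \<bar>f (fst p) - f (snd p)\<bar> \<in> {\<epsilon>..}}"
  have "closedin ?P K" unfolding K_def by (rule closedin_continuous_map_preimage[OF cf]) simp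
  moreover have "compact_space ?P" by (simp add: compact_space_prod_topology compact_space_Y_hat)
  ultimately have cK: "compactin ?P K" using closedin_compact_space by blast
  define O' where "O' i = {p \<in> topspace ?P. dg (fst i) p \<in> {1 / real (Suc (snd i))<..}}" for i :: "'g \<times> nat"
  have O': "openin ?P (O' i)" for i
    unfolding O'_def by (rule openin_continuous_map_preimage[OF cdg]) simp
  have cover: "K \<subseteq> \<Union>(range O')"
  proof
    fix p assume p: "p \<in> K"
    then have "fst p \<noteq> snd p" using \<epsilon> by (auto simp: K_def)
    then obtain g where g: "fst p g \<noteq> snd p g" by auto
    have "fst p g \<in> {0..<1}" "snd p g \<in> {0..<1}"
      using p by (auto simp: K_def mem_topspace_Y_hat mem_Times_iff)
    then have "dg g p > 0" using g inj_on_circ by (auto simp: dg_def inj_on_def)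
    then obtain n where "inverse (real (Suc n)) < dg g p" using reals_Archimedean by blast
    then have "p \<in> O' (g, n)" using p by (simp add: O'_def K_def inverse_eq_divide)
    then show "p \<in> \<Union>(range O')" by auto
  qed
  obtain \<F> where F: "finite \<F>" "\<F> \<subseteq> range O'" "K \<subseteq> \<Union>\<F>"
    using compactinD[OF cK _ cover] O' by (metis imageE)
  obtain I where I: "finite I" "\<F> = O' ` I" using finite_subset_image[OF F(1,2)] by auto
  obtain B where B: "B \<ge> 0" "\<And>x. x \<in> topspace Y_hat \<Longrightarrow> \<bar>f x\<bar> \<le> B"
    using continuous_map_bounded[OF compact_space_Y_hat f] by blast
  define N where "N = (\<Sum>i\<in>I. real (Suc (snd i)))"
  have N: "real (Suc (snd i)) \<le> N" if "i \<in> I" for i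
    unfolding N_def using I(1) that by (intro member_le_sum) auto
  have N0: "0 \<le> N" unfolding N_def by (intro sum_nonneg) auto
  \<comment> \<open>\<open>2 * B\<close> bounds the oscillation of \<open>f\<close>,
    \<open>N\<close> bounds the inverse of every chord length used in the cover, and
    \<open>2 * pi\<close> compares chords with distances on the line.\<close>
  define C where "C = 2 * B * N * (2 * pi)"
  have C0: "0 \<le> C" unfolding C_def using B N0 by simp
  have "\<bar>f x - f y\<bar> \<le> \<epsilon> + C * (\<Sum>g\<in>fst ` I. \<bar>x g - y g\<bar>)"
    if x: "x \<in> topspace Y_hat" and y: "y \<in> topspace Y_hat" for x y
  proof (cases "(x, y) \<in> K")
    case False
    then have "\<bar>f x - f y\<bar> \<le> \<epsilon>" using x y by (auto simp: K_def)
    moreover have "0 \<le> C * (\<Sum>g\<in>fst ` I. \<bar>x g - y g\<bar>)" using C0 by (intro mult_nonneg_nonneg sum_nonneg) auto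
    ultimately show ?thesis by simp
  next
    case True
    then obtain i where i: "i \<in> I" "(x, y) \<in> O' i" using F(3) I(2) by auto
    then have "1 / real (Suc (snd i)) < dg (fst i) (x, y)" by (simp add: O'_def)
    also have "\<dots> \<le> 2 * pi * \<bar>x (fst i) - y (fst i)\<bar>" by (simp add: dg_def norm_circ_diff_le)
    finally have "1 \<le> real (Suc (snd i)) * (2 * pi * \<bar>x (fst i) - y (fst i)\<bar>)"
      by (simp add: field_simps)
    also have "\<dots> \<le> N * (2 * pi * \<bar>x (fst i) - y (fst i)\<bar>)"
      using N[OF i(1)] by (intro mult_right_mono) auto
    also have "\<dots> \<le> N * (2 * pi * (\<Sum>g\<in>fst ` I. \<bar>x g - y g\<bar>))"
      using I(1) i(1) N0 by (intro mult_left_mono member_le_sum) auto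
    finally have 1: "1 \<le> N * (2 * pi * (\<Sum>g\<in>fst ` I. \<bar>x g - y g\<bar>))" .
    have "\<bar>f x - f y\<bar> \<le> 2 * B" using B(2)[OF x] B(2)[OF y] by linarith
    also have "\<dots> \<le> 2 * B * (N * (2 * pi * (\<Sum>g\<in>fst ` I. \<bar>x g - y g\<bar>)))"
      using mult_left_mono[OF 1, of "2 * B"] B(1) by simp
    also have "\<dots> = C * (\<Sum>g\<in>fst ` I. \<bar>x g - y g\<bar>)" by (simp add: C_def)
    finally show ?thesis using \<epsilon> by simp
  qed
  then show ?thesis using I(1) C0 by (intro exI[of _ "fst ` I"] exI[of _ C] conjI ballI) simp_all
qed

section \<open>Quantile functions\<close>

text \<open>These are the distribution functions of atomless probability measures on
  \<open>{0..<1}\<close>. Gaps in the support are permitted, so \<open>F\<close> need not be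
  strictly increasing.\<close>

definition unit_cdf :: "(real \<Rightarrow> real) \<Rightarrow> bool" where
  "unit_cdf F \<longleftrightarrow> mono F \<and> continuous_on UNIV F \<and> (\<forall>x\<le>0. F x = 0) \<and> (\<forall>x\<ge>1. F x = 1)"

text \<open>The generalized inverse of \<open>F\<close>. The bound \<open>0 \<le> x\<close> keeps
  the infimum meaningful at \<open>t = 0\<close>, where \<open>t \<le> F x\<close> holds on the
  whole line.\<close>

definition quantile :: "(real \<Rightarrow> real) \<Rightarrow> real \<Rightarrow> real" where
  "quantile F t = Inf {x. 0 \<le> x \<and> t \<le> F x}"

lemma unit_cdf_bounds: "unit_cdf F \<Longrightarrow> 0 \<le> F x \<and> F x \<le> 1"
  unfolding unit_cdf_def mono_def by (metis linorder_linear)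

lemma quantile_mem:
  assumes F: "unit_cdf F" and t: "t < 1"
  shows "0 \<le> quantile F t \<and> t \<le> F (quantile F t)"
proof -
  let ?S = "{x. 0 \<le> x \<and> t \<le> F x}"
  have "?S = {0..} \<inter> F -` {t..}" by auto
  moreover have "closed (F -` {t..})"
    using F by (intro closed_vimage) (auto simp: unit_cdf_def)
  ultimately have "closed ?S" by (simp add: closed_Int)
  moreover have "1 \<in> ?S" using F t by (auto simp: unit_cdf_def)
  ultimately have "Inf ?S \<in> ?S"
    by (intro closed_contains_Inf bdd_belowI[of _ 0]) (auto intro!: exI[of _ 1])
  then show ?thesis by (simp add: quantile_def)
qed

lemma quantile_le_iff:
  assumes F: "unit_cdf F" and t: "t < 1" and x: "0 \<le> x"
  shows "quantile F t \<le> x \<longleftrightarrow> t \<le> F x"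
proof
  assume "quantile F t \<le> x"
  then have "F (quantile F t) \<le> F x" using F by (auto simp: unit_cdf_def mono_def)
  then show "t \<le> F x" using quantile_mem[OF F t] by linarith
next
  assume "t \<le> F x"
  then show "quantile F t \<le> x"
    unfolding quantile_def using x by (intro cInf_lower) (auto intro: bdd_belowI[of _ 0])
qed

text \<open>By continuity \<open>F\<close> attains \<open>t\<close> at some point not beyond the
  quantile, and by minimality that point is the quantile itself. Thus \<open>quantile F\<close> is
  injective on \<open>{0..<1}\<close>, with \<open>F\<close> as its left inverse.\<close>

lemma quantile_right_inverse:
  assumes F: "unit_cdf F" and t: "0 \<le> t" "t < 1"
  shows "F (quantile F t) = t"
proof -
  let ?q = "quantile F t"
  have q: "0 \<le> ?q" "t \<le> F ?q" using quantile_mem[OF F t(2)] by auto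
  have "continuous_on {0..?q} F" using F by (auto simp: unit_cdf_def intro: continuous_on_subset)
  moreover have "F 0 \<le> t" using F t by (simp add: unit_cdf_def)
  ultimately obtain x where x: "0 \<le> x" "x \<le> ?q" "F x = t"
    using IVT'[of F 0 t ?q] q by auto
  then have "?q \<le> x" using quantile_le_iff[OF F t(2) x(1)] by simp
  then show ?thesis using x by simp
qed

lemma quantile_bounds:
  assumes F: "unit_cdf F" and t: "0 \<le> t" "t < 1"
  shows "0 \<le> quantile F t \<and> quantile F t < 1"
proof -
  have "F (quantile F t) < 1" using quantile_right_inverse[OF assms] t by simp
  then have "quantile F t < 1" using F unfolding unit_cdf_def by (metis linorder_not_less less_irrefl)
  then show ?thesis using quantile_mem[OF F t(2)] by simp
qed

lemma measurable_quantile: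
  assumes F: "unit_cdf F"
  shows "quantile F \<in> Y_measure \<rightarrow>\<^sub>M Y_measure"
  unfolding measurable_Y_measure_iff
proof
  show "quantile F \<in> borel_measurable Y_measure"
    unfolding borel_measurable_iff_le
  proof
    fix x :: real
    have "{t \<in> space Y_measure. quantile F t \<le> x} = (if 0 \<le> x then {..F x} \<inter> {0..<1} else {})"
    proof (cases "0 \<le> x")
      case True
      then show ?thesis using quantile_le_iff[OF F _ True] by auto
    next
      case False
      have "\<not> quantile F t \<le> x" if "t \<in> {0..<1}" for t
        using quantile_bounds[OF F, of t] that False by auto
      then show ?thesis using False by auto
    qed
    moreover have "{..F x} \<inter> {0..<1} \<in> sets Y_measure"
      unfolding sets_Y_measure_restrict sets_restrict_space by auto
    ultimately show "{t \<in> space Y_measure. quantile F t \<le> x} \<in> sets Y_measure" by simp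
  qed
qed (use quantile_bounds[OF F] in auto)

section \<open>The quantile transform and its continuity in L1\<close>

lemma emeasure_Y_measure: "A \<in> sets borel \<Longrightarrow> A \<subseteq> {0..<1} \<Longrightarrow> emeasure Y_measure A = emeasure lborel A"
  unfolding Y_measure_def by (subst emeasure_restrict_space) auto

lemma measure_Y_measure: "A \<in> sets borel \<Longrightarrow> A \<subseteq> {0..<1} \<Longrightarrow> measure Y_measure A = measure lborel A"
  by (simp add: measure_def emeasure_Y_measure)

lemma measure_quantile_le:
  assumes F: "unit_cdf F"
  shows "measure Y_measure {t \<in> {0..<1}. quantile F t \<le> x} = F x"
proof (cases "0 \<le> x")
  case True
  have "{t \<in> {0..<1}. quantile F t \<le> x} = {0..F x} \<inter> {0..<1}"
    using quantile_le_iff[OF F _ True] by auto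
  also have "measure Y_measure ({0..F x} \<inter> {0..<1}) = F x"
  proof (cases "F x = 1")
    case True
    then have "{0..F x} \<inter> {0..<1} = {0..<1}" by auto
    then show ?thesis using True by (simp add: measure_Y_measure)
  next
    case False
    then have "{0..F x} \<inter> {0..<1} = {0..F x}" using unit_cdf_bounds[OF F, of x] by auto
    moreover have "0 \<le> F x" "F x < 1" using False unit_cdf_bounds[OF F, of x] by auto
    ultimately show ?thesis by (subst measure_Y_measure) auto
  qed
  finally show ?thesis .
next
  case False
  have "\<not> quantile F t \<le> x" if "t \<in> {0..<1}" for t
    using quantile_bounds[OF F, of t] that False by auto
  then have e: "{t \<in> {0..<1}. quantile F t \<le> x} = {}" by auto
  show ?thesis using False F unfolding e by (simp add: unit_cdf_def)
qed

text \<open>Both sides of the estimate compute or bound the area between the graphs of \<open>F\<close> and \<open>G\<close>: the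
  left-hand side slices it horizontally, the right-hand side vertically.\<close>

lemma quantile_L1_le:
  assumes F: "unit_cdf F" and G: "unit_cdf G" and \<delta>: "\<And>x. \<bar>F x - G x\<bar> \<le> \<delta>"
  shows "(\<integral>t. \<bar>quantile F t - quantile G t\<bar> \<partial>Y_measure) \<le> \<delta>"
proof -
  interpret Y: prob_space Y_measure by (rule prob_space_Y_measure)
  interpret P: pair_sigma_finite Y_measure Y_measure ..
  have [measurable]: "quantile F \<in> borel_measurable Y_measure" "quantile G \<in> borel_measurable Y_measure"
    using measurable_quantile[OF F] measurable_quantile[OF G] by (auto simp: measurable_Y_measure_iff)
  have [measurable]: "(\<lambda>x. x) \<in> borel_measurable Y_measure"
    by (intro borel_measurable_Y_measure) simp
  have \<delta>0: "0 \<le> \<delta>" using \<delta>[of 0] by linarith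
  let ?A = "{p \<in> space (Y_measure \<Otimes>\<^sub>M Y_measure). (quantile F (fst p) \<le> snd p) \<noteq> (quantile G (fst p) \<le> snd p)}"
  have A: "?A \<in> sets (Y_measure \<Otimes>\<^sub>M Y_measure)" by measurable
  have 1: "emeasure Y_measure (Pair t -` ?A) = ennreal \<bar>quantile F t - quantile G t\<bar>"
    if t: "t \<in> space Y_measure" for t
  proof -
    let ?a = "quantile F t" and ?b = "quantile G t"
    have ab: "0 \<le> ?a" "?a < 1" "0 \<le> ?b" "?b < 1"
      using t quantile_bounds[OF F, of t] quantile_bounds[OF G, of t] by auto
    have "(x \<in> Pair t -` ?A) = (x \<in> {min ?a ?b..<max ?a ?b})" for x
    proof -
      have "(x \<in> Pair t -` ?A) = (x \<in> {0..<1} \<and> (?a \<le> x) \<noteq> (?b \<le> x))"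
        using t by (auto simp: space_pair_measure)
      also have "\<dots> = (x \<in> {min ?a ?b..<max ?a ?b})" using ab by simp linarith
      finally show ?thesis .
    qed
    then have "Pair t -` ?A = {min ?a ?b..<max ?a ?b}" by (rule set_eqI)
    moreover have "emeasure Y_measure {min ?a ?b..<max ?a ?b} = ennreal (max ?a ?b - min ?a ?b)"
      using ab by (subst emeasure_Y_measure) auto
    moreover have "max ?a ?b - min ?a ?b = \<bar>?a - ?b\<bar>" by auto
    ultimately show ?thesis by simp
  qed
  have 2: "emeasure Y_measure ((\<lambda>t. (t, x)) -` ?A) \<le> ennreal \<delta>" if x: "x \<in> space Y_measure" for x
  proof -
    have x0: "0 \<le> x" using x by simp
    have sub: "(\<lambda>t. (t, x)) -` ?A \<subseteq> {min (F x) (G x)<..max (F x) (G x)} \<inter> {0..<1}"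
    proof
      fix t assume "t \<in> (\<lambda>t. (t, x)) -` ?A"
      then have t: "t \<in> {0..<1}" and n: "(quantile F t \<le> x) \<noteq> (quantile G t \<le> x)"
        by (auto simp: space_pair_measure)
      from t have t1: "t < 1" by simp
      have "(t \<le> F x) \<noteq> (t \<le> G x)"
        using n quantile_le_iff[OF F t1 x0] quantile_le_iff[OF G t1 x0] by simp
      then have "min (F x) (G x) < t \<and> t \<le> max (F x) (G x)" by linarith
      then show "t \<in> {min (F x) (G x)<..max (F x) (G x)} \<inter> {0..<1}" using t by simp
    qed
    have "emeasure Y_measure ((\<lambda>t. (t, x)) -` ?A)
        \<le> emeasure Y_measure ({min (F x) (G x)<..max (F x) (G x)} \<inter> {0..<1})"
      using sub by (rule emeasure_mono) (auto simp: sets_Y_measure_restrict sets_restrict_space)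
    also have "\<dots> \<le> emeasure lborel {min (F x) (G x)<..max (F x) (G x)}"
      by (subst emeasure_Y_measure) (simp, blast, rule emeasure_mono, auto)
    also have "\<dots> = ennreal \<bar>F x - G x\<bar>"
    proof -
      have "max (F x) (G x) - min (F x) (G x) = \<bar>F x - G x\<bar>" by auto
      then show ?thesis by (subst emeasure_lborel_Ioc) auto
    qed
    also have "\<dots> \<le> ennreal \<delta>" using \<delta>[of x] by (rule ennreal_leI)
    finally show ?thesis .
  qed
  have "(\<integral>\<^sup>+t. ennreal \<bar>quantile F t - quantile G t\<bar> \<partial>Y_measure)
      = (\<integral>\<^sup>+t. emeasure Y_measure (Pair t -` ?A) \<partial>Y_measure)"
    by (rule nn_integral_cong) (rule 1[symmetric])
  also have "\<dots> = (\<integral>\<^sup>+x. emeasure Y_measure ((\<lambda>t. (t, x)) -` ?A) \<partial>Y_measure)"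
    using Y.emeasure_pair_measure_alt[OF A] P.emeasure_pair_measure_alt2[OF A] by simp
  also have "\<dots> \<le> (\<integral>\<^sup>+x. ennreal \<delta> \<partial>Y_measure)"
    by (rule nn_integral_mono) (rule 2)
  also have "\<dots> = ennreal \<delta>" using Y.emeasure_space_1 by simp
  finally have le: "(\<integral>\<^sup>+t. ennreal \<bar>quantile F t - quantile G t\<bar> \<partial>Y_measure) \<le> ennreal \<delta>" .
  show ?thesis
  proof (subst integral_eq_nn_integral)
    show "enn2real (\<integral>\<^sup>+t. ennreal \<bar>quantile F t - quantile G t\<bar> \<partial>Y_measure) \<le> \<delta>"
      using le \<delta>0 by (simp add: enn2real_leI)
  qed auto
qed

section \<open>Coding an action by a shift-invariant measure\<close>

lemma AE_measure_preserving:
  assumes "measure_preserving M N f" "AE y in N. P y"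
  shows "AE x in M. P (f x)"
proof -
  have f: "f \<in> M \<rightarrow>\<^sub>M N" "distr M N f = N" using assms(1) by (auto simp: measure_preserving_def)
  show ?thesis by (rule AE_distrD[OF f(1)]) (unfold f(2), rule assms(2))
qed

lemma measure_preserving_comp:
  assumes "measure_preserving M N f" "measure_preserving N L g"
  shows "measure_preserving M L (\<lambda>x. g (f x))"
proof -
  have f: "f \<in> M \<rightarrow>\<^sub>M N" "distr M N f = N" and g: "g \<in> N \<rightarrow>\<^sub>M L" "distr N L g = L"
    using assms by (auto simp: measure_preserving_def)
  have "distr M L (\<lambda>x. g (f x)) = distr (distr M N f) L g"
    using distr_distr[OF g(1) f(1)] by (simp add: comp_def)
  also have "\<dots> = L" unfolding f(2) by (rule g(2))
  finally show ?thesis using f g by (simp add: measure_preserving_def measurable_compose)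
qed

lemma AE_measure_preserving_iff:
  assumes f: "measure_preserving M N f" and P: "{y \<in> space N. P y} \<in> sets N"
  shows "(AE y in N. P y) \<longleftrightarrow> (AE x in M. P (f x))"
proof -
  have f: "f \<in> M \<rightarrow>\<^sub>M N" "distr M N f = N" using assms(1) by (auto simp: measure_preserving_def)
  show ?thesis using AE_distr_iff[OF f(1) P] unfolding f(2) .
qed

lemma AE_eq_real_measurable:
  assumes "u \<in> borel_measurable M" "v \<in> borel_measurable M"
  shows "{x \<in> space M. u x = (v x :: real)} \<in> sets M"
  using assms by measurable

lemma measurable_coord_shift: "coord_shift \<alpha> \<in> borel_of Y_hat \<rightarrow>\<^sub>M borel_of Y_hat"
  by (rule measurable_borel_of_continuous_map) (rule continuous_map_shift)

lemma coord_shift_coord_shift: "coord_shift \<beta> (coord_shift \<alpha> y) = coord_shift (\<beta> + \<alpha>) y"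
  by (simp add: coord_shift_def add.assoc)

text \<open>Shifting the name of \<open>x\<close> by \<alpha> gives the name of
  \<open>T \<alpha> x\<close>, off one null set because there are countably many coordinates, and
  \<open>T \<alpha>\<close> preserves \<open>M\<close>. The space is left general since the lemma
  serves both for \<open>Y_measure\<close> and for a product space in the density argument.\<close>

lemma distr_name_in_SIM:
  fixes T :: "'g::{group_add,countable} \<Rightarrow> 'a \<Rightarrow> 'a"
  assumes M: "prob_space M" and T: "\<And>g. measure_preserving M M (T g)"
    and act: "\<And>b a. AE x in M. T (b + a) x = T b (T a x)" and u: "u \<in> M \<rightarrow>\<^sub>M Y_measure"
  shows "distr M (borel_of Y_hat) (\<lambda>x g. u (T g x)) \<in> SIM"
proof -
  let ?n = "\<lambda>x g. u (T g x)"
  have Tm: "T g \<in> M \<rightarrow>\<^sub>M M" "distr M M (T g) = M" for g using T by (auto simp: measure_preserving_def)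
  have n: "?n \<in> M \<rightarrow>\<^sub>M borel_of Y_hat"
    by (rule measurable_into_Y_hat) (rule measurable_compose[OF Tm(1) u])
  let ?\<mu> = "distr M (borel_of Y_hat) ?n"
  have "measure_preserving ?\<mu> ?\<mu> (coord_shift \<alpha>)" for \<alpha>
  proof -
    have "AE x in M. \<forall>g. T (g + \<alpha>) x = T g (T \<alpha> x)" using act by (simp add: AE_all_countable)
    then have ae: "AE x in M. coord_shift \<alpha> (?n x) = ?n (T \<alpha> x)"
      by eventually_elim (simp add: coord_shift_def)
    have "distr ?\<mu> (borel_of Y_hat) (coord_shift \<alpha>) = distr M (borel_of Y_hat) (\<lambda>x. coord_shift \<alpha> (?n x))"
      by (simp only: distr_distr[OF measurable_coord_shift n] comp_def)
    also have "\<dots> = distr M (borel_of Y_hat) (\<lambda>x. ?n (T \<alpha> x))"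
      by (rule distr_cong_AE[OF refl refl ae])
         (rule measurable_compose[OF n measurable_coord_shift], rule measurable_compose[OF Tm(1) n])
    also have "\<dots> = distr (distr M M (T \<alpha>)) (borel_of Y_hat) ?n"
      by (simp only: distr_distr[OF n Tm(1)] comp_def)
    also have "\<dots> = ?\<mu>" by (simp add: Tm(2))
    finally have "distr ?\<mu> (borel_of Y_hat) (coord_shift \<alpha>) = ?\<mu>" .
    moreover have "distr ?\<mu> ?\<mu> (coord_shift \<alpha>) = distr ?\<mu> (borel_of Y_hat) (coord_shift \<alpha>)"
      by (rule distr_cong) auto
    ultimately have "distr ?\<mu> ?\<mu> (coord_shift \<alpha>) = ?\<mu>" by simp
    then show ?thesis using measurable_coord_shift by (simp add: measure_preserving_def)
  qed
  then show ?thesis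
    using prob_space.prob_space_distr[OF M n] by (simp add: SIM_def)
qed

section \<open>Names of points and the isomorphism given by them\<close>

lemma gaction_Y_measureD:
  assumes "gaction Y_measure T"
  shows "measure_preserving Y_measure Y_measure (T g)"
    and "AE x in Y_measure. T (b + a) x = T b (T a x)"
    and "T g \<in> Y_measure \<rightarrow>\<^sub>M Y_measure"
    and "t \<in> {0..<1} \<Longrightarrow> T g t \<in> {0..<1}"
proof -
  show "T g \<in> Y_measure \<rightarrow>\<^sub>M Y_measure" using assms by (simp add: gaction_def measure_preserving_def)
  then show "t \<in> {0..<1} \<Longrightarrow> T g t \<in> {0..<1}" by (metis measurable_space space_Y_measure)
qed (use assms in \<open>auto simp: gaction_def\<close>)

text \<open>The orbit of \<open>t\<close> observed through the quantile function. Since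
  \<open>T 0\<close> is the identity only modulo null sets, the zeroth coordinate equals
  \<open>quantile F t\<close> only almost everywhere.\<close>

definition name :: "(real \<Rightarrow> real) \<Rightarrow> ('g \<Rightarrow> real \<Rightarrow> real) \<Rightarrow> real \<Rightarrow> 'g \<Rightarrow> real" where
  "name F T t g = quantile F (T g t)"

definition coding :: "(real \<Rightarrow> real) \<Rightarrow> ('g \<Rightarrow> real \<Rightarrow> real) set \<Rightarrow> ('g \<Rightarrow> real) measure" where
  "coding F c = distr Y_measure (borel_of Y_hat) (name F (rep c))"

lemma measurable_name:
  fixes T :: "'g::{group_add,countable} \<Rightarrow> _"
  assumes "unit_cdf F" "gaction Y_measure T"
  shows "name F T \<in> Y_measure \<rightarrow>\<^sub>M borel_of Y_hat"
  unfolding name_def[abs_def]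
  by (rule measurable_into_Y_hat)
     (rule measurable_compose[OF gaction_Y_measureD(3)[OF assms(2)] measurable_quantile[OF assms(1)]])

lemma coding_in_SIM:
  assumes "unit_cdf F" "c \<in> Y_actions"
  shows "coding F c \<in> SIM"
  unfolding coding_def name_def[abs_def]
  by (rule distr_name_in_SIM)
     (use gaction_Y_measureD[OF gaction_rep[OF assms(2)]] measurable_quantile[OF assms(1)]
        prob_space_Y_measure in auto)

lemma name_preserving:
  assumes "unit_cdf F" "c \<in> Y_actions"
  shows "measure_preserving Y_measure (coding F c) (name F (rep c))"
proof -
  have n: "name F (rep c) \<in> Y_measure \<rightarrow>\<^sub>M borel_of Y_hat"
    using assms by (intro measurable_name gaction_rep)
  then have "distr Y_measure (coding F c) (name F (rep c)) = coding F c"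
    unfolding coding_def by (intro distr_cong) auto
  then show ?thesis using n by (simp add: measure_preserving_def coding_def)
qed

text \<open>A distribution function takes the value 1, which is not a point of
  \<open>{0..<1}\<close>. The default 0 makes maps total with values in \<open>{0..<1}\<close>; for
  the measures to which it is applied, the value is already in range almost everywhere.\<close>

definition clip :: "real \<Rightarrow> real" where "clip x = (if 0 \<le> x \<and> x < 1 then x else 0)"

lemma clip_eq [simp]: "0 \<le> x \<Longrightarrow> x < 1 \<Longrightarrow> clip x = x" by (simp add: clip_def)

lemma measurable_clip [measurable]: "clip \<in> borel_measurable borel"
  unfolding clip_def[abs_def] by measurable

lemma borel_measurable_unit_cdf: "unit_cdf F \<Longrightarrow> F \<in> borel_measurable borel"
  by (rule borel_measurable_continuous_onI) (simp add: unit_cdf_def)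

lemma measurable_clip_cdf: "unit_cdf F \<Longrightarrow> (\<lambda>x. clip (F x)) \<in> Y_measure \<rightarrow>\<^sub>M Y_measure"
  unfolding measurable_Y_measure_iff
  by (intro conjI borel_measurable_Y_measure measurable_compose[OF borel_measurable_unit_cdf measurable_clip])
     (auto simp: clip_def)

text \<open>A name is inverted by applying \<open>F\<close> to its zeroth coordinate, because
  \<open>F\<close> undoes the quantile function. Hence one coordinate already carries the whole
  point, and the shift corresponds to the action.\<close>

lemma isomorphic_coding:
  fixes c :: "('g::{group_add,countable} \<Rightarrow> real \<Rightarrow> real) set"
  assumes F: "unit_cdf F" and c: "c \<in> Y_actions"
  shows "isomorphic (Real_System Y_measure (rep c)) (Fun_System (coding F c) coord_shift)"
proof -
  note T = gaction_Y_measureD[OF gaction_rep[OF c]]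
  let ?T = "rep c" and ?\<phi> = "name F (rep c)" and ?\<psi> = "\<lambda>y :: 'g \<Rightarrow> real. clip (F (y 0))"
  let ?\<mu> = "coding F c"
  have \<phi>: "measure_preserving Y_measure ?\<mu> ?\<phi>" by (rule name_preserving[OF F c])
  have sets\<mu>: "sets ?\<mu> = sets (borel_of Y_hat)" by (simp add: coding_def)
  have T0: "AE t in Y_measure. ?T 0 t = t" by (rule gaction_zero[OF gaction_rep[OF c]])
  have \<psi>\<phi>: "AE t in Y_measure. ?\<psi> (?\<phi> t) = t"
    using T0 AE_space
  proof eventually_elim
    case (elim t)
    then show ?case using quantile_right_inverse[OF F, of t] by (simp add: name_def)
  qed
  have \<psi>m: "?\<psi> \<in> borel_of Y_hat \<rightarrow>\<^sub>M Y_measure"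
    using measurable_compose[OF measurable_coordinate measurable_clip_cdf[OF F]] .
  then have \<psi>m': "?\<psi> \<in> ?\<mu> \<rightarrow>\<^sub>M Y_measure" by (simp add: measurable_cong_sets[OF sets\<mu> refl])
  have "distr ?\<mu> Y_measure ?\<psi> = distr Y_measure Y_measure (\<lambda>t. ?\<psi> (?\<phi> t))"
    unfolding coding_def
    by (simp only: distr_distr[OF \<psi>m measurable_name[OF F gaction_rep[OF c]]] comp_def)
  also have "\<dots> = distr Y_measure Y_measure (\<lambda>t. t)"
    using \<phi> by (intro distr_cong_AE[OF refl refl \<psi>\<phi>] measurable_ident_sets measurable_compose[OF _ \<psi>m'])
      (auto simp: measure_preserving_def)
  finally have \<psi>: "measure_preserving ?\<mu> Y_measure ?\<psi>"
    using \<psi>m' by (simp add: measure_preserving_def distr_id2)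
  have nm: "(\<lambda>y. ?\<phi> (?T \<gamma> (?\<psi> y)) g) \<in> borel_measurable ?\<mu>" for \<gamma> g
    unfolding name_def
    using measurable_compose[OF measurable_compose[OF measurable_compose[OF \<psi>m' T(3)[of \<gamma>]] T(3)[of g]] measurable_quantile[OF F]]
    by (simp add: measurable_Y_measure_iff)
  have nm0: "(\<lambda>y. ?\<phi> (?\<psi> y) g) \<in> borel_measurable ?\<mu>" for g
    unfolding name_def
    using measurable_compose[OF measurable_compose[OF \<psi>m' T(3)[of g]] measurable_quantile[OF F]]
    by (simp add: measurable_Y_measure_iff)
  have cm: "(\<lambda>y. y g) \<in> borel_measurable ?\<mu>" for g
    by (subst measurable_cong_sets[OF sets\<mu> refl]) (rule measurable_coordinate_real)
  have \<phi>\<psi>: "AE y in ?\<mu>. ?\<phi> (?\<psi> y) = y"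
  proof -
    \<comment> \<open>The identity is checked after pulling back along \<open>?\<phi>\<close>, which
      requires a measurable set of solutions. Splitting into real coordinates provides it, and
      countably many null sets are joined afterwards.\<close>
    have "AE y in ?\<mu>. ?\<phi> (?\<psi> y) g = y g" for g
      unfolding AE_measure_preserving_iff[OF \<phi> AE_eq_real_measurable[OF nm0 cm]]
      using \<psi>\<phi> by eventually_elim simp
    then have "AE y in ?\<mu>. \<forall>g. ?\<phi> (?\<psi> y) g = y g" by (simp add: AE_all_countable)
    then show ?thesis by eventually_elim auto
  qed
  have eq: "AE y in ?\<mu>. coord_shift \<gamma> y = ?\<phi> (?T \<gamma> (?\<psi> y))" for \<gamma>
  proof -
    have "AE y in ?\<mu>. y (g + \<gamma>) = ?\<phi> (?T \<gamma> (?\<psi> y)) g" for g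
      unfolding AE_measure_preserving_iff[OF \<phi> AE_eq_real_measurable[OF cm nm]]
      using \<psi>\<phi> T(2)[of g \<gamma>] by eventually_elim (simp add: name_def)
    then have "AE y in ?\<mu>. \<forall>g. y (g + \<gamma>) = ?\<phi> (?T \<gamma> (?\<psi> y)) g" by (simp add: AE_all_countable)
    then show ?thesis by eventually_elim (auto simp: coord_shift_def)
  qed
  show ?thesis
    unfolding isomorphic.simps isomorphic_actions_def
    using \<phi> \<psi> \<psi>\<phi> \<phi>\<psi> eq by (intro exI[of _ ?\<phi>] exI[of _ ?\<psi>] conjI allI)
qed

section \<open>Continuity of the coding\<close>

lemma integrable_Y_measure:
  fixes f :: "real \<Rightarrow> real"
  assumes "f \<in> borel_measurable Y_measure" "\<And>t. t \<in> {0..<1} \<Longrightarrow> \<bar>f t\<bar> \<le> B"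
  shows "integrable Y_measure f"
proof -
  interpret prob_space Y_measure by (rule prob_space_Y_measure)
  show ?thesis
    by (rule integrable_const_bound[where B = B]) (use assms in auto)
qed

text \<open>The number of thresholds \<open>k / n\<close> below \<open>v\<close> is the floor of
  \<open>n * v\<close>. The lemma writes a function with values in \<open>{0..1}\<close> as an
  average of \<open>n\<close> indicators of level sets, up to \<open>1 / n\<close>.\<close>

lemma discretization_error:
  fixes v :: real
  assumes v: "0 \<le> v" "v \<le> 1" and n: "0 < n"
  shows "\<bar>v - (\<Sum>k\<in>{1..n}. of_bool (real k / real n \<le> v)) / real n\<bar> \<le> 1 / real n"
proof -
  let ?m = "nat \<lfloor>real n * v\<rfloor>"
  have nv: "0 \<le> real n * v" "real n * v \<le> real n" using v n by (auto simp: mult_left_le)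
  have "{k \<in> {1..n}. real k / real n \<le> v} = {1..?m}"
  proof (intro equalityI subsetI)
    fix k assume k: "k \<in> {k \<in> {1..n}. real k / real n \<le> v}"
    then have "real k \<le> real n * v" using n by (simp add: field_simps)
    then show "k \<in> {1..?m}" using k by (auto simp: le_nat_iff le_floor_iff)
  next
    fix k assume k: "k \<in> {1..?m}"
    then have "int k \<le> \<lfloor>real n * v\<rfloor>" by auto
    then have kn: "real k \<le> real n * v" by (simp add: le_floor_iff)
    then have "k \<le> n" using nv by linarith
    then show "k \<in> {k \<in> {1..n}. real k / real n \<le> v}" using k kn n by (auto simp: field_simps)
  qed
  then have eq: "{1..n} \<inter> {k. real k / real n \<le> v} = {1..?m}" by (simp only: Collect_conj_eq Collect_mem_eq)
  have "(\<Sum>k\<in>{1..n}. of_bool (real k / real n \<le> v) :: real) = real (card {1..?m})"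
    unfolding eq[symmetric] by (rule sum_of_bool_eq) simp_all
  then have s: "(\<Sum>k\<in>{1..n}. of_bool (real k / real n \<le> v) :: real) = real ?m" by simp
  have "real ?m = of_int \<lfloor>real n * v\<rfloor>" using nv(1) by simp
  then have "\<bar>real n * v - real ?m\<bar> \<le> 1" by linarith
  then have d: "\<bar>real n * v - real ?m\<bar> / real n \<le> 1 / real n" by (rule divide_right_mono) simp
  have "v - real ?m / real n = (real n * v - real ?m) / real n"
    using n by (simp add: field_simps)
  then have "\<bar>v - real ?m / real n\<bar> = \<bar>real n * v - real ?m\<bar> / real n"
    using n by (simp add: abs_divide)
  then show ?thesis using d s by simp
qed

lemma measurable_preimage_level:
  fixes g :: "real \<Rightarrow> real"
  assumes "g \<in> borel_measurable Y_measure"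
  shows "{t \<in> {0..<1}. a \<le> g t} \<in> sets Y_measure"
proof -
  have "{t \<in> space Y_measure. a \<le> g t} \<in> sets Y_measure" using assms by measurable
  then show ?thesis by simp
qed

lemma integral_of_bool_sym_diff:
  assumes T: "T \<in> Y_measure \<rightarrow>\<^sub>M Y_measure" and R: "R \<in> Y_measure \<rightarrow>\<^sub>M Y_measure" and E: "E \<in> sets Y_measure"
  shows "(\<integral>t. \<bar>of_bool (T t \<in> E) - of_bool (R t \<in> E) :: real\<bar> \<partial>Y_measure)
    = measure Y_measure (sym_diff (T -` E \<inter> space Y_measure) (R -` E \<inter> space Y_measure))"
proof -
  let ?S = "sym_diff (T -` E \<inter> space Y_measure) (R -` E \<inter> space Y_measure)"
  have "(\<integral>t. \<bar>of_bool (T t \<in> E) - of_bool (R t \<in> E) :: real\<bar> \<partial>Y_measure)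
      = (\<integral>t. indicator ?S t \<partial>Y_measure)"
    by (rule Bochner_Integration.integral_cong) (auto simp: indicator_def)
  also have "\<dots> = measure Y_measure (?S \<inter> space Y_measure)" by simp
  also have "?S \<inter> space Y_measure = ?S" by auto
  finally show ?thesis .
qed

text \<open>Coarse convergence speaks of one measurable set at a time. Slicing \<open>g\<close> into
  \<open>n\<close> level sets replaces the difference of functions by finitely many symmetric
  differences, up to twice the discretization error.\<close>

lemma coarse_limit_L1:
  fixes g :: "real \<Rightarrow> real" and c :: "'i \<Rightarrow> ('g::{group_add,countable} \<Rightarrow> real \<Rightarrow> real) set"
  assumes lim: "limitin coarse_topology c d Fl"
    and g: "g \<in> borel_measurable Y_measure" "\<And>t. t \<in> {0..<1} \<Longrightarrow> 0 \<le> g t \<and> g t \<le> 1"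
  shows "((\<lambda>i. \<integral>t. \<bar>g (rep (c i) \<gamma> t) - g (rep d \<gamma> t)\<bar> \<partial>Y_measure) \<longlongrightarrow> 0) Fl"
proof (rule tendstoI)
  fix \<epsilon> :: real assume \<epsilon>: "0 < \<epsilon>"
  obtain n :: nat where n: "0 < n" "1 / real n < \<epsilon> / 4"
    using nat_approx_posE[of "\<epsilon> / 4"] \<epsilon> by (metis divide_pos_pos zero_less_numeral zero_less_Suc)
  define E where "E k = {t \<in> {0..<1}. real k / real n \<le> g t}" for k
  have E: "E k \<in> sets Y_measure" for k unfolding E_def by (rule measurable_preimage_level[OF g(1)])
  have d: "d \<in> Y_actions" and ev: "eventually (\<lambda>i. c i \<in> Y_actions) Fl"
    and cd: "\<And>k. ((\<lambda>i. coarse_dist \<gamma> (E k) (c i) d) \<longlongrightarrow> 0) Fl"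
    using lim E unfolding limitin_coarse_topology by auto
  have "((\<lambda>i. \<Sum>k\<in>{1..n}. coarse_dist \<gamma> (E k) (c i) d) \<longlongrightarrow> (\<Sum>k\<in>{1..n}. 0)) Fl"
    by (intro tendsto_sum cd)
  then have ev2: "eventually (\<lambda>i. (\<Sum>k\<in>{1..n}. coarse_dist \<gamma> (E k) (c i) d) < \<epsilon> / 2) Fl"
    using \<epsilon> by (intro order_tendstoD(2)) auto
  from ev ev2 show "eventually (\<lambda>i. dist (\<integral>t. \<bar>g (rep (c i) \<gamma> t) - g (rep d \<gamma> t)\<bar> \<partial>Y_measure) 0 < \<epsilon>) Fl"
  proof eventually_elim
    case (elim i)
    let ?T = "rep (c i) \<gamma>" and ?R = "rep d \<gamma>"
    note T = gaction_Y_measureD(3,4)[OF gaction_rep[OF elim(1)], where g = \<gamma>]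
    note R = gaction_Y_measureD(3,4)[OF gaction_rep[OF d], where g = \<gamma>]
    have gT: "(\<lambda>t. g (?T t)) \<in> borel_measurable Y_measure" "(\<lambda>t. g (?R t)) \<in> borel_measurable Y_measure"
      using measurable_compose[OF T(1) g(1)] measurable_compose[OF R(1) g(1)] by auto
    have im: "(\<lambda>t. of_bool (Q t \<in> E k) :: real) \<in> borel_measurable Y_measure"
      if "Q \<in> Y_measure \<rightarrow>\<^sub>M Y_measure" for Q k
      using measurable_compose[OF that borel_measurable_indicator[OF E[of k]]]
      by (simp add: indicator_def of_bool_def cong: if_cong)
    have ib: "integrable Y_measure (\<lambda>t. \<bar>of_bool (?T t \<in> E k) - of_bool (?R t \<in> E k)\<bar> :: real)" for k
      by (rule integrable_Y_measure[where B = 1]) (use im[OF T(1)] im[OF R(1)] in auto)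
    have pt: "\<bar>g (?T t) - g (?R t)\<bar>
        \<le> 2 / real n + (\<Sum>k\<in>{1..n}. \<bar>of_bool (?T t \<in> E k) - of_bool (?R t \<in> E k)\<bar>)"
      if t: "t \<in> space Y_measure" for t
    proof -
      have TR: "?T t \<in> {0..<1}" "?R t \<in> {0..<1}" using T(2) R(2) t by auto
      let ?s = "\<lambda>x. (\<Sum>k\<in>{1..n}. of_bool (x \<in> E k)) / real n"
      have s: "\<bar>g x - ?s x\<bar> \<le> 1 / real n" if "x \<in> {0..<1}" for x
        using discretization_error[of "g x" n] g(2)[OF that] n that by (simp add: E_def)
      have "?s (?T t) - ?s (?R t) = (\<Sum>k\<in>{1..n}. of_bool (?T t \<in> E k) - of_bool (?R t \<in> E k)) / real n"
        by (simp add: sum_subtractf diff_divide_distrib)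
      also have "\<bar>\<dots>\<bar> \<le> (\<Sum>k\<in>{1..n}. \<bar>of_bool (?T t \<in> E k) - of_bool (?R t \<in> E k)\<bar>) / real n"
        by (simp add: abs_divide divide_right_mono sum_abs)
      also have "\<dots> \<le> (\<Sum>k\<in>{1..n}. \<bar>of_bool (?T t \<in> E k) - of_bool (?R t \<in> E k)\<bar>)"
        using n by (intro divide_le_eq[THEN iffD2]) (auto intro!: mult_left_mono[of 1 "real n", simplified] sum_nonneg)
      finally show ?thesis using s[OF TR(1)] s[OF TR(2)] by linarith
    qed
    have "(\<integral>t. \<bar>g (?T t) - g (?R t)\<bar> \<partial>Y_measure)
        \<le> (\<integral>t. 2 / real n + (\<Sum>k\<in>{1..n}. \<bar>of_bool (?T t \<in> E k) - of_bool (?R t \<in> E k)\<bar>) \<partial>Y_measure)"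
    proof (rule integral_mono)
      have "\<bar>\<bar>g (?T t) - g (?R t)\<bar>\<bar> \<le> 1" if "t \<in> {0..<1}" for t
        using g(2)[OF T(2)[OF that]] g(2)[OF R(2)[OF that]] by auto
      then show "integrable Y_measure (\<lambda>t. \<bar>g (?T t) - g (?R t)\<bar>)"
        using gT by (intro integrable_Y_measure[where B = 1]) auto
      show "integrable Y_measure (\<lambda>t. 2 / real n + (\<Sum>k\<in>{1..n}. \<bar>of_bool (?T t \<in> E k) - of_bool (?R t \<in> E k)\<bar>))"
        by (intro Bochner_Integration.integrable_add Bochner_Integration.integrable_sum ib integrable_Y_measure[where B = "2 / real n"]) auto
    qed (rule pt)
    also have "\<dots> = 2 / real n + (\<Sum>k\<in>{1..n}. coarse_dist \<gamma> (E k) (c i) d)"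
    proof -
      interpret prob_space Y_measure by (rule prob_space_Y_measure)
      have "(\<integral>t. 2 / real n + (\<Sum>k\<in>{1..n}. \<bar>of_bool (?T t \<in> E k) - of_bool (?R t \<in> E k)\<bar>) \<partial>Y_measure)
          = (\<integral>t. 2 / real n \<partial>Y_measure) + (\<Sum>k\<in>{1..n}. (\<integral>t. \<bar>of_bool (?T t \<in> E k) - of_bool (?R t \<in> E k)\<bar> \<partial>Y_measure))"
        by (subst Bochner_Integration.integral_add) (auto simp: Bochner_Integration.integral_sum ib intro!: Bochner_Integration.integrable_sum ib)
      then show ?thesis using prob_space
        by (simp add: integral_of_bool_sym_diff[OF T(1) R(1) E] coarse_dist_def)
    qed
    also have "\<dots> < \<epsilon>" using n(2) elim(2) by (simp add: field_simps)
    finally show ?case by (simp add: abs_of_nonneg integral_nonneg)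
  qed
qed

lemma integral_measure_preserving:
  fixes f :: "'b \<Rightarrow> real"
  assumes "measure_preserving M N T" "f \<in> borel_measurable N"
  shows "(\<integral>x. f (T x) \<partial>M) = (\<integral>y. f y \<partial>N)"
proof -
  have T: "T \<in> M \<rightarrow>\<^sub>M N" "distr M N T = N" using assms(1) by (auto simp: measure_preserving_def)
  have "(\<integral>y. f y \<partial>distr M N T) = (\<integral>x. f (T x) \<partial>M)" by (rule integral_distr[OF T(1) assms(2)])
  then show ?thesis unfolding T(2) by simp
qed

lemma borel_measurable_quantile: "unit_cdf F \<Longrightarrow> quantile F \<in> borel_measurable Y_measure"
  using measurable_quantile by (simp add: measurable_Y_measure_iff)

lemma measurable_name_coordinate:
  assumes "unit_cdf F" "c \<in> Y_actions"
  shows "(\<lambda>t. name F (rep c) t g) \<in> Y_measure \<rightarrow>\<^sub>M Y_measure"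
  unfolding name_def
  by (rule measurable_compose[OF gaction_Y_measureD(3)[OF gaction_rep[OF assms(2)]] measurable_quantile[OF assms(1)]])

lemma name_bounds:
  assumes "unit_cdf F" "c \<in> Y_actions" "t \<in> {0..<1}"
  shows "0 \<le> name F (rep c) t g \<and> name F (rep c) t g < 1"
  using quantile_bounds[OF assms(1)] gaction_Y_measureD(4)[OF gaction_rep[OF assms(2)] assms(3)]
  by (auto simp: name_def)

lemma integral_coding:
  fixes f :: "('g::{group_add,countable} \<Rightarrow> real) \<Rightarrow> real"
  assumes "unit_cdf F" "c \<in> Y_actions" "f \<in> borel_measurable (borel_of Y_hat)"
  shows "(\<integral>y. f y \<partial>coding F c) = (\<integral>t. f (name F (rep c) t) \<partial>Y_measure)"
  unfolding coding_def by (rule integral_distr[OF measurable_name[OF assms(1) gaction_rep[OF assms(2)]] assms(3)])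

text \<open>Each coordinate of the two names is compared through \<open>quantile F0\<close>
  evaluated along the approximating action. Changing \<open>F i\<close> to \<open>F0\<close> costs
  at most the uniform distance, as the action preserves measure; changing the action is coarse
  convergence applied to the fixed bounded function \<open>quantile F0\<close>.\<close>

lemma limitin_coding:
  fixes c :: "'i \<Rightarrow> ('g::{group_add,countable} \<Rightarrow> real \<Rightarrow> real) set"
  assumes F: "eventually (\<lambda>i. unit_cdf (F i)) Fl" "unit_cdf F0"
    and FF: "\<And>\<epsilon>. 0 < \<epsilon> \<Longrightarrow> eventually (\<lambda>i. \<forall>x. \<bar>F i x - F0 x\<bar> \<le> \<epsilon>) Fl"
    and c: "limitin coarse_topology c d Fl"
  shows "limitin weak_star_topology (\<lambda>i. coding (F i) (c i)) (coding F0 d) Fl"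
  unfolding limitin_weak_star_topology
proof (intro conjI allI impI)
  have d: "d \<in> Y_actions" and ev: "eventually (\<lambda>i. c i \<in> Y_actions) Fl"
    using c unfolding limitin_coarse_topology by auto
  show "coding F0 d \<in> SIM" by (rule coding_in_SIM[OF F(2) d])
  show "eventually (\<lambda>i. coding (F i) (c i) \<in> SIM) Fl"
    using F(1) ev by eventually_elim (rule coding_in_SIM)
  fix f :: "('g \<Rightarrow> real) \<Rightarrow> real" assume f: "continuous_map Y_hat euclideanreal f"
  have fm: "f \<in> borel_measurable (borel_of Y_hat)" by (rule borel_measurable_continuous_map[OF f])
  obtain Bd where Bd: "\<And>y. y \<in> topspace Y_hat \<Longrightarrow> \<bar>f y\<bar> \<le> Bd"
    using continuous_map_bounded[OF compact_space_Y_hat f] by blast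
  show "((\<lambda>i. \<integral>y. f y \<partial>coding (F i) (c i)) \<longlongrightarrow> (\<integral>y. f y \<partial>coding F0 d)) Fl"
  proof (rule tendstoI)
    fix \<epsilon> :: real assume \<epsilon>: "0 < \<epsilon>"
    obtain G C where G: "finite G" "0 \<le> C" "\<And>x y. x \<in> topspace Y_hat \<Longrightarrow> y \<in> topspace Y_hat \<Longrightarrow>
        \<bar>f x - f y\<bar> \<le> \<epsilon> / 4 + C * (\<Sum>g\<in>G. \<bar>x g - y g\<bar>)"
      using continuous_Y_hat_modulus[OF f, of "\<epsilon> / 4"] \<epsilon> by auto
    let ?W = "\<lambda>i g. \<integral>t. \<bar>quantile F0 (rep (c i) g t) - quantile F0 (rep d g t)\<bar> \<partial>Y_measure"
    have "((\<lambda>i. C * (\<Sum>g\<in>G. ?W i g)) \<longlongrightarrow> C * (\<Sum>g\<in>G. 0)) Fl"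
      using quantile_bounds[OF F(2)] borel_measurable_quantile[OF F(2)]
      by (intro tendsto_mult_left tendsto_sum coarse_limit_L1[OF c]) (auto simp: less_imp_le)
    then have ev1: "eventually (\<lambda>i. C * (\<Sum>g\<in>G. ?W i g) < \<epsilon> / 4) Fl"
      using \<epsilon> by (intro order_tendstoD(2)) auto
    \<comment> \<open>One quarter of \<epsilon> is reserved for each of the modulus, the change of
      \<open>F\<close> and the change of the action; the summand 1 avoids division by zero.\<close>
    define \<delta> where "\<delta> = \<epsilon> / (4 * (C * real (card G) + 1))"
    have CG: "0 \<le> C * real (card G)" using G(2) by simp
    have \<delta>: "0 < \<delta>" "C * real (card G) * \<delta> \<le> \<epsilon> / 4"
      using \<epsilon> CG by (auto simp: \<delta>_def field_simps)
    from F(1) ev ev1 FF[OF \<delta>(1)]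
    show "eventually (\<lambda>i. dist (\<integral>y. f y \<partial>coding (F i) (c i)) (\<integral>y. f y \<partial>coding F0 d) < \<epsilon>) Fl"
    proof eventually_elim
      case (elim i)
      let ?n = "name (F i) (rep (c i))" and ?m = "name F0 (rep d)"
      have top: "?n t \<in> topspace Y_hat" "?m t \<in> topspace Y_hat" if "t \<in> {0..<1}" for t
        using name_bounds[OF elim(1,2) that] name_bounds[OF F(2) d that] by (auto simp: mem_topspace_Y_hat)
      have intf: "integrable Y_measure (\<lambda>t. f (?n t))" "integrable Y_measure (\<lambda>t. f (?m t))"
        using measurable_compose[OF measurable_name[OF elim(1) gaction_rep[OF elim(2)]] fm]
          measurable_compose[OF measurable_name[OF F(2) gaction_rep[OF d]] fm] Bd top
        by (auto intro!: integrable_Y_measure[where B = Bd])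
      have mc: "(\<lambda>t. ?n t g) \<in> borel_measurable Y_measure" "(\<lambda>t. ?m t g) \<in> borel_measurable Y_measure" for g
        using measurable_name_coordinate[OF elim(1,2)] measurable_name_coordinate[OF F(2) d]
        by (auto simp: measurable_Y_measure_iff)
      have bd: "\<bar>?n t g - ?m t g\<bar> \<le> 1" if "t \<in> {0..<1}" for t g
        using name_bounds[OF elim(1,2) that, of g] name_bounds[OF F(2) d that, of g] by linarith
      have intd: "integrable Y_measure (\<lambda>t. \<bar>?n t g - ?m t g\<bar>)" for g
        using mc[of g] bd by (intro integrable_Y_measure[where B = 1]) auto
      have step: "(\<integral>t. \<bar>?n t g - ?m t g\<bar> \<partial>Y_measure) \<le> \<delta> + ?W i g" for g
      proof -
        note T = gaction_Y_measureD[OF gaction_rep[OF elim(2)]]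
        have qm: "(\<lambda>t. quantile F0 (rep (c i) g t)) \<in> borel_measurable Y_measure"
          using measurable_compose[OF T(3) borel_measurable_quantile[OF F(2)]] .
        have qb: "\<bar>quantile F0 (rep (c i) g t)\<bar> \<le> 1" if "t \<in> {0..<1}" for t
          using quantile_bounds[OF F(2), of "rep (c i) g t"] T(4)[OF that, of g] by auto
        have nb: "\<bar>?n t g\<bar> \<le> 1" "\<bar>?m t g\<bar> \<le> 1" if "t \<in> {0..<1}" for t
          using name_bounds[OF elim(1,2) that, of g] name_bounds[OF F(2) d that, of g] by auto
        have i1: "integrable Y_measure (\<lambda>t. \<bar>?n t g - quantile F0 (rep (c i) g t)\<bar>)"
          using mc(1)[of g] qm qb nb(1) by (intro integrable_Y_measure[where B = 2]) (simp, smt (verit))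
        have i2: "integrable Y_measure (\<lambda>t. \<bar>quantile F0 (rep (c i) g t) - ?m t g\<bar>)"
          using mc(2)[of g] qm qb nb(2) by (intro integrable_Y_measure[where B = 2]) (simp, smt (verit))
        have "(\<integral>t. \<bar>?n t g - ?m t g\<bar> \<partial>Y_measure) \<le>
          (\<integral>t. \<bar>?n t g - quantile F0 (rep (c i) g t)\<bar> + \<bar>quantile F0 (rep (c i) g t) - ?m t g\<bar> \<partial>Y_measure)"
          by (intro integral_mono intd Bochner_Integration.integrable_add i1 i2) simp
        also have "\<dots> = (\<integral>t. \<bar>?n t g - quantile F0 (rep (c i) g t)\<bar> \<partial>Y_measure) + ?W i g"
          by (subst Bochner_Integration.integral_add[OF i1 i2]) (simp add: name_def)
        also have "(\<integral>t. \<bar>?n t g - quantile F0 (rep (c i) g t)\<bar> \<partial>Y_measure)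
          = (\<integral>t. \<bar>quantile (F i) t - quantile F0 t\<bar> \<partial>Y_measure)"
          unfolding name_def
          using borel_measurable_quantile[OF F(2)] borel_measurable_quantile[OF elim(1)]
          by (intro integral_measure_preserving[OF T(1), where f = "\<lambda>t. \<bar>quantile (F i) t - quantile F0 t\<bar>"]) auto
        also have "\<dots> \<le> \<delta>" using quantile_L1_le[OF elim(1) F(2)] elim(4) by auto
        finally show ?thesis by simp
      qed
      have "\<bar>(\<integral>t. f (?n t) \<partial>Y_measure) - (\<integral>t. f (?m t) \<partial>Y_measure)\<bar>
          = \<bar>\<integral>t. f (?n t) - f (?m t) \<partial>Y_measure\<bar>"
        using intf by simp
      also have "\<dots> \<le> (\<integral>t. \<bar>f (?n t) - f (?m t)\<bar> \<partial>Y_measure)"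
        by (rule integral_abs_bound)
      also have "\<dots> \<le> (\<integral>t. \<epsilon> / 4 + C * (\<Sum>g\<in>G. \<bar>?n t g - ?m t g\<bar>) \<partial>Y_measure)"
      proof (rule integral_mono)
        show "integrable Y_measure (\<lambda>t. \<bar>f (?n t) - f (?m t)\<bar>)" using intf by auto
        have "integrable Y_measure (\<lambda>t. C * (\<Sum>g\<in>G. \<bar>?n t g - ?m t g\<bar>))"
          by (rule integrable_mult_right) (rule Bochner_Integration.integrable_sum, rule intd)
        moreover have "integrable Y_measure (\<lambda>t. \<epsilon> / 4)"
          by (rule integrable_Y_measure[where B = "\<epsilon> / 4"]) (use \<epsilon> in auto)
        ultimately show "integrable Y_measure (\<lambda>t. \<epsilon> / 4 + C * (\<Sum>g\<in>G. \<bar>?n t g - ?m t g\<bar>))"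
          by (intro Bochner_Integration.integrable_add)
      qed (use G(3) top in auto)
      also have "\<dots> = \<epsilon> / 4 + C * (\<Sum>g\<in>G. (\<integral>t. \<bar>?n t g - ?m t g\<bar> \<partial>Y_measure))"
      proof -
        interpret prob_space Y_measure by (rule prob_space_Y_measure)
        have "integrable Y_measure (\<lambda>t. C * (\<Sum>g\<in>G. \<bar>?n t g - ?m t g\<bar>))"
          by (rule integrable_mult_right) (rule Bochner_Integration.integrable_sum, rule intd)
        then have "(\<integral>t. \<epsilon> / 4 + C * (\<Sum>g\<in>G. \<bar>?n t g - ?m t g\<bar>) \<partial>Y_measure)
           = (\<integral>t. \<epsilon> / 4 \<partial>Y_measure) + (\<integral>t. C * (\<Sum>g\<in>G. \<bar>?n t g - ?m t g\<bar>) \<partial>Y_measure)"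
          by (intro Bochner_Integration.integral_add) auto
        then show ?thesis using prob_space by (simp add: Bochner_Integration.integral_sum intd)
      qed
      also have "\<dots> \<le> \<epsilon> / 4 + C * (\<Sum>g\<in>G. \<delta> + ?W i g)"
        using G(2) step by (intro add_left_mono mult_left_mono sum_mono) auto
      also have "\<dots> = \<epsilon> / 4 + C * real (card G) * \<delta> + C * (\<Sum>g\<in>G. ?W i g)"
        by (simp add: sum.distrib algebra_simps)
      also have "\<dots> < \<epsilon>" using \<delta>(2) elim(3) \<epsilon> by linarith
      finally show ?case
        by (simp add: dist_real_def integral_coding[OF elim(1,2) fm] integral_coding[OF F(2) d fm])
    qed
  qed
qed

section \<open>Recovering the distribution function and the action\<close>

text \<open>Both functions are monotone, so between two grid points \<open>G\<close> is trapped by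
  its values there. The mesh has to be fine only for \<open>F\<close>; no modulus of continuity of
  \<open>G\<close> enters. One \<epsilon> accounts for the grid error and one for the oscillation of
  \<open>F\<close>.\<close>

lemma unit_cdf_grid:
  assumes F: "unit_cdf F" and \<epsilon>: "0 < \<epsilon>"
  shows "\<exists>N0>0. \<forall>N\<ge>N0. \<forall>G. unit_cdf G \<longrightarrow>
    (\<forall>k\<le>N. \<bar>G (real k / real N) - F (real k / real N)\<bar> \<le> \<epsilon>) \<longrightarrow> (\<forall>x. \<bar>G x - F x\<bar> \<le> 2 * \<epsilon>)"
proof -
  have "uniformly_continuous_on {0..1} F"
    using F by (intro compact_uniformly_continuous) (auto simp: unit_cdf_def intro: continuous_on_subset)
  then obtain \<delta> where \<delta>: "0 < \<delta>" "\<And>x y. x \<in> {0..1} \<Longrightarrow> y \<in> {0..1} \<Longrightarrow> \<bar>y - x\<bar> < \<delta> \<Longrightarrow> \<bar>F y - F x\<bar> < \<epsilon>"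
    using \<epsilon> unfolding uniformly_continuous_on_def dist_real_def by metis
  obtain N0 :: nat where N0: "0 < N0" "1 / real N0 < \<delta>"
    using nat_approx_posE[OF \<delta>(1)] by (metis zero_less_Suc)
  have "\<bar>G x - F x\<bar> \<le> 2 * \<epsilon>"
    if N: "N \<ge> N0" and G: "unit_cdf G"
      and grid: "\<And>k. k \<le> N \<Longrightarrow> \<bar>G (real k / real N) - F (real k / real N)\<bar> \<le> \<epsilon>" for N G x
  proof (cases "0 < x \<and> x < 1")
    case False
    then have "x \<le> 0 \<or> 1 \<le> x" by auto
    then have "G x = F x" using F G by (auto simp: unit_cdf_def)
    then show ?thesis using \<epsilon> by simp
  next
    case True
    have N1: "0 < real N" "1 / real N < \<delta>"
    proof -
      show "0 < real N" using N N0 by simp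
      have "1 / real N \<le> 1 / real N0" using N N0 by (simp add: frac_le)
      then show "1 / real N < \<delta>" using N0 by linarith
    qed
    define k where "k = nat \<lfloor>x * real N\<rfloor>"
    have "0 \<le> x * real N" "x * real N < real N" using True N1 by auto
    then have k: "real k \<le> x * real N" "x * real N < real k + 1" "real k < real N"
      unfolding k_def by linarith+
    let ?a = "real k / real N" and ?b = "real (Suc k) / real N"
    have ab: "?a \<le> x" "x \<le> ?b" "?b - ?a = 1 / real N" "0 \<le> ?a" "?b \<le> 1"
      using k N1 by (auto simp: field_simps)
    have "F ?b - F ?a \<le> \<epsilon>" using \<delta>(2)[of ?a ?b] ab N1 by force
    moreover have "F ?a \<le> F x" "F x \<le> F ?b" "G ?a \<le> G x" "G x \<le> G ?b"
      using F G ab(1,2) by (auto simp: unit_cdf_def mono_def)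
    moreover have "\<bar>G ?a - F ?a\<bar> \<le> \<epsilon>" "\<bar>G ?b - F ?b\<bar> \<le> \<epsilon>"
      using grid[of k] grid[of "Suc k"] k(3) by auto
    ultimately show ?thesis unfolding abs_le_iff by linarith
  qed
  then show ?thesis using N0(1) by (intro exI[of _ N0]) blast
qed

text \<open>This is Polya's theorem: for monotone functions with continuous limit, convergence on a
  finite grid controls the whole interval.\<close>

lemma unit_cdf_uniform_limit:
  assumes F: "eventually (\<lambda>i. unit_cdf (F i)) Fl" "unit_cdf F0"
    and lim: "\<And>x. ((\<lambda>i. F i x) \<longlongrightarrow> F0 x) Fl" and \<epsilon>: "0 < \<epsilon>"
  shows "eventually (\<lambda>i. \<forall>x. \<bar>F i x - F0 x\<bar> \<le> \<epsilon>) Fl"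
proof -
  obtain N where N: "\<And>G. unit_cdf G \<Longrightarrow>
    (\<forall>k\<le>N. \<bar>G (real k / real N) - F0 (real k / real N)\<bar> \<le> \<epsilon> / 2) \<Longrightarrow> (\<forall>x. \<bar>G x - F0 x\<bar> \<le> \<epsilon>)"
  proof -
    have e2: "0 < \<epsilon> / 2" using \<epsilon> by simp
    from unit_cdf_grid[OF F(2) e2] obtain N0 where N0: "\<forall>N\<ge>N0. \<forall>G. unit_cdf G \<longrightarrow>
      (\<forall>k\<le>N. \<bar>G (real k / real N) - F0 (real k / real N)\<bar> \<le> \<epsilon> / 2) \<longrightarrow> (\<forall>x. \<bar>G x - F0 x\<bar> \<le> 2 * (\<epsilon> / 2))"
      by (elim exE conjE)
    show thesis by (rule that[of N0]) (use N0[rule_format, OF order_refl] in auto)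
  qed
  have "eventually (\<lambda>i. \<forall>k\<in>{..N}. \<bar>F i (real k / real N) - F0 (real k / real N)\<bar> \<le> \<epsilon> / 2) Fl"
  proof (rule eventually_ball_finite)
    show "\<forall>k\<in>{..N}. eventually (\<lambda>i. \<bar>F i (real k / real N) - F0 (real k / real N)\<bar> \<le> \<epsilon> / 2) Fl"
    proof
      fix k
      from tendstoD[OF lim[of "real k / real N"], of "\<epsilon> / 2"] \<epsilon>
      show "eventually (\<lambda>i. \<bar>F i (real k / real N) - F0 (real k / real N)\<bar> \<le> \<epsilon> / 2) Fl"
        by (auto simp: dist_real_def elim: eventually_mono)
    qed
  qed simp
  with F(1) show ?thesis by eventually_elim (use N in auto)
qed

section \<open>Recovering the distribution function from the law\<close>

definition ramp :: "real \<Rightarrow> real \<Rightarrow> real \<Rightarrow> real" where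
  "ramp a b x = max 0 (min 1 ((x - a) / (b - a)))"

lemma continuous_on_ramp: "a < b \<Longrightarrow> continuous_on S (ramp a b)"
  unfolding ramp_def[abs_def] by (intro continuous_intros) auto

lemma ramp_bounds: "0 \<le> ramp a b x \<and> ramp a b x \<le> 1"
  by (auto simp: ramp_def)

text \<open>A ramp lies between the indicators of the half lines beyond \<open>b\<close> and beyond
  \<open>a\<close>, whose integrals are \<open>1 - F b\<close> and \<open>1 - F a\<close>.\<close>

lemma ramp_quantile_bounds:
  assumes F: "unit_cdf F" and ab: "a < b"
  shows "1 - F b \<le> (\<integral>t. ramp a b (quantile F t) \<partial>Y_measure)"
    and "(\<integral>t. ramp a b (quantile F t) \<partial>Y_measure) \<le> 1 - F a"
    and "integrable Y_measure (\<lambda>t. ramp a b (quantile F t))"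
proof -
  interpret prob_space Y_measure by (rule prob_space_Y_measure)
  have rm: "ramp a b \<in> borel_measurable borel"
    by (intro borel_measurable_continuous_onI continuous_on_ramp ab)
  have m: "(\<lambda>t. ramp a b (quantile F t)) \<in> borel_measurable Y_measure"
    by (rule measurable_compose[OF borel_measurable_quantile[OF F] rm])
  show int: "integrable Y_measure (\<lambda>t. ramp a b (quantile F t))"
    by (rule integrable_Y_measure[where B = 1, OF m]) (use ramp_bounds in \<open>auto simp: abs_le_iff\<close>)
  have S: "{t \<in> {0..<1}. quantile F t \<le> x} \<in> sets Y_measure" for x
  proof -
    have "{t \<in> space Y_measure. quantile F t \<le> x} \<in> sets Y_measure"
      using borel_measurable_quantile[OF F] by measurable
    then show ?thesis by simp
  qed
  let ?I = "\<lambda>x t. 1 - indicator {t \<in> {0..<1}. quantile F t \<le> x} t :: real"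
  have i: "integrable Y_measure (\<lambda>t. indicator {t \<in> {0..<1}. quantile F t \<le> x} t :: real)" for x
    using S by (intro integrable_real_indicator) (auto simp: emeasure_eq_measure)
  have I: "(\<integral>t. ?I x t \<partial>Y_measure) = 1 - F x" "integrable Y_measure (?I x)" for x
  proof -
    have "(\<integral>t. ?I x t \<partial>Y_measure) = (\<integral>t. 1 \<partial>Y_measure) - (\<integral>t. indicator {t \<in> {0..<1}. quantile F t \<le> x} t \<partial>Y_measure)"
      using i by (intro Bochner_Integration.integral_diff) auto
    also have "(\<integral>t. indicator {t \<in> {0..<1}. quantile F t \<le> x} t \<partial>Y_measure)
        = measure Y_measure ({t \<in> {0..<1}. quantile F t \<le> x} \<inter> space Y_measure)" by simp
    also have "{t \<in> {0..<1}. quantile F t \<le> x} \<inter> space Y_measure = {t \<in> {0..<1}. quantile F t \<le> x}" by auto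
    finally show "(\<integral>t. ?I x t \<partial>Y_measure) = 1 - F x"
      using measure_quantile_le[OF F, of x] prob_space by simp
    show "integrable Y_measure (?I x)" using i by auto
  qed
  have r1: "ramp a b x = 1" if "b < x" for x
    using that ab by (auto simp: ramp_def field_simps)
  have r0: "ramp a b x = 0" if "x \<le> a" for x
    using that ab by (auto simp: ramp_def field_simps max_def min_def)
  have "(\<integral>t. ?I b t \<partial>Y_measure) \<le> (\<integral>t. ramp a b (quantile F t) \<partial>Y_measure)"
    using r1 ramp_bounds by (intro integral_mono I int) (auto simp: indicator_def)
  then show "1 - F b \<le> (\<integral>t. ramp a b (quantile F t) \<partial>Y_measure)" by (simp only: I)
  have "(\<integral>t. ramp a b (quantile F t) \<partial>Y_measure) \<le> (\<integral>t. ?I a t \<partial>Y_measure)"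
    using r0 ramp_bounds by (intro integral_mono I int) (auto simp: indicator_def)
  then show "(\<integral>t. ramp a b (quantile F t) \<partial>Y_measure) \<le> 1 - F a" by (simp only: I)
qed

lemma continuous_map_Y_hat_coordinate:
  "continuous_map circle euclideanreal v \<Longrightarrow> continuous_map Y_hat euclideanreal (\<lambda>y. v (y g))"
  using continuous_map_compose[OF continuous_map_coordinate] by (simp add: comp_def)

lemma borel_measurable_circle:
  fixes v :: "real \<Rightarrow> real"
  assumes "continuous_map circle euclideanreal v"
  shows "v \<in> borel_measurable Y_measure"
  using borel_measurable_continuous_map[OF assms] by (simp add: measurable_cong_sets[OF sets_Y_measure refl])

lemma integral_coding_zero_coordinate:
  fixes c :: "('g::{group_add,countable} \<Rightarrow> real \<Rightarrow> real) set"
  assumes F: "unit_cdf F" and c: "c \<in> Y_actions" and v: "continuous_map circle euclideanreal v"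
  shows "(\<integral>y. v (y 0) \<partial>coding F c) = (\<integral>t. v (quantile F t) \<partial>Y_measure)"
proof -
  have vm: "v \<in> borel_measurable Y_measure" by (rule borel_measurable_circle[OF v])
  have "(\<integral>y. v (y 0) \<partial>coding F c) = (\<integral>t. v (name F (rep c) t 0) \<partial>Y_measure)"
    by (rule integral_coding[OF F c, where f = "\<lambda>y. v (y 0)"])
       (rule measurable_compose[OF measurable_coordinate vm])
  also have "\<dots> = (\<integral>t. v (quantile F t) \<partial>Y_measure)"
  proof (rule integral_cong_AE)
    show "(\<lambda>t. v (name F (rep c) t 0)) \<in> borel_measurable Y_measure"
      by (rule measurable_compose[OF measurable_name_coordinate[OF F c] vm])
    show "(\<lambda>t. v (quantile F t)) \<in> borel_measurable Y_measure"
      by (rule measurable_compose[OF measurable_quantile[OF F] vm])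
    show "AE t in Y_measure. v (name F (rep c) t 0) = v (quantile F t)"
      using gaction_zero[OF gaction_rep[OF c]] by eventually_elim (simp add: name_def)
  qed
  finally show ?thesis .
qed

text \<open>A ramp inside \<open>{0..1}\<close> jumps from 1 to 0 where the circle closes, so it is
  not a test function, but the difference of two ramps is. The second ramp is placed where
  \<open>F0\<close> has little mass, near 1 for the upper estimate and near 0 for the lower one, so
  that it contributes almost 0 or almost 1.\<close>

lemma coding_limit_cdf:
  fixes c :: "'i \<Rightarrow> ('g::{group_add,countable} \<Rightarrow> real \<Rightarrow> real) set"
  assumes F: "eventually (\<lambda>i. unit_cdf (F i)) Fl" "unit_cdf F0"
    and c: "eventually (\<lambda>i. c i \<in> Y_actions) Fl" "d \<in> Y_actions"
    and lim: "limitin weak_star_topology (\<lambda>i. coding (F i) (c i)) (coding F0 d) Fl"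
    and \<epsilon>: "0 < \<epsilon>"
  shows "eventually (\<lambda>i. \<forall>x. \<bar>F i x - F0 x\<bar> \<le> \<epsilon>) Fl"
proof (rule unit_cdf_uniform_limit[OF F _ \<epsilon>])
  let ?J = "\<lambda>F a b. \<integral>t. ramp a b (quantile F t) \<partial>Y_measure"
  have J: "((\<lambda>i. ?J (F i) a b - ?J (F i) a' b') \<longlongrightarrow> ?J F0 a b - ?J F0 a' b') Fl"
    if ab: "a < b" "0 \<le> a" "b \<le> 1" "a' < b'" "0 \<le> a'" "b' \<le> 1" for a b a' b'
  proof -
    define v where "v x = ramp a b x - ramp a' b' x" for x
    have v: "continuous_map circle euclideanreal v"
    proof (rule continuous_map_circle)
      show "continuous_on {0..1} v" unfolding v_def[abs_def]
        using ab by (intro continuous_intros continuous_on_ramp)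
      show "v 0 = v 1" using ab
        by (auto simp: v_def ramp_def max_def min_def divide_le_0_iff field_simps)
    qed
    have e: "(\<integral>y. v (y 0) \<partial>coding G k) = ?J G a b - ?J G a' b'"
      if "unit_cdf G" "k \<in> Y_actions" for G and k :: "('g \<Rightarrow> real \<Rightarrow> real) set"
      unfolding integral_coding_zero_coordinate[OF that v] unfolding v_def
      by (intro Bochner_Integration.integral_diff ramp_quantile_bounds that ab)
    have "((\<lambda>i. \<integral>y. v (y 0) \<partial>coding (F i) (c i)) \<longlongrightarrow> (\<integral>y. v (y 0) \<partial>coding F0 d)) Fl"
      using lim continuous_map_Y_hat_coordinate[OF v, of 0] unfolding limitin_weak_star_topology by blast
    moreover have "eventually (\<lambda>i. (\<integral>y. v (y 0) \<partial>coding (F i) (c i)) = ?J (F i) a b - ?J (F i) a' b') Fl"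
      using F(1) c(1) by eventually_elim (rule e)
    ultimately show ?thesis unfolding e[OF F(2) c(2)] by (rule Lim_transform_eventually)
  qed
  have near: "\<exists>z. a < z \<and> z < b \<and> \<bar>F0 z - F0 a\<bar> < e" if ab: "a < b" and e: "0 < e" for a b e
  proof -
    have "isCont F0 a" using F(2) by (simp add: unit_cdf_def continuous_on_eq_continuous_at)
    then obtain s where s: "0 < s" "\<And>z. \<bar>z - a\<bar> < s \<Longrightarrow> \<bar>F0 z - F0 a\<bar> < e"
      using e unfolding continuous_at_eps_delta dist_real_def by metis
    show ?thesis
      by (rule exI[of _ "a + min (s / 2) ((b - a) / 2)"]) (use s ab e in \<open>auto simp: min_def field_simps\<close>)
  qed
  have near': "\<exists>z. b < z \<and> z < a \<and> \<bar>F0 z - F0 a\<bar> < e" if ab: "b < a" and e: "0 < e" for a b e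
  proof -
    have "isCont F0 a" using F(2) by (simp add: unit_cdf_def continuous_on_eq_continuous_at)
    then obtain s where s: "0 < s" "\<And>z. \<bar>z - a\<bar> < s \<Longrightarrow> \<bar>F0 z - F0 a\<bar> < e"
      using e unfolding continuous_at_eps_delta dist_real_def by metis
    show ?thesis
      by (rule exI[of _ "a - min (s / 2) ((a - b) / 2)"]) (use s ab e in \<open>auto simp: min_def field_simps\<close>)
  qed
  fix x
  show "((\<lambda>i. F i x) \<longlongrightarrow> F0 x) Fl"
  proof (cases "0 < x \<and> x < 1")
    case False
    have "eventually (\<lambda>i. F0 x = F i x) Fl"
      using F(1) by eventually_elim (use F(2) False in \<open>auto simp: unit_cdf_def not_less\<close>)
    then show ?thesis by (rule Lim_transform_eventually[OF tendsto_const])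
  next
    case True
    show ?thesis
    proof (rule tendstoI)
      fix e :: real assume e: "0 < e"
      \<comment> \<open>The points \<open>a\<close> and \<open>b\<close> enclose \<open>x\<close>;
        \<open>p\<close> and \<open>q\<close> delimit short end intervals of small mass under
        \<open>F0\<close>. All four come from continuity of \<open>F0\<close>, and each estimate
        below spends at most three quarters of \<open>e\<close>.\<close>
      obtain b where b: "x < b" "b < 1" "\<bar>F0 b - F0 x\<bar> < e / 4" using near[of x 1 "e / 4"] True e by auto
      obtain a where a: "0 < a" "a < x" "\<bar>F0 a - F0 x\<bar> < e / 4" using near'[of 0 x "e / 4"] True e by auto
      obtain p where p: "0 < p" "p < 1" "\<bar>F0 p - F0 0\<bar> < e / 4" using near[of 0 1 "e / 4"] e by auto
      obtain q where q: "0 < q" "q < 1" "\<bar>F0 q - F0 1\<bar> < e / 4" using near'[of 0 1 "e / 4"] e by auto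
      have F01: "F0 0 = 0" "F0 1 = 1" using F(2) by (auto simp: unit_cdf_def)
      have "eventually (\<lambda>i. dist (?J (F i) x b - ?J (F i) q 1) (?J F0 x b - ?J F0 q 1) < e / 4) Fl"
        using b q True e by (intro tendstoD[OF J]) auto
      moreover have "eventually (\<lambda>i. dist (?J (F i) a x - ?J (F i) 0 p) (?J F0 a x - ?J F0 0 p) < e / 4) Fl"
        using a p True e by (intro tendstoD[OF J]) auto
      ultimately show "eventually (\<lambda>i. dist (F i x) (F0 x) < e) Fl" using F(1)
      proof eventually_elim
        case (elim i)
        note R = ramp_quantile_bounds(1,2)[OF elim(3)] and R0 = ramp_quantile_bounds(1,2)[OF F(2)]
        have Fi: "F i 0 = 0" "F i 1 = 1" using elim(3) by (auto simp: unit_cdf_def)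
        have "F i x \<le> 1 - ?J (F i) x b" using R(2)[OF b(1)] by linarith
        also have "\<dots> \<le> 1 - (?J (F i) x b - ?J (F i) q 1)"
          using R(1)[OF q(2)] Fi by simp
        also have "\<dots> \<le> 1 - (?J F0 x b - ?J F0 q 1) + e / 4"
          using elim(1) unfolding dist_real_def abs_less_iff by linarith
        also have "\<dots> \<le> F0 b + (1 - F0 q) + e / 4"
          using R0(1)[OF b(1)] R0(2)[OF q(2)] by linarith
        also have "\<dots> < F0 x + e" using b(3) q(3) F01 unfolding abs_less_iff by linarith
        finally have 1: "F i x < F0 x + e" .
        have "F i x \<ge> 1 - ?J (F i) a x" using R(1)[OF a(2)] by linarith
        moreover have "?J (F i) 0 p \<le> 1" using R(2)[OF p(1)] Fi by simp
        moreover have "?J F0 a x \<le> 1 - F0 a" using R0(2)[OF a(2)] .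
        moreover have "1 - F0 p \<le> ?J F0 0 p" using R0(1)[OF p(1)] .
        ultimately have "F i x > F0 x - e" using elim(2) a(3) p(3) F01
          unfolding dist_real_def abs_less_iff by linarith
        with 1 show ?case by (simp add: dist_real_def abs_less_iff)
      qed
    qed
  qed
qed

section \<open>Recovering the action from the law\<close>

lemma borel_measurable_of_bool_mem:
  assumes "E \<in> sets M"
  shows "(\<lambda>t. of_bool (t \<in> E) :: real) \<in> borel_measurable M"
proof -
  have "(\<lambda>t. of_bool (t \<in> E) :: real) = indicator E" by (auto simp: indicator_def)
  then show ?thesis using assms by simp
qed

text \<open>Almost everywhere \<open>t\<close> lies in \<open>E\<close> exactly if its quantile lies
  in \<open>E'\<close>. Inner regularity of the law of the quantile replaces \<open>E'\<close> by a
  compact \<open>K\<close>, and truncated multiples of the distance to \<open>K\<close> are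
  Lipschitz and converge to its indicator. The Lipschitz bound later absorbs a change of the
  distribution function.\<close>

lemma approximate_indicator:
  assumes F: "unit_cdf F" and E: "E \<in> sets Y_measure" and \<epsilon>: "0 < \<epsilon>"
  shows "\<exists>g L. 0 \<le> L \<and> (\<forall>x y. \<bar>g x - g y\<bar> \<le> L * \<bar>x - y\<bar>) \<and> (\<forall>x. 0 \<le> g x \<and> g x \<le> 1) \<and>
    g 0 = g 1 \<and> (\<integral>t. \<bar>g (quantile F t) - of_bool (t \<in> E)\<bar> \<partial>Y_measure) \<le> (\<epsilon>::real)"
proof -
  interpret prob_space Y_measure by (rule prob_space_Y_measure)
  define \<nu> where "\<nu> = distr Y_measure borel (quantile F)"
  have qm: "quantile F \<in> Y_measure \<rightarrow>\<^sub>M borel" by (rule borel_measurable_quantile[OF F])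
  interpret \<nu>: prob_space \<nu> unfolding \<nu>_def by (rule prob_space_distr[OF qm])
  have s\<nu>: "sets \<nu> = sets borel" by (simp add: \<nu>_def)
  \<comment> \<open>The open interval keeps \<open>K\<close> away from 0 and 1, so the approximants
    eventually vanish at both ends and agree there. The omitted value 0 has probability zero because
    \<open>F 0 = 0\<close>.\<close>
  define E' where "E' = {x \<in> {0<..<1}. clip (F x) \<in> E}"
  have Eb: "E \<in> sets borel" "E \<subseteq> {0..<1}"
    using E unfolding sets_Y_measure_restrict sets_restrict_space by auto
  have E'b: "E' \<in> sets borel"
  proof -
    have "(\<lambda>x. clip (F x)) \<in> borel_measurable borel"
      by (rule measurable_compose[OF borel_measurable_unit_cdf[OF F] measurable_clip])
    then have "(\<lambda>x. clip (F x)) -` E \<inter> space borel \<in> sets borel" using Eb(1) by (rule measurable_sets)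
    moreover have "E' = ((\<lambda>x. clip (F x)) -` E \<inter> space borel) \<inter> {0<..<1}" by (auto simp: E'_def)
    ultimately show ?thesis by auto
  qed
  have pos: "AE t in Y_measure. 0 < quantile F t"
  proof -
    have "measure Y_measure {t \<in> {0..<1}. quantile F t \<le> 0} = 0"
      using measure_quantile_le[OF F, of 0] F by (simp add: unit_cdf_def)
    moreover have "{t \<in> space Y_measure. quantile F t \<le> 0} \<in> sets Y_measure" using qm by measurable
    ultimately show ?thesis
      by (intro AE_I[of _ _ "{t \<in> {0..<1}. quantile F t \<le> 0}"]) (auto simp: emeasure_eq_measure)
  qed
  have mem: "AE t in Y_measure. (quantile F t \<in> E') = (t \<in> E)"
    using pos AE_space
  proof eventually_elim
    case (elim t)
    then show ?case
      using quantile_bounds[OF F, of t] quantile_right_inverse[OF F, of t] by (simp add: E'_def)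
  qed
  obtain K where K: "compact K" "K \<subseteq> E'" "measure \<nu> E' - \<epsilon> / 2 < measure \<nu> K"
  proof (cases "measure \<nu> E' = 0")
    case True
    then show ?thesis using \<epsilon> by (intro that[of "{}"]) auto
  next
    case False
    have "ennreal (measure \<nu> E' - \<epsilon> / 2) < emeasure \<nu> E'"
    proof -
      have "0 < measure \<nu> E'" using False by (simp add: less_le)
      then show ?thesis unfolding \<nu>.emeasure_eq_measure using \<epsilon> by (intro ennreal_lessI) auto
    qed
    also have "emeasure \<nu> E' = (SUP K \<in> {K. K \<subseteq> E' \<and> compact K}. emeasure \<nu> K)"
      by (rule inner_regular[OF s\<nu> _ E'b]) (simp add: \<nu>.emeasure_space_1)
    finally obtain K where K: "K \<subseteq> E'" "compact K" "ennreal (measure \<nu> E' - \<epsilon> / 2) < emeasure \<nu> K"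
      unfolding less_SUP_iff by auto
    have "\<not> measure \<nu> K \<le> measure \<nu> E' - \<epsilon> / 2"
    proof
      assume "measure \<nu> K \<le> measure \<nu> E' - \<epsilon> / 2"
      from ennreal_leI[OF this] K(3) show False
        unfolding \<nu>.emeasure_eq_measure by (metis leD)
    qed
    then show ?thesis using K by (intro that[of K]) auto
  qed
  have Kb: "K \<in> sets borel" using K(1) by (simp add: compact_imp_closed borel_closed)
  have dK: "(\<integral>t. \<bar>of_bool (quantile F t \<in> K) - of_bool (t \<in> E)\<bar> \<partial>Y_measure) \<le> \<epsilon> / 2"
  proof -
    have "(\<integral>t. \<bar>of_bool (quantile F t \<in> K) - of_bool (t \<in> E) :: real\<bar> \<partial>Y_measure)
        = (\<integral>t. indicator (E' - K) (quantile F t) \<partial>Y_measure)"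
    proof (rule integral_cong_AE)
      show "AE t in Y_measure. \<bar>of_bool (quantile F t \<in> K) - of_bool (t \<in> E)\<bar> = (indicator (E' - K) (quantile F t) :: real)"
        using mem by eventually_elim (use K(2) in \<open>auto simp: indicator_def\<close>)
      show "(\<lambda>t. indicator (E' - K) (quantile F t) :: real) \<in> borel_measurable Y_measure"
        by (rule measurable_compose[OF qm]) (use E'b Kb in auto)
      have "(\<lambda>t. indicator K (quantile F t) :: real) \<in> borel_measurable Y_measure"
        by (rule measurable_compose[OF qm]) (use Kb in auto)
      moreover have "(\<lambda>t. indicator E t :: real) \<in> borel_measurable Y_measure" using E by simp
      ultimately have "(\<lambda>t. \<bar>indicator K (quantile F t) - indicator E t\<bar> :: real) \<in> borel_measurable Y_measure"
        by measurable
      then show "(\<lambda>t. \<bar>of_bool (quantile F t \<in> K) - of_bool (t \<in> E)\<bar> :: real) \<in> borel_measurable Y_measure"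
        by (simp add: indicator_def)
    qed
    also have "\<dots> = (\<integral>x. indicator (E' - K) x \<partial>\<nu>)"
      unfolding \<nu>_def by (rule integral_distr[symmetric, OF qm]) (use E'b Kb in auto)
    also have "\<dots> = measure \<nu> (E' - K)"
      using E'b Kb s\<nu> by (simp add: sets_eq_imp_space_eq[OF s\<nu>])
    also have "\<dots> = measure \<nu> E' - measure \<nu> K"
      by (rule \<nu>.finite_measure_Diff) (use E'b Kb s\<nu> K(2) in auto)
    finally show ?thesis using K(3) by linarith
  qed
  show ?thesis
  proof (cases "K = {}")
    \<comment> \<open>The distance to the empty set is 0 by convention, so the construction of the
      other case would give the constant 1 instead of 0.\<close>
    case True
    then show ?thesis using dK \<epsilon> by (intro exI[of _ "\<lambda>_. 0"] exI[of _ 0]) auto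
  next
    case False
    define g where "g n x = max 0 (1 - real n * infdist x K)" for n :: nat and x
    have gb: "0 \<le> g n x \<and> g n x \<le> 1" for n x by (auto simp: g_def infdist_nonneg)
    have gL: "\<bar>g n x - g n y\<bar> \<le> real n * \<bar>x - y\<bar>" for n x y
    proof -
      have "\<bar>infdist x K - infdist y K\<bar> \<le> \<bar>x - y\<bar>"
        using infdist_triangle_abs[of x K y] by (simp add: dist_real_def)
      then have "real n * \<bar>infdist x K - infdist y K\<bar> \<le> real n * \<bar>x - y\<bar>" by (rule mult_left_mono) simp
      moreover have "\<bar>g n x - g n y\<bar> \<le> \<bar>real n * infdist x K - real n * infdist y K\<bar>"
        by (auto simp: g_def)
      moreover have "\<bar>real n * infdist x K - real n * infdist y K\<bar> = real n * \<bar>infdist x K - infdist y K\<bar>"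
        by (simp add: abs_mult flip: right_diff_distrib)
      ultimately show ?thesis by linarith
    qed
    have gm: "g n \<in> borel_measurable borel" for n
      unfolding g_def[abs_def] by (intro borel_measurable_continuous_onI continuous_intros)
    have off: "\<exists>N. \<forall>n\<ge>N. g n x = 0" if "x \<notin> K" for x
    proof -
      have "infdist x K > 0"
        using that K(1) False by (simp add: compact_imp_closed infdist_pos_not_in_closed)
      then obtain N where "1 < real N * infdist x K" using ex_less_of_nat_mult by blast
      then have "1 < real n * infdist x K" if "n \<ge> N" for n
        using that by (meson infdist_nonneg less_le_trans mult_right_mono of_nat_le_iff)
      then show ?thesis by (intro exI[of _ N]) (force simp: g_def)
    qed
    have on: "g n x = 1" if "x \<in> K" for n x using that by (simp add: g_def)
    have "(\<lambda>n. g n x) \<longlonglongrightarrow> of_bool (x \<in> K)" for x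
    proof (cases "x \<in> K")
      case False
      then obtain N where "\<forall>n\<ge>N. g n x = 0" using off by auto
      then have "eventually (\<lambda>n. g n x = 0) sequentially" unfolding eventually_sequentially by blast
      then show ?thesis using False by (simp add: tendsto_eventually)
    qed (simp add: on)
    note lim = this
    have "(\<lambda>n. \<integral>t. \<bar>g n (quantile F t) - of_bool (t \<in> E)\<bar> \<partial>Y_measure) \<longlonglongrightarrow>
        (\<integral>t. \<bar>of_bool (quantile F t \<in> K) - of_bool (t \<in> E)\<bar> \<partial>Y_measure)"
    proof (intro integral_dominated_convergence[where w = "\<lambda>_. 1"])
      have iE: "(\<lambda>t. of_bool (t \<in> E) :: real) \<in> borel_measurable Y_measure"
        by (rule borel_measurable_of_bool_mem[OF E])
      have "(\<lambda>t. of_bool (quantile F t \<in> K) :: real) \<in> borel_measurable Y_measure"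
        by (rule measurable_compose[OF qm borel_measurable_of_bool_mem[OF Kb]])
      then show "(\<lambda>t. \<bar>of_bool (quantile F t \<in> K) - of_bool (t \<in> E)\<bar> :: real) \<in> borel_measurable Y_measure"
        using iE by measurable
      show "(\<lambda>t. \<bar>g n (quantile F t) - of_bool (t \<in> E)\<bar>) \<in> borel_measurable Y_measure" for n
        using measurable_compose[OF qm gm[of n]] iE by measurable
      show "AE t in Y_measure. norm \<bar>g n (quantile F t) - of_bool (t \<in> E)\<bar> \<le> 1" for n
      proof (rule AE_I2)
        fix t show "norm \<bar>g n (quantile F t) - of_bool (t \<in> E)\<bar> \<le> 1"
          using gb[of n "quantile F t"] by (cases "t \<in> E") auto
      qed
      show "AE t in Y_measure. (\<lambda>n. \<bar>g n (quantile F t) - of_bool (t \<in> E)\<bar>)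
          \<longlonglongrightarrow> \<bar>of_bool (quantile F t \<in> K) - of_bool (t \<in> E)\<bar>"
        by (intro AE_I2 tendsto_intros lim)
    qed simp
    then have "eventually (\<lambda>n. (\<integral>t. \<bar>g n (quantile F t) - of_bool (t \<in> E)\<bar> \<partial>Y_measure) < \<epsilon>) sequentially"
      by (rule order_tendstoD(2)) (use dK \<epsilon> in linarith)
    then obtain N1 where N1: "\<And>n. n \<ge> N1 \<Longrightarrow> (\<integral>t. \<bar>g n (quantile F t) - of_bool (t \<in> E)\<bar> \<partial>Y_measure) < \<epsilon>"
      by (auto simp: eventually_sequentially)
    have "0 \<notin> K" "1 \<notin> K" using K(2) by (auto simp: E'_def)
    then obtain N2 N3 where N23: "\<And>n. n \<ge> N2 \<Longrightarrow> g n 0 = 0" "\<And>n. n \<ge> N3 \<Longrightarrow> g n 1 = 0"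
      using off[of 0] off[of 1] by auto
    let ?n = "max N1 (max N2 N3)"
    show ?thesis
      using gL[of ?n] gb[of ?n] N1[of ?n] N23[of ?n]
      by (intro exI[of _ "g ?n"] exI[of _ "real ?n"]) auto
  qed
qed

lemma integral_Lipschitz_quantile_le:
  assumes F: "unit_cdf F" and G: "unit_cdf G" and \<delta>: "\<And>x. \<bar>F x - G x\<bar> \<le> \<delta>"
    and g: "\<And>x y. \<bar>g x - g y\<bar> \<le> L * \<bar>x - y\<bar>" and L: "0 \<le> L"
    and gm: "g \<in> borel_measurable borel"
  shows "(\<integral>t. \<bar>g (quantile F t) - g (quantile G t)\<bar> \<partial>Y_measure) \<le> L * \<delta>"
proof -
  note qm = borel_measurable_quantile[OF F] borel_measurable_quantile[OF G]
  have i: "integrable Y_measure (\<lambda>t. \<bar>quantile F t - quantile G t\<bar>)"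
  proof (rule integrable_Y_measure[where B = 1])
    fix t :: real assume "t \<in> {0..<1}"
    then show "\<bar>\<bar>quantile F t - quantile G t\<bar>\<bar> \<le> 1"
      using quantile_bounds[OF F, of t] quantile_bounds[OF G, of t] by auto
  qed (use qm in measurable)
  have "(\<integral>t. \<bar>g (quantile F t) - g (quantile G t)\<bar> \<partial>Y_measure)
      \<le> (\<integral>t. L * \<bar>quantile F t - quantile G t\<bar> \<partial>Y_measure)"
  proof (rule integral_mono)
    show i': "integrable Y_measure (\<lambda>t. L * \<bar>quantile F t - quantile G t\<bar>)" using i by simp
    show "integrable Y_measure (\<lambda>t. \<bar>g (quantile F t) - g (quantile G t)\<bar>)"
      by (rule Bochner_Integration.integrable_bound[OF i'])
         (use g L measurable_compose[OF qm(1) gm] measurable_compose[OF qm(2) gm] in \<open>auto simp: abs_mult\<close>)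
  qed (rule g)
  also have "\<dots> = L * (\<integral>t. \<bar>quantile F t - quantile G t\<bar> \<partial>Y_measure)" by simp
  also have "\<dots> \<le> L * \<delta>" by (intro mult_left_mono quantile_L1_le F G \<delta> L)
  finally show ?thesis .
qed

lemma Lipschitz_imp_continuous_on:
  fixes g :: "real \<Rightarrow> real"
  assumes g: "\<And>x y. \<bar>g x - g y\<bar> \<le> L * \<bar>x - y\<bar>" and L: "0 \<le> L"
  shows "continuous_on S g"
proof (rule lipschitz_on_continuous_on)
  show "L-lipschitz_on S g" using g L by (intro lipschitz_onI) (auto simp: dist_real_def)
qed

lemma integral_coding_pair:
  fixes c :: "('g::{group_add,countable} \<Rightarrow> real \<Rightarrow> real) set"
  assumes F: "unit_cdf F" and c: "c \<in> Y_actions"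
    and g: "continuous_map circle euclideanreal g" and h: "continuous_map circle euclideanreal h"
  shows "(\<integral>y. \<bar>g (y \<gamma>) - h (y 0)\<bar> \<partial>coding F c)
    = (\<integral>t. \<bar>g (quantile F (rep c \<gamma> t)) - h (quantile F t)\<bar> \<partial>Y_measure)"
proof -
  have f: "continuous_map Y_hat euclideanreal (\<lambda>y. \<bar>g (y \<gamma>) - h (y 0)\<bar>)"
    by (intro continuous_map_real_abs continuous_map_diff continuous_map_Y_hat_coordinate g h)
  note gY = borel_measurable_circle[OF g] and hY = borel_measurable_circle[OF h]
  show ?thesis
    unfolding integral_coding[OF F c borel_measurable_continuous_map[OF f]]
  proof (rule integral_cong_AE)
    have 1: "(\<lambda>t. g (name F (rep c) t \<gamma>)) \<in> borel_measurable Y_measure"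
      "(\<lambda>t. h (name F (rep c) t 0)) \<in> borel_measurable Y_measure"
      by (rule measurable_compose[OF measurable_name_coordinate[OF F c] gY],
          rule measurable_compose[OF measurable_name_coordinate[OF F c] hY])
    then show "(\<lambda>t. \<bar>g (name F (rep c) t \<gamma>) - h (name F (rep c) t 0)\<bar>) \<in> borel_measurable Y_measure"
      by measurable
    have "(\<lambda>t. h (quantile F t)) \<in> borel_measurable Y_measure"
      by (rule measurable_compose[OF measurable_quantile[OF F] hY])
    then show "(\<lambda>t. \<bar>g (quantile F (rep c \<gamma> t)) - h (quantile F t)\<bar>) \<in> borel_measurable Y_measure"
      using 1(1) unfolding name_def by measurable
    show "AE t in Y_measure. \<bar>g (name F (rep c) t \<gamma>) - h (name F (rep c) t 0)\<bar>
        = \<bar>g (quantile F (rep c \<gamma> t)) - h (quantile F t)\<bar>"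
      using gaction_zero[OF gaction_rep[OF c]] by eventually_elim (simp add: name_def)
  qed
qed

text \<open>Let \<open>g\<close> approximate \<open>E\<close> and \<open>h\<close> its preimage
  under the limiting action. The function \<open>\<bar>g (y \<gamma>) - h (y 0)\<bar>\<close> has
  small integral at the limit measure, hence also nearby; a small value says that the preimages of
  \<open>E\<close> under \<open>c i\<close> and under \<open>d\<close> nearly agree. The preceding
  lemma supplies uniform closeness of \<open>F i\<close> to \<open>F0\<close>, which lets both
  functions be read through \<open>quantile F0\<close>.\<close>

lemma coding_limit_coarse:
  fixes c :: "'i \<Rightarrow> ('g::{group_add,countable} \<Rightarrow> real \<Rightarrow> real) set"
  assumes F: "eventually (\<lambda>i. unit_cdf (F i)) Fl" "unit_cdf F0"
    and c: "eventually (\<lambda>i. c i \<in> Y_actions) Fl" "d \<in> Y_actions"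
    and lim: "limitin weak_star_topology (\<lambda>i. coding (F i) (c i)) (coding F0 d) Fl"
  shows "limitin coarse_topology c d Fl"
  unfolding limitin_coarse_topology
proof (intro conjI c allI ballI)
  fix \<gamma> :: 'g and E assume E: "E \<in> sets Y_measure"
  let ?B = "rep d \<gamma> -` E \<inter> space Y_measure"
  note R = gaction_Y_measureD[OF gaction_rep[OF c(2)]]
  have B: "?B \<in> sets Y_measure" by (rule measurable_sets[OF R(3) E])
  show "((\<lambda>i. coarse_dist \<gamma> E (c i) d) \<longlongrightarrow> 0) Fl"
  proof (rule tendstoI)
    fix \<epsilon> :: real assume \<epsilon>: "0 < \<epsilon>"
    then have \<epsilon>8: "0 < \<epsilon> / 8" by simp
    obtain g L where g: "0 \<le> L" "\<And>x y. \<bar>g x - g y\<bar> \<le> L * \<bar>x - y\<bar>" "\<And>x. 0 \<le> g x \<and> g x \<le> 1" "g 0 = g 1"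
      "(\<integral>t. \<bar>g (quantile F0 t) - of_bool (t \<in> E)\<bar> \<partial>Y_measure) \<le> \<epsilon> / 8"
      using approximate_indicator[OF F(2) E \<epsilon>8] by blast
    obtain h L' where h: "0 \<le> L'" "\<And>x y. \<bar>h x - h y\<bar> \<le> L' * \<bar>x - y\<bar>" "\<And>x. 0 \<le> h x \<and> h x \<le> 1" "h 0 = h 1"
      "(\<integral>t. \<bar>h (quantile F0 t) - of_bool (t \<in> ?B)\<bar> \<partial>Y_measure) \<le> \<epsilon> / 8"
      using approximate_indicator[OF F(2) B \<epsilon>8] by blast
    have gc: "continuous_on S g" and hc: "continuous_on S h" for S
      using Lipschitz_imp_continuous_on[OF g(2,1)] Lipschitz_imp_continuous_on[OF h(2,1)] by auto
    have gcirc: "continuous_map circle euclideanreal g" and hcirc: "continuous_map circle euclideanreal h"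
      by (intro continuous_map_circle gc hc g h)+
    have gb: "g \<in> borel_measurable borel" and hb: "h \<in> borel_measurable borel"
      by (intro borel_measurable_continuous_onI gc hc)+
    have gY: "g \<in> borel_measurable Y_measure" and hY: "h \<in> borel_measurable Y_measure"
      by (intro borel_measurable_Y_measure gb hb)+
    have Em: "(\<lambda>t. of_bool (t \<in> E) :: real) \<in> borel_measurable Y_measure"
      "(\<lambda>t. of_bool (t \<in> ?B) :: real) \<in> borel_measurable Y_measure"
      by (rule borel_measurable_of_bool_mem, fact)+
    let ?f = "\<lambda>y :: 'g \<Rightarrow> real. \<bar>g (y \<gamma>) - h (y 0)\<bar>"
    have f: "continuous_map Y_hat euclideanreal ?f"
      by (intro continuous_map_real_abs continuous_map_diff continuous_map_Y_hat_coordinate gcirc hcirc)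
    note int_f = integral_coding_pair[OF _ _ gcirc hcirc, where \<gamma> = \<gamma>]
    have gh1: "\<bar>g x - h y\<bar> \<le> 1" for x y using g(3)[of x] h(3)[of y] by linarith
    have ofb: "\<bar>g x - of_bool P\<bar> \<le> 1" "\<bar>h x - of_bool P\<bar> \<le> 1" for x P
      using g(3)[of x] h(3)[of x] by (cases P; auto)+
    have iE: "integrable Y_measure (\<lambda>t. \<bar>g (quantile F0 t) - of_bool (t \<in> E)\<bar>)"
      using measurable_compose[OF measurable_quantile[OF F(2)] gY] Em(1) ofb
      by (intro integrable_Y_measure[where B = 1]) auto
    have iB: "integrable Y_measure (\<lambda>t. \<bar>h (quantile F0 t) - of_bool (t \<in> ?B)\<bar>)"
      using measurable_compose[OF measurable_quantile[OF F(2)] hY] Em(2) ofb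
      by (intro integrable_Y_measure[where B = 1]) auto
    have gE: "(\<lambda>t. \<bar>g (quantile F0 t) - of_bool (t \<in> E)\<bar>) \<in> borel_measurable Y_measure"
      using iE by auto
    have shift_gE: "(\<integral>t. \<bar>g (quantile F0 (rep k \<gamma> t)) - of_bool (rep k \<gamma> t \<in> E)\<bar> \<partial>Y_measure) \<le> \<epsilon> / 8"
      "integrable Y_measure (\<lambda>t. \<bar>g (quantile F0 (rep k \<gamma> t)) - of_bool (rep k \<gamma> t \<in> E)\<bar>)"
      if k: "k \<in> Y_actions" for k :: "('g \<Rightarrow> real \<Rightarrow> real) set"
    proof -
      note T = gaction_Y_measureD[OF gaction_rep[OF k]]
      show "(\<integral>t. \<bar>g (quantile F0 (rep k \<gamma> t)) - of_bool (rep k \<gamma> t \<in> E)\<bar> \<partial>Y_measure) \<le> \<epsilon> / 8"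
        using integral_measure_preserving[OF T(1) gE, of \<gamma>] g(5) by simp
      show "integrable Y_measure (\<lambda>t. \<bar>g (quantile F0 (rep k \<gamma> t)) - of_bool (rep k \<gamma> t \<in> E)\<bar>)"
        using measurable_compose[OF T(3) gE, of \<gamma>] ofb
        by (intro integrable_Y_measure[where B = 1]) auto
    qed
    have X0: "(\<integral>y. ?f y \<partial>coding F0 d) \<le> \<epsilon> / 4"
    proof -
      have "(\<integral>y. ?f y \<partial>coding F0 d) \<le> (\<integral>t. \<bar>g (quantile F0 (rep d \<gamma> t)) - of_bool (rep d \<gamma> t \<in> E)\<bar>
          + \<bar>h (quantile F0 t) - of_bool (t \<in> ?B)\<bar> \<partial>Y_measure)"
        unfolding int_f[OF F(2) c(2)]
      proof (rule integral_mono)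
        show "integrable Y_measure (\<lambda>t. \<bar>g (quantile F0 (rep d \<gamma> t)) - h (quantile F0 t)\<bar>)"
          using measurable_compose[OF R(3) measurable_compose[OF measurable_quantile[OF F(2)] gY]]
            measurable_compose[OF measurable_quantile[OF F(2)] hY] gh1
          by (intro integrable_Y_measure[where B = 1]) auto
        show "integrable Y_measure (\<lambda>t. \<bar>g (quantile F0 (rep d \<gamma> t)) - of_bool (rep d \<gamma> t \<in> E)\<bar>
            + \<bar>h (quantile F0 t) - of_bool (t \<in> ?B)\<bar>)"
          by (intro Bochner_Integration.integrable_add shift_gE c iB)
        fix t assume "t \<in> space Y_measure"
        then have "of_bool (t \<in> ?B) = (of_bool (rep d \<gamma> t \<in> E) :: real)" by simp
        then show "\<bar>g (quantile F0 (rep d \<gamma> t)) - h (quantile F0 t)\<bar>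
          \<le> \<bar>g (quantile F0 (rep d \<gamma> t)) - of_bool (rep d \<gamma> t \<in> E)\<bar> + \<bar>h (quantile F0 t) - of_bool (t \<in> ?B)\<bar>"
          by linarith
      qed
      also have "\<dots> \<le> \<epsilon> / 8 + \<epsilon> / 8"
        unfolding Bochner_Integration.integral_add[OF shift_gE(2)[OF c(2)] iB]
        using shift_gE(1)[OF c(2)] h(5) by (rule add_mono)
      finally show ?thesis by simp
    qed
    \<comment> \<open>With \<delta> equal to \<open>\<epsilon> / (8 * M)\<close> the two Lipschitz
      errors together stay below \<open>\<epsilon> / 8\<close>; the summand 1 keeps \<open>M\<close>
      positive.\<close>
    define M where "M = L + L' + 1"
    define \<delta> where "\<delta> = \<epsilon> / (8 * M)"
    have M: "0 < M" using g(1) h(1) by (simp add: M_def)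
    have \<delta>0: "0 < \<delta>" using \<epsilon> M by (simp add: \<delta>_def)
    have "M * \<delta> = \<epsilon> / 8" using M by (simp add: \<delta>_def)
    moreover have "M * \<delta> = L * \<delta> + L' * \<delta> + \<delta>" by (simp add: M_def algebra_simps)
    ultimately have \<delta>: "0 < \<delta>" "L * \<delta> + L' * \<delta> \<le> \<epsilon> / 8" using \<delta>0 by linarith+
    have "((\<lambda>i. \<integral>y. ?f y \<partial>coding (F i) (c i)) \<longlongrightarrow> (\<integral>y. ?f y \<partial>coding F0 d)) Fl"
      using lim f unfolding limitin_weak_star_topology by blast
    then have "eventually (\<lambda>i. (\<integral>y. ?f y \<partial>coding (F i) (c i)) < 3 * \<epsilon> / 8) Fl"
      by (rule order_tendstoD(2)) (use X0 \<epsilon> in linarith)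
    with F(1) c(1) coding_limit_cdf[OF F c lim \<delta>(1)]
    show "eventually (\<lambda>i. dist (coarse_dist \<gamma> E (c i) d) 0 < \<epsilon>) Fl"
    proof eventually_elim
      case (elim i)
      note T = gaction_Y_measureD[OF gaction_rep[OF elim(2)]]
      let ?T = "rep (c i) \<gamma>"
      let ?a = "\<lambda>t. \<bar>g (quantile F0 (?T t)) - of_bool (?T t \<in> E)\<bar>"
      let ?b = "\<lambda>t. \<bar>g (quantile (F i) (?T t)) - g (quantile F0 (?T t))\<bar>"
      let ?x = "\<lambda>t. \<bar>g (quantile (F i) (?T t)) - h (quantile (F i) t)\<bar>"
      let ?e = "\<lambda>t. \<bar>h (quantile (F i) t) - h (quantile F0 t)\<bar>"
      let ?f' = "\<lambda>t. \<bar>h (quantile F0 t) - of_bool (t \<in> ?B)\<bar>"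
      have gh2: "\<bar>g x - g y\<bar> \<le> 1" "\<bar>h x - h y\<bar> \<le> 1" for x y
        using g(3)[of x] g(3)[of y] h(3)[of x] h(3)[of y] by linarith+
      have gq: "(\<lambda>t. g (quantile (F i) t)) \<in> borel_measurable Y_measure" "(\<lambda>t. g (quantile F0 t)) \<in> borel_measurable Y_measure"
        "(\<lambda>t. h (quantile (F i) t)) \<in> borel_measurable Y_measure" "(\<lambda>t. h (quantile F0 t)) \<in> borel_measurable Y_measure"
        by (rule measurable_compose[OF measurable_quantile gY] measurable_compose[OF measurable_quantile hY]; rule elim F)+
      note gqT = measurable_compose[OF T(3)[of \<gamma>] gq(1)] measurable_compose[OF T(3)[of \<gamma>] gq(2)]
      have ib: "integrable Y_measure ?b"
        by (rule integrable_Y_measure[where B = 1]) (use gqT gh2 in auto)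
      have ix: "integrable Y_measure ?x"
        by (rule integrable_Y_measure[where B = 1]) (use gqT gq gh1 in auto)
      have ie: "integrable Y_measure ?e"
        by (rule integrable_Y_measure[where B = 1]) (use gq gh2 in auto)
      note ia = shift_gE(2)[OF elim(2)]
      have "coarse_dist \<gamma> E (c i) d
          = (\<integral>t. \<bar>of_bool (?T t \<in> E) - of_bool (rep d \<gamma> t \<in> E)\<bar> \<partial>Y_measure)"
        unfolding integral_of_bool_sym_diff[OF T(3) R(3) E] by (simp add: coarse_dist_def)
      \<comment> \<open>The triangle inequality runs from \<open>E\<close> along \<open>c i\<close>
        to \<open>g\<close> with \<open>F0\<close>, to \<open>g\<close> with \<open>F i\<close>, to
        \<open>h\<close> with \<open>F i\<close>, to \<open>h\<close> with \<open>F0\<close>, to the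
        preimage under \<open>d\<close>. The approximation errors contribute
        \<open>\<epsilon> / 8\<close> each, the test function less than
        \<open>3 * \<epsilon> / 8\<close>, and the two changes of quantile at most
        \<open>\<epsilon> / 8\<close> in all.\<close>
      also have "\<dots> \<le> (\<integral>t. ?a t + ?b t + ?x t + ?e t + ?f' t \<partial>Y_measure)"
      proof (rule integral_mono)
        have "(\<lambda>t. of_bool (?T t \<in> E) :: real) \<in> borel_measurable Y_measure"
          "(\<lambda>t. of_bool (rep d \<gamma> t \<in> E) :: real) \<in> borel_measurable Y_measure"
          using measurable_compose[OF T(3) Em(1)] measurable_compose[OF R(3) Em(1)] by auto
        then show "integrable Y_measure (\<lambda>t. \<bar>of_bool (?T t \<in> E) - of_bool (rep d \<gamma> t \<in> E)\<bar> :: real)"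
          by (intro integrable_Y_measure[where B = 1]) auto
        show "integrable Y_measure (\<lambda>t. ?a t + ?b t + ?x t + ?e t + ?f' t)"
          by (intro Bochner_Integration.integrable_add ia ib ix ie iB)
        fix t assume "t \<in> space Y_measure"
        then have "of_bool (t \<in> ?B) = (of_bool (rep d \<gamma> t \<in> E) :: real)" by simp
        then show "\<bar>of_bool (?T t \<in> E) - of_bool (rep d \<gamma> t \<in> E)\<bar> \<le> ?a t + ?b t + ?x t + ?e t + ?f' t"
          by linarith
      qed
      also have "\<dots> = (\<integral>t. ?a t \<partial>Y_measure) + (\<integral>t. ?b t \<partial>Y_measure) + (\<integral>t. ?x t \<partial>Y_measure)
          + (\<integral>t. ?e t \<partial>Y_measure) + (\<integral>t. ?f' t \<partial>Y_measure)"
        by (simp only: Bochner_Integration.integral_add Bochner_Integration.integrable_add ia ib ix ie iB)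
      also have "(\<integral>t. ?b t \<partial>Y_measure) = (\<integral>t. \<bar>g (quantile (F i) t) - g (quantile F0 t)\<bar> \<partial>Y_measure)"
        by (rule integral_measure_preserving[OF T(1), where f = "\<lambda>t. \<bar>g (quantile (F i) t) - g (quantile F0 t)\<bar>"])
           (use gq in auto)
      also have "\<dots> \<le> L * \<delta>"
        by (rule integral_Lipschitz_quantile_le[OF elim(1) F(2) _ g(2,1) gb]) (use elim(3) in auto)
      also have "(\<integral>t. ?e t \<partial>Y_measure) \<le> L' * \<delta>"
        by (rule integral_Lipschitz_quantile_le[OF elim(1) F(2) _ h(2,1) hb]) (use elim(3) in auto)
      finally have "coarse_dist \<gamma> E (c i) d < \<epsilon>"
        using shift_gE(1)[OF elim(2)] h(5) elim(4) \<delta>(2) \<epsilon> unfolding int_f[OF elim(1,2)] by linarith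
      then show ?case by (simp add: coarse_dist_def)
    qed
  qed
qed

text \<open>Distinct values are separated by a rational, so the countably many half lines with
  rational endpoint decide equality almost everywhere.\<close>

lemma Y_actions_eqI:
  fixes c d :: "('g::{group_add,countable} \<Rightarrow> real \<Rightarrow> real) set"
  assumes c: "c \<in> Y_actions" and d: "d \<in> Y_actions"
    and eq: "\<And>\<gamma> E. E \<in> sets Y_measure \<Longrightarrow> coarse_dist \<gamma> E c d = 0"
  shows "c = d"
proof -
  interpret prob_space Y_measure by (rule prob_space_Y_measure)
  have ae: "AE t in Y_measure. rep c \<gamma> t = rep d \<gamma> t" for \<gamma>
  proof -
    note T = gaction_Y_measureD(3,4)[OF gaction_rep[OF c], where g = \<gamma>]
      and R = gaction_Y_measureD(3,4)[OF gaction_rep[OF d], where g = \<gamma>]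
    have "AE t in Y_measure. (rep c \<gamma> t < of_rat q) = (rep d \<gamma> t < of_rat q)" for q
    proof -
      let ?E = "{0..<1} \<inter> {..<real_of_rat q}"
      have E: "?E \<in> sets Y_measure" by (auto simp: sets_Y_measure_restrict sets_restrict_space)
      let ?S = "sym_diff (rep c \<gamma> -` ?E \<inter> space Y_measure) (rep d \<gamma> -` ?E \<inter> space Y_measure)"
      have "?S \<in> sets Y_measure"
        by (intro sets.Un sets.Diff measurable_sets[OF T(1) E] measurable_sets[OF R(1) E])
      moreover have "measure Y_measure ?S = 0" using eq[OF E, of \<gamma>] by (simp add: coarse_dist_def)
      moreover have "{t \<in> space Y_measure. \<not> (rep c \<gamma> t < of_rat q) = (rep d \<gamma> t < of_rat q)} \<subseteq> ?S"
      proof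
        fix t assume "t \<in> {t \<in> space Y_measure. \<not> (rep c \<gamma> t < of_rat q) = (rep d \<gamma> t < of_rat q)}"
        then have t: "t \<in> {0..<1}" and n: "(rep c \<gamma> t < of_rat q) \<noteq> (rep d \<gamma> t < of_rat q)" by auto
        show "t \<in> ?S" using T(2)[OF t] R(2)[OF t] t n by auto
      qed
      ultimately show ?thesis
        by (intro AE_I[of _ _ ?S]) (simp_all add: emeasure_eq_measure)
    qed
    then have "AE t in Y_measure. \<forall>q. (rep c \<gamma> t < of_rat q) = (rep d \<gamma> t < of_rat q)"
      by (simp add: AE_all_countable)
    then show ?thesis
    proof eventually_elim
      case (elim t)
      show ?case
      proof (rule ccontr)
        assume "rep c \<gamma> t \<noteq> rep d \<gamma> t"
        then consider "rep c \<gamma> t < rep d \<gamma> t" | "rep d \<gamma> t < rep c \<gamma> t" by linarith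
        then show False
        proof cases
          case 1
          obtain q where "rep c \<gamma> t < of_rat q" "of_rat q < rep d \<gamma> t" using of_rat_dense[OF 1] by auto
          then show False using elim[rule_format, of q] by simp
        next
          case 2
          obtain q where "rep d \<gamma> t < of_rat q" "of_rat q < rep c \<gamma> t" using of_rat_dense[OF 2] by auto
          then show False using elim[rule_format, of q] by simp
        qed
      qed
    qed
  qed
  then have "(rep c, rep d) \<in> ae_equal" by (simp add: ae_equal_def gaction_rep c d)
  then show ?thesis
    using quotient_eq_iff[OF ae_equal_equiv, of c d "rep c" "rep d"] c d rep_in[OF c] rep_in[OF d]
    by (simp add: Y_actions_def)
qed

section \<open>The coding as a homeomorphism onto its image\<close>

text \<open>The type of bounded continuous functions provides the complete supremum metric.\<close>

definition cdfs :: "(real \<Rightarrow>\<^sub>C real) set" where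
  "cdfs = {F. unit_cdf (apply_bcontfun F)}"

definition coding_map :: "(real \<Rightarrow>\<^sub>C real) \<times> ('g \<Rightarrow> real \<Rightarrow> real) set \<Rightarrow> ('g \<Rightarrow> real) measure" where
  "coding_map p = coding (apply_bcontfun (fst p)) (snd p)"

definition coded_measures :: "('g::{group_add,countable} \<Rightarrow> real) measure set" where
  "coded_measures = coding_map ` (cdfs \<times> Y_actions)"

lemma cdfs_limit_iff:
  assumes "eventually (\<lambda>i. F i \<in> cdfs) Fl" "F0 \<in> cdfs"
  shows "limitin (top_of_set cdfs) F F0 Fl \<longleftrightarrow>
    (\<forall>\<epsilon>>0. eventually (\<lambda>i. \<forall>x. \<bar>apply_bcontfun (F i) x - apply_bcontfun F0 x\<bar> \<le> \<epsilon>) Fl)"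
proof -
  have "(F \<longlongrightarrow> F0) Fl \<longleftrightarrow>
    (\<forall>\<epsilon>>0. eventually (\<lambda>i. \<forall>x. \<bar>apply_bcontfun (F i) x - apply_bcontfun F0 x\<bar> \<le> \<epsilon>) Fl)"
  proof (intro iffI allI impI tendstoI)
    fix \<epsilon> :: real assume L: "(F \<longlongrightarrow> F0) Fl" and "0 < \<epsilon>"
    from tendstoD[OF this] show "eventually (\<lambda>i. \<forall>x. \<bar>apply_bcontfun (F i) x - apply_bcontfun F0 x\<bar> \<le> \<epsilon>) Fl"
    proof eventually_elim
      case (elim i)
      show ?case
      proof
        fix x show "\<bar>apply_bcontfun (F i) x - apply_bcontfun F0 x\<bar> \<le> \<epsilon>"
          using elim dist_bounded[of "F i" x F0] by (simp add: dist_real_def)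
      qed
    qed
  next
    fix \<epsilon> :: real
    assume R: "\<forall>\<epsilon>>0. eventually (\<lambda>i. \<forall>x. \<bar>apply_bcontfun (F i) x - apply_bcontfun F0 x\<bar> \<le> \<epsilon>) Fl" and \<epsilon>: "0 < \<epsilon>"
    have "eventually (\<lambda>i. \<forall>x. \<bar>apply_bcontfun (F i) x - apply_bcontfun F0 x\<bar> \<le> \<epsilon> / 2) Fl"
      by (rule R[rule_format]) (use \<epsilon> in simp)
    then show "eventually (\<lambda>i. dist (F i) F0 < \<epsilon>) Fl"
    proof eventually_elim
      case (elim i)
      then have "dist (F i) F0 \<le> \<epsilon> / 2" by (intro dist_bound) (simp add: dist_real_def)
      then show ?case using \<epsilon> by simp
    qed
  qed
  then show ?thesis using assms by (simp add: limitin_subtopology)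
qed

text \<open>Applied to a constant sequence, the two recovery theorems say that equal laws have equal
  parameters.\<close>

lemma inj_on_coding_map: "inj_on coding_map (cdfs \<times> (Y_actions :: ('g::{group_add,countable} \<Rightarrow> real \<Rightarrow> real) set set))"
proof (rule inj_onI)
  fix p q :: "(real \<Rightarrow>\<^sub>C real) \<times> ('g \<Rightarrow> real \<Rightarrow> real) set"
  assume "p \<in> cdfs \<times> Y_actions" "q \<in> cdfs \<times> Y_actions" and pq: "coding_map p = coding_map q"
  then obtain F c G d where p: "p = (F, c)" and q: "q = (G, d)"
    and F: "F \<in> cdfs" and G: "G \<in> cdfs" and c: "c \<in> Y_actions" and d: "d \<in> Y_actions" by auto
  have eq: "coding_map (F, c) = coding_map (G, d)" using pq p q by simp
  have FG: "unit_cdf F" "unit_cdf G" using F G by (auto simp: cdfs_def)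
  have "limitin weak_star_topology (\<lambda>_::nat. coding F c) (coding G d) sequentially"
    using eq coding_in_SIM[OF FG(2) d] by (auto simp: coding_map_def limitin_weak_star_topology)
  note lims = coding_limit_cdf[OF always_eventually FG(2) always_eventually d this]
    coding_limit_coarse[OF always_eventually FG(2) always_eventually d this]
  have e: "\<bar>F x - G x\<bar> \<le> \<epsilon>" if "0 < \<epsilon>" for x \<epsilon>
    using lims(1)[OF _ _ that] FG c by (simp add: eventually_sequentially) blast
  have "F x = G x" for x
    using e[of "\<bar>F x - G x\<bar> / 2" x] by fastforce
  then have "F = G" by (rule bcontfun_eqI)
  have "limitin coarse_topology (\<lambda>_::nat. c) d sequentially" using lims(2) FG c by simp
  then have "coarse_dist \<gamma> E c d = 0" if "E \<in> sets Y_measure" for \<gamma> E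
    using that unfolding limitin_coarse_topology by (auto simp: LIMSEQ_const_iff)
  then have "c = d" by (rule Y_actions_eqI[OF c d])
  with \<open>F = G\<close> show "p = q" using p q by simp
qed

lemma coded_measures_subset_SIM: "coded_measures \<subseteq> SIM"
  by (auto simp: coded_measures_def coding_map_def cdfs_def intro: coding_in_SIM)

text \<open>Continuity in both directions is tested at each point along its filter
  \<open>atin\<close> of punctured neighbourhoods, where the limit theorems for arbitrary filters
  apply.\<close>

lemma homeomorphic_map_coding:
  "homeomorphic_map (prod_topology (top_of_set cdfs) coarse_topology)
     (subtopology weak_star_topology (coded_measures :: ('g::{group_add,countable} \<Rightarrow> real) measure set)) coding_map"
proof -
  let ?A = "Y_actions :: ('g \<Rightarrow> real \<Rightarrow> real) set set"
  let ?P = "prod_topology (top_of_set cdfs) (coarse_topology :: ('g \<Rightarrow> real \<Rightarrow> real) set topology)"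
  let ?S = "subtopology weak_star_topology (coded_measures :: ('g \<Rightarrow> real) measure set)"
  let ?k = "inv_into (cdfs \<times> ?A) coding_map"
  have topP: "topspace ?P = cdfs \<times> ?A" by simp
  have topS: "topspace ?S = coded_measures" using coded_measures_subset_SIM by auto
  have kh: "?k (coding_map p) = p" if "p \<in> cdfs \<times> ?A" for p
    by (rule inv_into_f_f[OF inj_on_coding_map that])
  have hk: "coding_map (?k \<mu>) = \<mu>" "?k \<mu> \<in> cdfs \<times> ?A" if "\<mu> \<in> coded_measures" for \<mu>
    using that f_inv_into_f[of \<mu> coding_map "cdfs \<times> ?A"] inv_into_into[of \<mu> coding_map "cdfs \<times> ?A"]
    by (auto simp: coded_measures_def)
  have idlim: "limitin X (\<lambda>x. x) x (atin X x)" if "x \<in> topspace X" for X :: "'z topology" and x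
    by (rule limitin_continuous_map[where f = "\<lambda>x. x"]) (use that in auto)
  have "continuous_map ?P weak_star_topology coding_map"
    unfolding continuous_map_atin
  proof
    fix p assume "p \<in> topspace ?P"
    then have p: "fst p \<in> cdfs" "snd p \<in> ?A" and "p \<in> topspace ?P" by auto
    have L: "limitin (top_of_set cdfs) fst (fst p) (atin ?P p)" "limitin coarse_topology snd (snd p) (atin ?P p)"
      using idlim[OF \<open>p \<in> topspace ?P\<close>] unfolding limitin_pairwise by (simp_all add: comp_def)
    have ev: "eventually (\<lambda>x. fst x \<in> cdfs) (atin ?P p)"
      using L(1) by (simp add: limitin_subtopology)
    have "limitin weak_star_topology (\<lambda>x. coding (apply_bcontfun (fst x)) (snd x))
        (coding (apply_bcontfun (fst p)) (snd p)) (atin ?P p)"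
    proof (rule limitin_coding[OF _ _ _ L(2)])
      show "eventually (\<lambda>x. unit_cdf (apply_bcontfun (fst x))) (atin ?P p)"
        using ev by (simp add: cdfs_def)
      show "unit_cdf (apply_bcontfun (fst p))" using p by (simp add: cdfs_def)
    qed (use L(1) cdfs_limit_iff[OF ev p(1)] in simp)
    then show "limitin weak_star_topology coding_map (coding_map p) (atin ?P p)"
      by (simp add: coding_map_def[abs_def])
  qed
  then have 1: "continuous_map ?P ?S coding_map"
    by (auto simp: continuous_map_in_subtopology coded_measures_def)
  have 2: "continuous_map ?S ?P ?k"
    unfolding continuous_map_atin
  proof
    fix \<mu> assume "\<mu> \<in> topspace ?S"
    then have \<mu>: "\<mu> \<in> coded_measures" using topS by simp
    let ?Fl = "atin ?S \<mu>"
    have "limitin ?S (\<lambda>\<nu>. \<nu>) \<mu> ?Fl" by (rule idlim) fact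
    then have ev: "eventually (\<lambda>\<nu>. \<nu> \<in> coded_measures) ?Fl" and L: "limitin weak_star_topology (\<lambda>\<nu>. \<nu>) \<mu> ?Fl"
      by (auto simp: limitin_subtopology)
    have "limitin weak_star_topology (\<lambda>\<nu>. coding_map (?k \<nu>)) (coding_map (?k \<mu>)) ?Fl"
    proof (rule limitin_transform_eventually)
      show "eventually (\<lambda>\<nu>. \<nu> = coding_map (?k \<nu>)) ?Fl" using ev by eventually_elim (simp add: hk)
    qed (use L hk(1)[OF \<mu>] in simp)
    then have L': "limitin weak_star_topology (\<lambda>\<nu>. coding (apply_bcontfun (fst (?k \<nu>))) (snd (?k \<nu>)))
      (coding (apply_bcontfun (fst (?k \<mu>))) (snd (?k \<mu>))) ?Fl"
      by (simp add: coding_map_def)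
    have k\<mu>: "fst (?k \<mu>) \<in> cdfs" "snd (?k \<mu>) \<in> ?A" using hk(2)[OF \<mu>] by auto
    have evk: "eventually (\<lambda>\<nu>. fst (?k \<nu>) \<in> cdfs) ?Fl" "eventually (\<lambda>\<nu>. snd (?k \<nu>) \<in> ?A) ?Fl"
      using ev by (auto elim!: eventually_mono dest!: hk(2))
    have u: "eventually (\<lambda>\<nu>. unit_cdf (apply_bcontfun (fst (?k \<nu>)))) ?Fl" "unit_cdf (apply_bcontfun (fst (?k \<mu>)))"
      using evk(1) k\<mu>(1) by (simp_all add: cdfs_def)
    have "limitin (top_of_set cdfs) (\<lambda>\<nu>. fst (?k \<nu>)) (fst (?k \<mu>)) ?Fl"
      unfolding cdfs_limit_iff[OF evk(1) k\<mu>(1)]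
      using coding_limit_cdf[OF u evk(2) k\<mu>(2) L'] by blast
    moreover have "limitin coarse_topology (\<lambda>\<nu>. snd (?k \<nu>)) (snd (?k \<mu>)) ?Fl"
      by (rule coding_limit_coarse[OF u evk(2) k\<mu>(2) L'])
    ultimately show "limitin ?P ?k (?k \<mu>) ?Fl"
      by (simp add: limitin_pairwise comp_def)
  qed
  have "homeomorphic_maps ?P ?S coding_map ?k"
    unfolding homeomorphic_maps_def using 1 2 kh hk(1) topS by (simp only: topP) auto
  then show ?thesis unfolding homeomorphic_map_maps by blast
qed

section \<open>Which invariant measures are codings\<close>

lemma SIM_D:
  assumes "\<mu> \<in> SIM"
  shows "sets \<mu> = sets (borel_of Y_hat)" "prob_space \<mu>" "measure_preserving \<mu> \<mu> (coord_shift \<alpha>)"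
    "space \<mu> = topspace Y_hat"
  using assms sets_eq_imp_space_eq[of \<mu> "borel_of Y_hat"] by (auto simp: SIM_def space_borel_of)

lemma measurable_SIM_coordinate:
  assumes "\<mu> \<in> SIM"
  shows "(\<lambda>y. y g) \<in> \<mu> \<rightarrow>\<^sub>M Y_measure" "(\<lambda>y. y g) \<in> borel_measurable \<mu>"
  unfolding measurable_cong_sets[OF SIM_D(1)[OF assms] refl]
  by (rule measurable_coordinate, rule measurable_coordinate_real)

text \<open>Applying the distribution function of the zeroth marginal to \<open>y 0\<close> gives a
  uniformly distributed parameter. As \<open>y 0\<close> determines all coordinates, the shift
  descends to an action \<open>T\<close> on that parameter, and the law of the names of
  \<open>T\<close> is \<mu> again.\<close>

lemma coded_measuresI:
  fixes \<mu> :: "('g::{group_add,countable} \<Rightarrow> real) measure"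
  assumes \<mu>: "\<mu> \<in> SIM" and atom: "\<And>x. measure \<mu> {y \<in> space \<mu>. y 0 = x} = 0"
    and gen: "\<And>\<gamma>. \<exists>\<phi>. \<phi> \<in> Y_measure \<rightarrow>\<^sub>M Y_measure \<and> (AE y in \<mu>. y \<gamma> = \<phi> (y 0))"
  shows "\<mu> \<in> coded_measures"
proof -
  note s\<mu> = SIM_D(1)[OF \<mu>] and S = SIM_D(3)[OF \<mu>] and cm = measurable_SIM_coordinate[OF \<mu>]
  interpret \<mu>: prob_space \<mu> by (rule SIM_D(2)[OF \<mu>])
  obtain \<phi> where \<phi>: "\<And>\<gamma>. \<phi> \<gamma> \<in> Y_measure \<rightarrow>\<^sub>M Y_measure" "\<And>\<gamma>. AE y in \<mu>. y \<gamma> = \<phi> \<gamma> (y 0)"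
    using gen by metis
  have rng: "0 \<le> y g \<and> y g < 1" if "y \<in> space \<mu>" for y g
    using that SIM_D(4)[OF \<mu>] by (auto simp: mem_topspace_Y_hat)
  define \<nu> where "\<nu> = distr \<mu> borel (\<lambda>y. y 0)"
  interpret \<nu>: real_distribution \<nu> unfolding \<nu>_def by (rule \<mu>.real_distribution_distr[OF cm(2)])
  have \<nu>m: "measure \<nu> A = measure \<mu> {y \<in> space \<mu>. y 0 \<in> A}" if "A \<in> sets borel" for A
    unfolding \<nu>_def using that by (subst measure_distr[OF cm(2)]) (auto intro!: arg_cong[of _ _ "measure \<mu>"])
  define F where "F = cdf \<nu>"
  have F: "unit_cdf F"
    unfolding unit_cdf_def
  proof (intro conjI allI impI)
    show "mono F" unfolding F_def mono_def by (auto intro: \<nu>.cdf_nondecreasing)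
    show "continuous_on UNIV F" unfolding F_def
      using atom by (auto intro!: continuous_at_imp_continuous_on simp: \<nu>.isCont_cdf \<nu>m)
    fix x :: real
    show "F x = 0" if "x \<le> 0"
    proof -
      \<comment> \<open>Coordinates are nonnegative, so the value of \<open>F\<close> at 0 is the
        mass of the atom at 0, which is excluded.\<close>
      have "{y \<in> space \<mu>. y 0 \<le> x} \<subseteq> {y \<in> space \<mu>. y 0 = 0}" using that rng[of _ 0] by force
      moreover have "{y \<in> space \<mu>. y 0 = 0} \<in> sets \<mu>" using cm(2)[of 0] by measurable
      ultimately have "measure \<mu> {y \<in> space \<mu>. y 0 \<le> x} \<le> measure \<mu> {y \<in> space \<mu>. y 0 = 0}"
        by (rule \<mu>.finite_measure_mono)
      then have "measure \<mu> {y \<in> space \<mu>. y 0 \<le> x} = 0"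
        using atom[of 0] measure_nonneg[of \<mu>] by (simp add: order_antisym)
      then show ?thesis unfolding F_def cdf_def by (simp add: \<nu>m)
    qed
    show "F x = 1" if "1 \<le> x"
    proof -
      have "{y \<in> space \<mu>. y 0 \<le> x} = space \<mu>" using that rng[of _ 0] by force
      then show ?thesis unfolding F_def cdf_def by (simp add: \<nu>m \<mu>.prob_space)
    qed
  qed
  interpret Y: prob_space Y_measure by (rule prob_space_Y_measure)
  have qm: "quantile F \<in> borel_measurable Y_measure" by (rule borel_measurable_quantile[OF F])
  have law: "distr Y_measure borel (quantile F) = \<nu>"
  proof (rule cdf_unique)
    show "real_distribution (distr Y_measure borel (quantile F))"
      by (rule Y.real_distribution_distr[OF qm])
    show "cdf (distr Y_measure borel (quantile F)) = cdf \<nu>"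
    proof
      fix x
      have "cdf (distr Y_measure borel (quantile F)) x = measure Y_measure (quantile F -` {..x} \<inter> space Y_measure)"
        unfolding cdf_def by (rule measure_distr[OF qm]) simp
      also have "quantile F -` {..x} \<inter> space Y_measure = {t \<in> {0..<1}. quantile F t \<le> x}" by auto
      finally show "cdf (distr Y_measure borel (quantile F)) x = cdf \<nu> x"
        using measure_quantile_le[OF F, of x] by (simp add: F_def)
    qed
  qed unfold_locales
  define \<kappa> where "\<kappa> x = clip (F x)" for x
  have \<kappa>m: "\<kappa> \<in> borel \<rightarrow>\<^sub>M Y_measure"
    unfolding measurable_Y_measure_iff \<kappa>_def[abs_def]
    by (intro conjI measurable_compose[OF borel_measurable_unit_cdf[OF F] measurable_clip]) (auto simp: clip_def)
  have \<kappa>Y: "\<kappa> \<in> Y_measure \<rightarrow>\<^sub>M Y_measure"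
    unfolding \<kappa>_def[abs_def] by (rule measurable_clip_cdf[OF F])
  have \<kappa>q: "\<kappa> (quantile F t) = t" if "t \<in> {0..<1}" for t
    using quantile_right_inverse[OF F, of t] that by (simp add: \<kappa>_def)
  let ?\<pi> = "\<lambda>y :: 'g \<Rightarrow> real. \<kappa> (y 0)"
  have \<pi>m: "?\<pi> \<in> \<mu> \<rightarrow>\<^sub>M Y_measure" by (rule measurable_compose[OF cm(2) \<kappa>m])
  have "distr \<mu> Y_measure ?\<pi> = distr \<nu> Y_measure \<kappa>"
    unfolding \<nu>_def by (simp only: distr_distr[OF \<kappa>m cm(2)] comp_def)
  also have "\<dots> = distr Y_measure Y_measure (\<lambda>t. \<kappa> (quantile F t))"
    unfolding law[symmetric] by (simp only: distr_distr[OF \<kappa>m qm] comp_def)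
  also have "\<dots> = distr Y_measure Y_measure (\<lambda>t. t)"
    by (rule distr_cong) (auto simp: \<kappa>q)
  finally have d\<pi>: "distr \<mu> Y_measure ?\<pi> = Y_measure" by (simp add: distr_id2)
  then have \<pi>: "measure_preserving \<mu> Y_measure ?\<pi>" using \<pi>m by (simp add: measure_preserving_def)
  have q\<pi>: "AE y in \<mu>. quantile F (?\<pi> y) = y 0"
  proof -
    have "(\<lambda>x. quantile F (\<kappa> x)) \<in> borel_measurable borel" by (rule measurable_compose[OF \<kappa>m qm])
    then have P: "{x \<in> space borel. quantile F (\<kappa> x) = x} \<in> sets borel"
      by (rule AE_eq_real_measurable) simp
    have "AE x in \<nu>. quantile F (\<kappa> x) = x"
      unfolding law[symmetric] AE_distr_iff[OF qm P] by (rule AE_I2) (simp add: \<kappa>q)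
    then show ?thesis unfolding \<nu>_def by (rule AE_distrD[OF cm(2)])
  qed
  \<comment> \<open>From the parameter to the zeroth coordinate, to the coordinate at \<gamma>, and
    back to a parameter.\<close>
  define T where "T \<gamma> t = \<kappa> (\<phi> \<gamma> (quantile F t))" for \<gamma> t
  have Tm: "T \<gamma> \<in> Y_measure \<rightarrow>\<^sub>M Y_measure" for \<gamma>
    unfolding T_def[abs_def]
    by (rule measurable_compose[OF measurable_compose[OF measurable_quantile[OF F] \<phi>(1)] \<kappa>Y])
  have T\<pi>: "AE y in \<mu>. T \<gamma> (?\<pi> y) = ?\<pi> (coord_shift \<gamma> y)" for \<gamma>
    using q\<pi> \<phi>(2)[of \<gamma>] by eventually_elim (simp add: T_def coord_shift_def)
  have Tpres: "measure_preserving Y_measure Y_measure (T \<gamma>)" for \<gamma>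
  proof -
    have "distr Y_measure Y_measure (T \<gamma>) = distr (distr \<mu> Y_measure ?\<pi>) Y_measure (T \<gamma>)" by (simp add: d\<pi>)
    also have "\<dots> = distr \<mu> Y_measure (\<lambda>y. T \<gamma> (?\<pi> y))"
      by (simp only: distr_distr[OF Tm \<pi>m] comp_def)
    also have "\<dots> = distr \<mu> Y_measure (\<lambda>y. ?\<pi> (coord_shift \<gamma> y))"
      using S by (intro distr_cong_AE[OF refl refl T\<pi>] measurable_compose[OF \<pi>m Tm] measurable_compose[OF _ \<pi>m])
        (auto simp: measure_preserving_def)
    also have "\<dots> = Y_measure"
      using measure_preserving_comp[OF S \<pi>] by (auto simp: measure_preserving_def)
    finally show ?thesis using Tm by (simp add: measure_preserving_def)
  qed
  \<comment> \<open>The shift satisfies the action law exactly; \<open>?\<pi>\<close> intertwines it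
    with \<open>T\<close> almost everywhere and carries \<mu> to Lebesgue measure.\<close>
  have Tact: "AE t in Y_measure. T (\<beta> + \<alpha>) t = T \<beta> (T \<alpha> t)" for \<beta> \<alpha>
  proof -
    have Tb: "T \<gamma> \<in> borel_measurable Y_measure" for \<gamma> using Tm by (simp add: measurable_Y_measure_iff)
    have P: "{t \<in> space Y_measure. T (\<beta> + \<alpha>) t = T \<beta> (T \<alpha> t)} \<in> sets Y_measure"
      by (rule AE_eq_real_measurable[OF Tb measurable_compose[OF Tm Tb]])
    show ?thesis
      unfolding AE_measure_preserving_iff[OF \<pi> P]
      using T\<pi>[of "\<beta> + \<alpha>"] T\<pi>[of \<alpha>] AE_measure_preserving[OF S T\<pi>[of \<beta>], of \<alpha>]
      by eventually_elim (simp add: coord_shift_def)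
  qed
  have T: "gaction Y_measure T"
    unfolding gaction_def
  proof (intro conjI allI prob_space_Y_measure Tpres Tact)
    show "(\<lambda>(\<gamma>, x). T \<gamma> x) \<in> count_space UNIV \<Otimes>\<^sub>M Y_measure \<rightarrow>\<^sub>M Y_measure"
      by (rule measurable_pair_measure_countable1) (use Tm in auto)
  qed
  define c where "c = ae_equal `` {T}"
  have c: "c \<in> Y_actions" unfolding c_def Y_actions_def using T by (intro quotientI) simp
  have Tc: "T \<in> c" unfolding c_def using equiv_class_self[OF ae_equal_equiv, of T] T by simp
  have "coding F c = distr Y_measure (borel_of Y_hat) (name F T)"
    unfolding coding_def
  proof (rule distr_cong_AE[OF refl refl _ measurable_name[OF F gaction_rep[OF c]] measurable_name[OF F T]])
    have "AE t in Y_measure. \<forall>\<gamma>. rep c \<gamma> t = T \<gamma> t"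
      using ae_equal_rep[OF c Tc] by (simp add: AE_all_countable)
    then show "AE t in Y_measure. name F (rep c) t = name F T t"
      by eventually_elim (auto simp: name_def)
  qed
  also have "\<dots> = distr (distr \<mu> Y_measure ?\<pi>) (borel_of Y_hat) (name F T)" by (simp add: d\<pi>)
  also have "\<dots> = distr \<mu> (borel_of Y_hat) (\<lambda>y. name F T (?\<pi> y))"
    by (simp only: distr_distr[OF measurable_name[OF F T] \<pi>m] comp_def)
  also have "\<dots> = distr \<mu> (borel_of Y_hat) (\<lambda>y. y)"
  proof (rule distr_cong_AE[OF refl refl])
    have "AE y in \<mu>. name F T (?\<pi> y) \<gamma> = y \<gamma>" for \<gamma>
      using T\<pi>[of \<gamma>] AE_measure_preserving[OF S q\<pi>, of \<gamma>]
      by eventually_elim (simp add: name_def coord_shift_def)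
    then have "AE y in \<mu>. \<forall>\<gamma>. name F T (?\<pi> y) \<gamma> = y \<gamma>" by (simp add: AE_all_countable)
    then show "AE y in \<mu>. name F T (?\<pi> y) = y" by eventually_elim auto
  qed (use measurable_compose[OF \<pi>m measurable_name[OF F T]] s\<mu> in \<open>auto intro: measurable_ident_sets\<close>)
  also have "\<dots> = \<mu>" by (rule distr_id2[OF s\<mu>[symmetric]])
  finally have \<mu>c: "\<mu> = coding F c" by simp
  have "F \<in> bcontfun"
    using F unit_cdf_bounds[OF F] by (intro bcontfun_normI[of _ 1]) (auto simp: unit_cdf_def)
  then have "apply_bcontfun (Bcontfun F) = F" by (rule Bcontfun_inverse)
  then have "\<mu> = coding_map (Bcontfun F, c)" "Bcontfun F \<in> cdfs"
    using \<mu>c F by (simp_all add: coding_map_def cdfs_def)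
  then show ?thesis unfolding coded_measures_def using c by (intro image_eqI[of _ _ "(Bcontfun F, c)"]) auto
qed

section \<open>Open conditions that cut out the codings\<close>

definition circle_fun :: "(real \<Rightarrow> real) \<Rightarrow> bool" where
  "circle_fun g \<longleftrightarrow> continuous_map circle euclideanreal g"

lemma openin_weak_star_integral_less:
  assumes "continuous_map Y_hat euclideanreal f"
  shows "openin weak_star_topology {\<mu> \<in> SIM. (\<integral>y. f y \<partial>\<mu>) < b}"
proof -
  have "openin weak_star_topology {\<mu> \<in> SIM. (\<integral>y. f y \<partial>\<mu>) \<in> {..<b}}"
    unfolding weak_star_topology_def
  proof (rule topology_generated_by_Basis)
    show "{\<mu> \<in> SIM. (\<integral>y. f y \<partial>\<mu>) \<in> {..<b}}
      \<in> {{\<mu> \<in> SIM. (\<integral>y. f y \<partial>\<mu>) \<in> U} |f U. continuous_map Y_hat euclideanreal f \<and> open U}"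
      using assms by (intro CollectI exI[of _ f] exI[of _ "{..<b}"]) auto
  qed
  then show ?thesis by simp
qed

text \<open>An open condition forcing every atom of the zeroth marginal to have mass below
  \<open>2 * \<epsilon>\<close>: an atom has at most twice the integral of a nonnegative bump
  exceeding 1/2 there. Finiteness of the cover keeps the condition open.\<close>

definition small_atoms :: "real \<Rightarrow> ('g::{group_add,countable} \<Rightarrow> real) measure set" where
  "small_atoms \<epsilon> = (\<Union>H\<in>{H. finite H \<and> H \<subseteq> Collect circle_fun \<and> (\<forall>h\<in>H. \<forall>x. 0 \<le> h x) \<and>
      (\<forall>x\<in>{0..<1}. \<exists>h\<in>H. 1 / 2 < h x)}. {\<mu> \<in> SIM. \<forall>h\<in>H. (\<integral>y. h (y 0) \<partial>\<mu>) < \<epsilon>})"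

text \<open>The L1 distance of \<open>u (y \<gamma>)\<close> from the functions of
  \<open>y 0\<close>, with approximants restricted to continuous ones so that each single condition
  is weak-* open.\<close>

definition nearly_determined ::
  "'g \<Rightarrow> (real \<Rightarrow> real) \<Rightarrow> real \<Rightarrow> ('g::{group_add,countable} \<Rightarrow> real) measure set" where
  "nearly_determined \<gamma> u \<epsilon> = (\<Union>g\<in>Collect circle_fun. {\<mu> \<in> SIM. (\<integral>y. \<bar>u (y \<gamma>) - g (y 0)\<bar> \<partial>\<mu>) < \<epsilon>})"

lemma openin_small_atoms:
  "openin weak_star_topology (small_atoms \<epsilon> :: ('g::{group_add,countable} \<Rightarrow> real) measure set)"
  unfolding small_atoms_def
proof (rule openin_Union, safe)
  fix H :: "(real \<Rightarrow> real) set"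
  assume H: "finite H" "H \<subseteq> Collect circle_fun"
  have "{\<mu> \<in> SIM. \<forall>h\<in>H. (\<integral>y. h (y (0 :: 'g)) \<partial>\<mu>) < \<epsilon>}
      = topspace weak_star_topology \<inter> (\<Inter>h\<in>H. {\<mu> \<in> SIM. (\<integral>y. h (y 0) \<partial>\<mu>) < \<epsilon>})" by auto
  moreover have "openin (weak_star_topology :: ('g \<Rightarrow> real) measure topology)
      (topspace weak_star_topology \<inter> (\<Inter>h\<in>H. {\<mu> \<in> SIM. (\<integral>y. h (y 0) \<partial>\<mu>) < \<epsilon>}))"
  proof (cases "H = {}")
    case False
    show ?thesis
    proof (rule openin_Int[OF openin_topspace openin_INT2[OF H(1) False]])
      fix h assume "h \<in> H"
      then show "openin weak_star_topology {\<mu> \<in> SIM. (\<integral>y. h (y 0) \<partial>\<mu>) < \<epsilon>}"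
        using H(2) by (intro openin_weak_star_integral_less continuous_map_Y_hat_coordinate) (auto simp: circle_fun_def)
    qed
  next
    case True
    then show ?thesis using openin_topspace[of weak_star_topology] by simp
  qed
  ultimately show "openin weak_star_topology {\<mu> \<in> SIM. \<forall>h\<in>H. (\<integral>y. h (y (0 :: 'g)) \<partial>\<mu>) < \<epsilon>}"
    by (simp only:)
qed

lemma openin_nearly_determined:
  assumes "circle_fun u"
  shows "openin weak_star_topology (nearly_determined \<gamma> u \<epsilon>)"
  unfolding nearly_determined_def
proof (rule openin_Union, safe)
  fix g assume "circle_fun g"
  then show "openin weak_star_topology {\<mu> \<in> SIM. (\<integral>y. \<bar>u (y \<gamma>) - g (y 0)\<bar> \<partial>\<mu>) < \<epsilon>}"
    using assms unfolding circle_fun_def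
    by (intro openin_weak_star_integral_less continuous_map_real_abs continuous_map_diff
        continuous_map_Y_hat_coordinate)
qed

text \<open>The two functions separate the points of the circle: \<open>fold_circle\<close> identifies exactly \<open>x\<close>
  and \<open>1 - x\<close>, and \<open>left_half\<close> is positive exactly on \<open>{0<..<1/2}\<close>.\<close>

definition fold_circle :: "real \<Rightarrow> real" where "fold_circle x = min x (1 - x)"

definition left_half :: "real \<Rightarrow> real" where "left_half x = max 0 (1 / 4 - \<bar>x - 1 / 4\<bar>)"

lemma circle_fun_fold_circle: "circle_fun fold_circle" and circle_fun_left_half: "circle_fun left_half"
  unfolding circle_fun_def fold_circle_def[abs_def] left_half_def[abs_def]
  by (intro continuous_map_circle continuous_intros; simp)+

lemma unfold_circle:
  assumes "x \<in> {0..<1}"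
  shows "clip (if 0 < left_half x then fold_circle x else 1 - fold_circle x) = x"
  using assms by (auto simp: clip_def fold_circle_def left_half_def)

lemma integrable_SIM:
  fixes f :: "('g::{group_add,countable} \<Rightarrow> real) \<Rightarrow> real"
  assumes \<mu>: "\<mu> \<in> SIM" and f: "continuous_map Y_hat euclideanreal f"
  shows "integrable \<mu> f"
proof -
  interpret prob_space \<mu> by (rule SIM_D(2)[OF \<mu>])
  obtain B where "\<And>y. y \<in> topspace Y_hat \<Longrightarrow> \<bar>f y\<bar> \<le> B"
    using continuous_map_bounded[OF compact_space_Y_hat f] by blast
  then show ?thesis
    using borel_measurable_continuous_map[OF f] SIM_D(4)[OF \<mu>]
    by (intro integrable_const_bound[where B = B]) (auto simp: measurable_cong_sets[OF SIM_D(1)[OF \<mu>] refl])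
qed

lemma small_atoms_imp_null:
  fixes \<mu> :: "('g::{group_add,countable} \<Rightarrow> real) measure"
  assumes \<mu>: "\<And>n. \<mu> \<in> small_atoms (1 / real (Suc n))"
  shows "measure \<mu> {y \<in> space \<mu>. y 0 = x} = 0"
proof (cases "x \<in> {0..<1}")
  case False
  have S: "\<mu> \<in> SIM" using \<mu>[of 0] by (auto simp: small_atoms_def)
  have "{y \<in> space \<mu>. y 0 = x} = {}" using False SIM_D(4)[OF S] by (auto simp: mem_topspace_Y_hat)
  then show ?thesis by (simp only: measure_empty)
next
  case True
  have S: "\<mu> \<in> SIM" using \<mu>[of 0] by (auto simp: small_atoms_def)
  interpret prob_space \<mu> by (rule SIM_D(2)[OF S])
  let ?A = "{y \<in> space \<mu>. y 0 = x}"
  have A: "?A \<in> sets \<mu>" using measurable_SIM_coordinate(2)[OF S, of 0] by measurable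
  have "measure \<mu> ?A / 2 < 1 / real (Suc n)" for n
  proof -
    obtain H where H: "H \<subseteq> Collect circle_fun" "\<forall>h\<in>H. \<forall>x. 0 \<le> h x" "\<forall>x\<in>{0..<1}. \<exists>h\<in>H. 1 / 2 < h x"
      "\<forall>h\<in>H. (\<integral>y. h (y 0) \<partial>\<mu>) < 1 / real (Suc n)"
      using \<mu>[of n] unfolding small_atoms_def by (elim UN_E CollectE conjE)
    obtain h where h: "h \<in> H" "1 / 2 < h x" using bspec[OF H(3) True] by (elim bexE)
    have i: "integrable \<mu> (\<lambda>y. h (y 0))"
      using H(1) h(1) by (intro integrable_SIM S continuous_map_Y_hat_coordinate) (auto simp: circle_fun_def)
    have "(\<integral>y. indicator ?A y / 2 \<partial>\<mu>) \<le> (\<integral>y. h (y 0) \<partial>\<mu>)"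
    proof (rule integral_mono[OF _ i])
      show "integrable \<mu> (\<lambda>y. indicator ?A y / 2 :: real)"
        using A by (intro integrable_divide integrable_real_indicator) (auto simp: emeasure_eq_measure)
      show "indicator ?A y / 2 \<le> h (y 0)" for y
        using h H(2) by (auto simp: indicator_def)
    qed
    moreover have "?A \<inter> space \<mu> = ?A" by auto
    ultimately have "measure \<mu> ?A / 2 \<le> (\<integral>y. h (y 0) \<partial>\<mu>)" by simp
    then show ?thesis using bspec[OF H(4) h(1)] by linarith
  qed
  moreover have "\<exists>n. 1 / real (Suc n) < measure \<mu> ?A / 2" if "0 < measure \<mu> ?A / 2"
    using nat_approx_posE[OF that] by auto
  ultimately have "\<not> 0 < measure \<mu> ?A / 2" by (meson less_asym)
  then show ?thesis using measure_nonneg[of \<mu> ?A] by linarith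
qed

text \<open>The approximants converge in L1, so a subsequence converges almost everywhere, and its
  limit is a measurable function of \<open>y 0\<close>. Where the subsequence diverges,
  \<open>lim\<close> has an arbitrary value, but only on a null set.\<close>

lemma nearly_determined_imp_AE:
  fixes \<mu> :: "('g::{group_add,countable} \<Rightarrow> real) measure"
  assumes \<mu>: "\<And>n. \<mu> \<in> nearly_determined \<gamma> u (1 / real (Suc n))" and u: "circle_fun u"
  shows "\<exists>v. v \<in> borel_measurable Y_measure \<and> (AE y in \<mu>. u (y \<gamma>) = v (y 0))"
proof -
  have S: "\<mu> \<in> SIM" using \<mu>[of 0] by (auto simp: nearly_determined_def)
  have ex: "\<forall>n. \<exists>g. circle_fun g \<and> (\<integral>y. \<bar>u (y \<gamma>) - g (y 0)\<bar> \<partial>\<mu>) < 1 / real (Suc n)"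
    using \<mu> by (auto simp: nearly_determined_def)
  from choice[OF ex] obtain g :: "nat \<Rightarrow> real \<Rightarrow> real"
    where "\<forall>n. circle_fun (g n) \<and> (\<integral>y. \<bar>u (y \<gamma>) - g n (y 0)\<bar> \<partial>\<mu>) < 1 / real (Suc n)" by (elim exE)
  then have g: "circle_fun (g n)" "(\<integral>y. \<bar>u (y \<gamma>) - g n (y 0)\<bar> \<partial>\<mu>) < 1 / real (Suc n)" for n
    by auto
  let ?d = "\<lambda>n y. u (y \<gamma>) - g n (y 0)"
  have cd: "continuous_map Y_hat euclideanreal (?d n)" for n
    using u g(1)[of n] unfolding circle_fun_def by (intro continuous_map_diff continuous_map_Y_hat_coordinate)
  have "(\<lambda>n. \<integral>y. norm (?d n y) \<partial>\<mu>) \<longlonglongrightarrow> 0"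
  proof (rule tendsto_sandwich[OF _ _ tendsto_const LIMSEQ_inverse_real_of_nat])
    show "eventually (\<lambda>n. (\<integral>y. norm (?d n y) \<partial>\<mu>) \<le> inverse (real (Suc n))) sequentially"
      using g(2) by (intro always_eventually allI less_imp_le) (simp add: inverse_eq_divide)
  qed (simp add: integral_nonneg)
  from tendsto_L1_AE_subseq[OF integrable_SIM[OF S cd] this]
  obtain r :: "nat \<Rightarrow> nat" where r: "AE y in \<mu>. (\<lambda>n. ?d (r n) y) \<longlonglongrightarrow> 0" by blast
  have gm: "g n \<in> borel_measurable Y_measure" for n
    using g(1) by (intro borel_measurable_circle) (simp add: circle_fun_def)
  define v where "v x = lim (\<lambda>n. g (r n) x)" for x
  have "v \<in> borel_measurable Y_measure" unfolding v_def[abs_def]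
    by (rule borel_measurable_lim_metric) (rule gm)
  moreover have "AE y in \<mu>. u (y \<gamma>) = v (y 0)"
    using r
  proof eventually_elim
    case (elim y)
    have "(\<lambda>n. u (y \<gamma>) - ?d (r n) y) \<longlonglongrightarrow> u (y \<gamma>) - 0" by (intro tendsto_intros elim)
    then have "(\<lambda>n. g (r n) (y 0)) \<longlonglongrightarrow> u (y \<gamma>)" by simp
    then show ?case unfolding v_def by (rule limI[symmetric])
  qed
  ultimately show ?thesis by blast
qed

text \<open>No continuous real function on the circle is injective, so two are needed to recover a
  coordinate; \<open>unfold_circle\<close> reassembles it from their values.\<close>

lemma coded_measures_if_small_atoms_nearly_determined:
  fixes \<mu> :: "('g::{group_add,countable} \<Rightarrow> real) measure"
  assumes small: "\<And>n. \<mu> \<in> small_atoms (1 / real (Suc n))"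
    and det: "\<And>n \<gamma> u. u \<in> {fold_circle, left_half} \<Longrightarrow> \<mu> \<in> nearly_determined \<gamma> u (1 / real (Suc n))"
  shows "\<mu> \<in> coded_measures"
proof (rule coded_measuresI)
  show S: "\<mu> \<in> SIM" using small[of 0] by (auto simp: small_atoms_def)
  show "measure \<mu> {y \<in> space \<mu>. y 0 = x} = 0" for x by (rule small_atoms_imp_null[OF small])
  fix \<gamma>
  obtain v where v: "v \<in> borel_measurable Y_measure" "AE y in \<mu>. fold_circle (y \<gamma>) = v (y 0)"
    using nearly_determined_imp_AE[OF det circle_fun_fold_circle, of \<gamma>] by auto
  obtain w where w: "w \<in> borel_measurable Y_measure" "AE y in \<mu>. left_half (y \<gamma>) = w (y 0)"
    using nearly_determined_imp_AE[OF det circle_fun_left_half, of \<gamma>] by auto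
  let ?\<phi> = "\<lambda>x. clip (if 0 < w x then v x else 1 - v x)"
  have "(\<lambda>x. if 0 < w x then v x else 1 - v x) \<in> borel_measurable Y_measure" using v(1) w(1) by measurable
  from measurable_compose[OF this measurable_clip]
  have "?\<phi> \<in> Y_measure \<rightarrow>\<^sub>M Y_measure" by (auto simp: measurable_Y_measure_iff clip_def)
  moreover have "AE y in \<mu>. y \<gamma> = ?\<phi> (y 0)"
    using v(2) w(2) AE_space
  proof eventually_elim
    case (elim y)
    have "y \<gamma> \<in> {0..<1}" using elim(3) SIM_D(4)[OF S] by (auto simp: mem_topspace_Y_hat)
    then have "?\<phi> (y 0) = y \<gamma>" using unfold_circle[of "y \<gamma>"] unfolding elim(1,2) by blast
    then show ?case by (rule sym)
  qed
  ultimately show "\<exists>\<phi>. \<phi> \<in> Y_measure \<rightarrow>\<^sub>M Y_measure \<and> (AE y in \<mu>. y \<gamma> = \<phi> (y 0))" by blast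
qed

section \<open>The codings form a residual set\<close>

text \<open>Bumps shrinking to a point have integrals tending to the mass of that point, which is
  zero. Choosing for each point a bump of small integral, compactness of the circle leaves finitely
  many.\<close>

lemma coded_measures_subset_small_atoms:
  assumes \<epsilon>: "0 < \<epsilon>"
  shows "(coded_measures :: ('g::{group_add,countable} \<Rightarrow> real) measure set) \<subseteq> small_atoms \<epsilon>"
proof
  fix \<mu> :: "('g \<Rightarrow> real) measure" assume \<mu>: "\<mu> \<in> coded_measures"
  then obtain F c where F: "unit_cdf F" and c: "c \<in> Y_actions" and \<mu>c: "\<mu> = coding F c"
    by (auto simp: coded_measures_def coding_map_def cdfs_def)
  interpret prob_space Y_measure by (rule prob_space_Y_measure)
  have S: "\<mu> \<in> SIM" using \<mu> coded_measures_subset_SIM by blast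
  define h where "h x0 k x = max 0 (1 - real k * norm (circ x - circ x0))" for x0 :: real and k :: nat and x
  have h0: "0 \<le> h x0 k x" "h x0 k x \<le> 1" for x0 k x by (auto simp: h_def)
  have hc: "circle_fun (h x0 k)" for x0 k
    unfolding circle_fun_def
  proof (rule continuous_map_circle)
    show "continuous_on {0..1} (h x0 k)" unfolding h_def[abs_def] by (intro continuous_intros)
    show "h x0 k 0 = h x0 k 1" by (simp add: h_def)
  qed
  have "\<exists>k. (\<integral>y. h x0 k (y 0) \<partial>\<mu>) < \<epsilon>" if x0: "x0 \<in> {0..<1}" for x0
  proof -
    have hm: "(\<lambda>t. h x0 k (quantile F t)) \<in> borel_measurable Y_measure" for k
      by (rule measurable_compose[OF measurable_quantile[OF F] borel_measurable_circle[OF hc[unfolded circle_fun_def]]])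
    have "(\<lambda>k. \<integral>t. h x0 k (quantile F t) \<partial>Y_measure) \<longlonglongrightarrow> (\<integral>t. 0 \<partial>Y_measure)"
    proof (rule integral_dominated_convergence[where w = "\<lambda>_. 1"])
      show "AE t in Y_measure. (\<lambda>k. h x0 k (quantile F t)) \<longlonglongrightarrow> 0"
      \<comment> \<open>The only parameter whose quantile can be \<open>x0\<close> is
        \<open>F x0\<close>, since \<open>F\<close> inverts the quantile function.\<close>
      proof (rule AE_I[of _ _ "{F x0} \<inter> {0..<1}"])
        show "{F x0} \<inter> {0..<1} \<in> sets Y_measure"
          unfolding sets_Y_measure_restrict sets_restrict_space
          by (rule image_eqI[of _ _ "{F x0}"]) auto
        show "emeasure Y_measure ({F x0} \<inter> {0..<1}) = 0"
          by (cases "F x0 \<in> {0..<1}") (simp_all add: emeasure_Y_measure)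
        have "(\<lambda>k. h x0 k (quantile F t)) \<longlonglongrightarrow> 0" if t: "t \<in> {0..<1}" "t \<noteq> F x0" for t
        proof -
          have q: "quantile F t \<in> {0..<1}" using quantile_bounds[OF F, of t] t by auto
          have "quantile F t \<noteq> x0" using quantile_right_inverse[OF F, of t] t by auto
          then have "0 < norm (circ (quantile F t) - circ x0)"
            using inj_onD[OF inj_on_circ _ q x0] by auto
          then obtain N where N: "1 < real N * norm (circ (quantile F t) - circ x0)"
            using ex_less_of_nat_mult by blast
          have "h x0 k (quantile F t) = 0" if "k \<ge> N" for k
          proof -
            have "real N * norm (circ (quantile F t) - circ x0) \<le> real k * norm (circ (quantile F t) - circ x0)"
              using that by (intro mult_right_mono) auto
            then show ?thesis using N by (simp add: h_def)
          qed
          then have "eventually (\<lambda>k. h x0 k (quantile F t) = 0) sequentially"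
            by (intro eventually_sequentiallyI[of N])
          then show ?thesis by (rule tendsto_eventually)
        qed
        then show "{t \<in> space Y_measure. \<not> (\<lambda>k. h x0 k (quantile F t)) \<longlonglongrightarrow> 0} \<subseteq> {F x0} \<inter> {0..<1}"
          by auto
      qed
    qed (use hm h0 in auto)
    then have "eventually (\<lambda>k. (\<integral>t. h x0 k (quantile F t) \<partial>Y_measure) < \<epsilon>) sequentially"
      by (rule order_tendstoD(2)) (use \<epsilon> in simp)
    then obtain k where "(\<integral>t. h x0 k (quantile F t) \<partial>Y_measure) < \<epsilon>"
      by (auto simp: eventually_sequentially)
    then show ?thesis
      unfolding \<mu>c using integral_coding_zero_coordinate[OF F c, of "h x0 k"] hc[of x0 k]
      by (intro exI[of _ k]) (simp add: circle_fun_def)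
  qed
  then have "\<forall>x0\<in>{0..<1}. \<exists>k. (\<integral>y. h x0 k (y 0) \<partial>\<mu>) < \<epsilon>" by (intro ballI)
  from bchoice[OF this] obtain k where k: "\<forall>x0\<in>{0..<1}. (\<integral>y. h x0 (k x0) (y 0) \<partial>\<mu>) < \<epsilon>" by (elim exE)
  define V where "V x0 = {x \<in> topspace circle. h x0 (k x0) x \<in> {1 / 2<..}}" for x0
  have "openin circle (V x0)" for x0
    unfolding V_def using hc[of x0 "k x0"]
    by (intro openin_continuous_map_preimage[of _ euclideanreal]) (auto simp: circle_fun_def)
  moreover have "topspace circle \<subseteq> \<Union>(V ` {0..<1})"
  proof
    fix x assume "x \<in> topspace circle"
    then have "x \<in> V x" "x \<in> {0..<1}" by (auto simp: V_def h_def)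
    then show "x \<in> \<Union>(V ` {0..<1})" by blast
  qed
  moreover have "compactin circle (topspace circle)"
    using compact_space_circle by (simp add: compact_space_def)
  ultimately obtain \<F> where \<F>: "finite \<F>" "\<F> \<subseteq> V ` {0..<1}" "topspace circle \<subseteq> \<Union>\<F>"
    using compactinD[of circle "topspace circle" "V ` {0..<1}"] by auto
  obtain I where I: "I \<subseteq> {0..<1}" "finite I" "\<F> = V ` I" using finite_subset_image[OF \<F>(1,2)] by auto
  let ?H = "(\<lambda>x0. h x0 (k x0)) ` I"
  have "\<exists>g\<in>?H. 1 / 2 < g x" if "x \<in> {0..<1}" for x
  proof -
    have "x \<in> \<Union>(V ` I)" using \<F>(3) I(3) that by auto
    then show ?thesis by (auto simp: V_def)
  qed
  moreover have "finite ?H" "?H \<subseteq> Collect circle_fun" "\<forall>g\<in>?H. \<forall>x. 0 \<le> g x" using I(2) hc h0 by auto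
  moreover have "\<forall>g\<in>?H. (\<integral>y. g (y 0) \<partial>\<mu>) < \<epsilon>" using k I(1) by auto
  ultimately show "\<mu> \<in> small_atoms \<epsilon>"
    unfolding small_atoms_def using S by (intro UN_I[of ?H]) simp_all
qed

text \<open>The function is replaced by the average of its \<open>n\<close> level set indicators,
  and each indicator by a continuous function of the quantile. Averaging keeps the error at
  \<epsilon>/2 whatever \<open>n\<close> is.\<close>

lemma approximate_function_of_quantile:
  assumes F: "unit_cdf F" and w: "w \<in> borel_measurable Y_measure"
    and w01: "\<And>t. t \<in> {0..<1} \<Longrightarrow> 0 \<le> w t \<and> w t \<le> 1" and \<epsilon>: "0 < (\<epsilon>::real)"
  shows "\<exists>g. circle_fun g \<and> (\<integral>t. \<bar>w t - g (quantile F t)\<bar> \<partial>Y_measure) < \<epsilon>"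
proof -
  interpret prob_space Y_measure by (rule prob_space_Y_measure)
  have \<epsilon>2: "0 < \<epsilon> / 2" using \<epsilon> by simp
  obtain m where "1 / real (Suc m) < \<epsilon> / 2" using nat_approx_posE[OF \<epsilon>2] by auto
  then obtain n where n: "0 < n" "1 / real n < \<epsilon> / 2" by blast
  define E where "E k = {t \<in> {0..<1}. real k / real n \<le> w t}" for k
  have E: "E k \<in> sets Y_measure" for k unfolding E_def by (rule measurable_preimage_level[OF w])
  have "\<exists>g. circle_fun g \<and> (\<forall>x. 0 \<le> g x \<and> g x \<le> 1) \<and>
      (\<integral>t. \<bar>g (quantile F t) - of_bool (t \<in> E k)\<bar> \<partial>Y_measure) \<le> \<epsilon> / 2" for k
  proof -
    obtain g L where g: "0 \<le> L" "\<And>x y. \<bar>g x - g y\<bar> \<le> L * \<bar>x - y\<bar>" "\<forall>x. 0 \<le> g x \<and> g x \<le> 1" "g 0 = g 1"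
      "(\<integral>t. \<bar>g (quantile F t) - of_bool (t \<in> E k)\<bar> \<partial>Y_measure) \<le> \<epsilon> / 2"
      using approximate_indicator[OF F E \<epsilon>2] by blast
    have "circle_fun g" unfolding circle_fun_def
      by (intro continuous_map_circle Lipschitz_imp_continuous_on[OF g(2,1)] g(4))
    then show ?thesis using g(3,5) by blast
  qed
  then obtain g where g: "\<And>k. circle_fun (g k)" "\<And>k x. 0 \<le> g k x \<and> g k x \<le> 1"
    "\<And>k. (\<integral>t. \<bar>g k (quantile F t) - of_bool (t \<in> E k)\<bar> \<partial>Y_measure) \<le> \<epsilon> / 2" by metis
  define G where "G x = (\<Sum>k\<in>{1..n}. g k x) / real n" for x
  have Gc: "circle_fun G"
    using g(1) n(1) unfolding circle_fun_def G_def[abs_def] divide_inverse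
    by (intro continuous_map_real_mult_right continuous_map_sum) auto
  have gm: "(\<lambda>t. g k (quantile F t)) \<in> borel_measurable Y_measure" for k
    using g(1)[of k] by (intro measurable_compose[OF measurable_quantile[OF F] borel_measurable_circle]) (simp add: circle_fun_def)
  have i: "integrable Y_measure (\<lambda>t. \<bar>g k (quantile F t) - of_bool (t \<in> E k)\<bar>)" for k
  proof (rule integrable_Y_measure[where B = 1])
    show "(\<lambda>t. \<bar>g k (quantile F t) - of_bool (t \<in> E k)\<bar>) \<in> borel_measurable Y_measure"
      using gm[of k] borel_measurable_of_bool_mem[OF E[of k]] by measurable
    fix t show "\<bar>\<bar>g k (quantile F t) - of_bool (t \<in> E k)\<bar>\<bar> \<le> 1"
      using g(2)[of k "quantile F t"] by (cases "t \<in> E k") auto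
  qed
  have pt: "\<bar>w t - G (quantile F t)\<bar>
      \<le> 1 / real n + (\<Sum>k\<in>{1..n}. \<bar>g k (quantile F t) - of_bool (t \<in> E k)\<bar>) / real n" if "t \<in> space Y_measure" for t
  proof -
    have t: "t \<in> {0..<1}" using that by simp
    have "\<bar>w t - (\<Sum>k\<in>{1..n}. of_bool (t \<in> E k)) / real n\<bar> \<le> 1 / real n"
      using discretization_error[of "w t" n] w01[OF t] n(1) t by (simp add: E_def)
    moreover have "G (quantile F t) - (\<Sum>k\<in>{1..n}. of_bool (t \<in> E k)) / real n
        = (\<Sum>k\<in>{1..n}. g k (quantile F t) - of_bool (t \<in> E k)) / real n"
      by (simp add: G_def sum_subtractf diff_divide_distrib del: sum_of_bool_eq)
    moreover have "\<bar>(\<Sum>k\<in>{1..n}. g k (quantile F t) - of_bool (t \<in> E k)) / real n\<bar>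
        \<le> (\<Sum>k\<in>{1..n}. \<bar>g k (quantile F t) - of_bool (t \<in> E k)\<bar>) / real n"
      by (simp add: divide_right_mono sum_abs)
    ultimately show ?thesis by linarith
  qed
  have "(\<integral>t. \<bar>w t - G (quantile F t)\<bar> \<partial>Y_measure)
      \<le> (\<integral>t. 1 / real n + (\<Sum>k\<in>{1..n}. \<bar>g k (quantile F t) - of_bool (t \<in> E k)\<bar>) / real n \<partial>Y_measure)"
  proof (rule integral_mono[OF _ _ pt])
    show i2: "integrable Y_measure (\<lambda>t. 1 / real n + (\<Sum>k\<in>{1..n}. \<bar>g k (quantile F t) - of_bool (t \<in> E k)\<bar>) / real n)"
      by (intro Bochner_Integration.integrable_add integrable_divide Bochner_Integration.integrable_sum i) simp
    have "(\<lambda>t. G (quantile F t)) \<in> borel_measurable Y_measure"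
      using Gc by (intro measurable_compose[OF measurable_quantile[OF F] borel_measurable_circle]) (simp add: circle_fun_def)
    then show "integrable Y_measure (\<lambda>t. \<bar>w t - G (quantile F t)\<bar>)"
      using w pt by (intro Bochner_Integration.integrable_bound[OF i2]) (auto intro!: AE_I2 order_trans[OF pt])
  qed
  also have "\<dots> = 1 / real n + (\<Sum>k\<in>{1..n}. \<integral>t. \<bar>g k (quantile F t) - of_bool (t \<in> E k)\<bar> \<partial>Y_measure) / real n"
  proof -
    have "(\<integral>t. 1 / real n + (\<Sum>k\<in>{1..n}. \<bar>g k (quantile F t) - of_bool (t \<in> E k)\<bar>) / real n \<partial>Y_measure)
      = (\<integral>t. 1 / real n \<partial>Y_measure) + (\<integral>t. (\<Sum>k\<in>{1..n}. \<bar>g k (quantile F t) - of_bool (t \<in> E k)\<bar>) / real n \<partial>Y_measure)"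
      by (intro Bochner_Integration.integral_add integrable_divide Bochner_Integration.integrable_sum i) simp
    then show ?thesis using prob_space by (simp add: Bochner_Integration.integral_sum i)
  qed
  also have "\<dots> \<le> 1 / real n + (\<Sum>k\<in>{1..n}. \<epsilon> / 2) / real n"
    using g(3) by (intro add_left_mono divide_right_mono sum_mono) auto
  also have "\<dots> < \<epsilon>" using n by simp
  finally show ?thesis using Gc by blast
qed

text \<open>Under a coding the coordinate at \<gamma> is a measurable function of the parameter
  \<open>t\<close>, and every such function can be approximated through the quantile, that is,
  through the zeroth coordinate.\<close>

lemma coded_measures_subset_nearly_determined:
  assumes u: "circle_fun u" "\<And>x. x \<in> {0..<1} \<Longrightarrow> 0 \<le> u x \<and> u x \<le> 1" and \<epsilon>: "0 < \<epsilon>"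
  shows "(coded_measures :: ('g::{group_add,countable} \<Rightarrow> real) measure set) \<subseteq> nearly_determined \<gamma> u \<epsilon>"
proof
  fix \<mu> :: "('g \<Rightarrow> real) measure" assume \<mu>: "\<mu> \<in> coded_measures"
  then obtain F c where F: "unit_cdf F" and c: "c \<in> Y_actions" and \<mu>c: "\<mu> = coding F c"
    by (auto simp: coded_measures_def coding_map_def cdfs_def)
  have S: "\<mu> \<in> SIM" using \<mu> coded_measures_subset_SIM by blast
  note T = gaction_Y_measureD[OF gaction_rep[OF c]]
  have cu: "continuous_map circle euclideanreal u" using u(1) by (simp add: circle_fun_def)
  let ?w = "\<lambda>t. u (quantile F (rep c \<gamma> t))"
  have "?w \<in> borel_measurable Y_measure"
    by (rule measurable_compose[OF measurable_compose[OF T(3) measurable_quantile[OF F]] borel_measurable_circle[OF cu]])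
  moreover have "0 \<le> ?w t \<and> ?w t \<le> 1" if "t \<in> {0..<1}" for t
    using T(4)[OF that, of \<gamma>] quantile_bounds[OF F, of "rep c \<gamma> t"] by (intro u(2)) auto
  ultimately obtain g where g: "circle_fun g" "(\<integral>t. \<bar>?w t - g (quantile F t)\<bar> \<partial>Y_measure) < \<epsilon>"
    using approximate_function_of_quantile[OF F _ _ \<epsilon>] by blast
  have cg: "continuous_map circle euclideanreal g" using g(1) by (simp add: circle_fun_def)
  have "(\<integral>y. \<bar>u (y \<gamma>) - g (y 0)\<bar> \<partial>\<mu>) < \<epsilon>"
    unfolding \<mu>c integral_coding_pair[OF F c cu cg] by (rule g(2))
  then show "\<mu> \<in> nearly_determined \<gamma> u \<epsilon>"
    unfolding nearly_determined_def using S g(1) by (intro UN_I[of g]) simp_all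
qed

lemma residual_in_coded_measures:
  assumes dense: "\<And>U. openin weak_star_topology U \<Longrightarrow> U \<noteq> {} \<Longrightarrow>
    U \<inter> (coded_measures :: ('g::{group_add,countable} \<Rightarrow> real) measure set) \<noteq> {}"
  shows "residual_in weak_star_topology (coded_measures :: ('g \<Rightarrow> real) measure set)"
proof -
  let ?D = "coded_measures :: ('g \<Rightarrow> real) measure set"
  let ?W = "weak_star_topology :: ('g \<Rightarrow> real) measure topology"
  have nd: "nowhere_dense_in ?W (topspace ?W - V)" if V: "openin ?W V" "?D \<subseteq> V" for V
    unfolding nowhere_dense_in_iff_open_subset
  proof (intro conjI allI impI)
    fix U assume U: "openin ?W U \<and> U \<noteq> {}"
    have "U \<inter> V \<noteq> {}" using dense[of U] U V(2) by blast
    moreover have "openin ?W (U \<inter> V)" using U V(1) by blast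
    ultimately show "\<exists>U'. openin ?W U' \<and> U' \<noteq> {} \<and> U' \<subseteq> U \<and> U' \<inter> (topspace ?W - V) = {}"
      by (intro exI[of _ "U \<inter> V"]) auto
  qed auto
  let ?A = "\<lambda>n. small_atoms (1 / real (Suc n)) :: ('g \<Rightarrow> real) measure set"
  \<comment> \<open>The Boolean selects one of the two separating functions; the index type is
    countable because the group is.\<close>
  let ?B = "\<lambda>i :: nat \<times> 'g \<times> bool. nearly_determined (fst (snd i))
      (if snd (snd i) then fold_circle else left_half) (1 / real (Suc (fst i)))"
  have A: "openin ?W (?A n)" "?D \<subseteq> ?A n" for n
    by (rule openin_small_atoms, rule coded_measures_subset_small_atoms) simp
  have B: "openin ?W (?B i)" "?D \<subseteq> ?B i" for i
  proof -
    show "openin ?W (?B i)"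
      by (rule openin_nearly_determined) (simp add: circle_fun_fold_circle circle_fun_left_half)
    show "?D \<subseteq> ?B i"
      by (rule coded_measures_subset_nearly_determined)
         (auto simp: circle_fun_fold_circle circle_fun_left_half fold_circle_def left_half_def)
  qed
  have "meager_in ?W ((\<Union>n. topspace ?W - ?A n) \<union> (\<Union>i. topspace ?W - ?B i))"
    by (intro meager_in_Un meager_in_UN nowhere_dense_in_imp_meager_in nd A B) auto
  moreover have "topspace ?W - ?D \<subseteq> (\<Union>n. topspace ?W - ?A n) \<union> (\<Union>i. topspace ?W - ?B i)"
  proof (rule subsetI, rule ccontr)
    fix \<mu> assume \<mu>: "\<mu> \<in> topspace ?W - ?D" and n: "\<mu> \<notin> (\<Union>n. topspace ?W - ?A n) \<union> (\<Union>i. topspace ?W - ?B i)"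
    have a: "\<mu> \<in> ?A n" for n using \<mu> n by blast
    have b: "\<mu> \<in> ?B i" for i using \<mu> n by blast
    have "\<mu> \<in> ?D"
    proof (rule coded_measures_if_small_atoms_nearly_determined[OF a])
      fix n \<gamma> and u :: "real \<Rightarrow> real" assume "u \<in> {fold_circle, left_half}"
      then show "\<mu> \<in> nearly_determined \<gamma> u (1 / real (Suc n))"
        using b[of "(n, \<gamma>, True)"] b[of "(n, \<gamma>, False)"] by auto
    qed
    then show False using \<mu> by simp
  qed
  ultimately have "meager_in ?W (topspace ?W - ?D)" by (rule meager_in_subset)
  then show ?thesis using coded_measures_subset_SIM by (simp add: residual_in_def)
qed

section \<open>The codings form a dense set\<close>

text \<open>Base 4 with digits 0 and 1 only: every tail is at most 1/3, so no carry occurs and the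
  digits are read off without the ambiguity of binary expansions.\<close>

definition bit_code :: "(nat \<Rightarrow> bool) \<Rightarrow> real" where
  "bit_code b = (\<Sum>j. of_bool (b j) / 4 ^ Suc j)"

lemma sums_quarter_powers: "(\<lambda>j. 1 / 4 ^ Suc j) sums (1 / 3 :: real)"
proof -
  have "(\<lambda>j. 1 / 4 * (1 / 4) ^ j) sums (1 / 4 * (1 / (1 - 1 / 4)) :: real)"
    by (intro sums_mult geometric_sums) simp
  then show ?thesis by (simp add: power_one_over)
qed

lemma summable_bit_code: "summable (\<lambda>j. of_bool (b j) / 4 ^ Suc j :: real)"
  by (rule summable_comparison_test'[OF sums_summable[OF sums_quarter_powers]]) auto

lemma bit_code_bounds: "0 \<le> bit_code b \<and> bit_code b \<le> 1 / 3"
proof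
  show "0 \<le> bit_code b" unfolding bit_code_def
    by (rule suminf_nonneg[OF summable_bit_code]) simp
  have "bit_code b \<le> (\<Sum>j. 1 / 4 ^ Suc j)"
    unfolding bit_code_def
    by (rule suminf_le[OF _ summable_bit_code sums_summable[OF sums_quarter_powers]]) auto
  then show "bit_code b \<le> 1 / 3" using sums_unique[OF sums_quarter_powers] by simp
qed

lemma bit_code_head: "4 * bit_code b = of_bool (b 0) + bit_code (\<lambda>j. b (Suc j))"
proof -
  have "(\<Sum>j. of_bool (b (Suc j)) / 4 ^ Suc (Suc j) :: real) = bit_code b - of_bool (b 0) / 4 ^ Suc 0"
    unfolding bit_code_def by (rule suminf_split_head[OF summable_bit_code])
  moreover have "(\<Sum>j. of_bool (b (Suc j)) / 4 ^ Suc (Suc j) :: real)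
      = (\<Sum>j. of_bool (b (Suc j)) / 4 ^ Suc j / 4)"
    by simp
  moreover have "\<dots> = bit_code (\<lambda>j. b (Suc j)) / 4"
    unfolding bit_code_def by (rule suminf_divide[OF summable_bit_code])
  ultimately show ?thesis by simp
qed

text \<open>Multiplying by \<open>4 ^ Suc j\<close> turns the earlier digits into multiples of 4,
  puts digit \<open>j\<close> in the units place and leaves a tail below 1 for the floor to remove.
  The parity is therefore that of digit \<open>j\<close>.\<close>

lemma bit_code_digit: "odd \<lfloor>4 ^ Suc j * bit_code b\<rfloor> \<longleftrightarrow> b j"
proof (induction j arbitrary: b)
  case 0
  have "\<lfloor>4 * bit_code b\<rfloor> = of_bool (b 0)"
    unfolding bit_code_head using bit_code_bounds[of "\<lambda>j. b (Suc j)"]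
    by (intro floor_unique) auto
  then show ?case by simp
next
  case (Suc j)
  let ?z = "4 ^ Suc j * of_bool (b 0) :: int"
  have "4 ^ Suc (Suc j) * bit_code b = 4 ^ Suc j * (4 * bit_code b)" by simp
  also have "\<dots> = of_int ?z + 4 ^ Suc j * bit_code (\<lambda>j. b (Suc j))"
    unfolding bit_code_head by (simp add: distrib_left)
  finally have e: "4 ^ Suc (Suc j) * bit_code b = of_int ?z + 4 ^ Suc j * bit_code (\<lambda>j. b (Suc j))" .
  have "\<lfloor>4 ^ Suc (Suc j) * bit_code b\<rfloor> = ?z + \<lfloor>4 ^ Suc j * bit_code (\<lambda>j. b (Suc j))\<rfloor>"
    unfolding e by (rule int_add_floor[symmetric])
  moreover have "even ?z" by simp
  ultimately show ?case using Suc.IH[of "\<lambda>j. b (Suc j)"] by (simp only: even_add simp_thms)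
qed

lemma borel_measurable_bit_code:
  assumes "\<And>j. {x \<in> space M. b j x} \<in> sets M"
  shows "(\<lambda>x. bit_code (\<lambda>j. b j x)) \<in> borel_measurable M"
  unfolding bit_code_def
proof (rule borel_measurable_suminf)
  fix j
  have "(\<lambda>x. indicator {x \<in> space M. b j x} x / 4 ^ Suc j :: real) \<in> borel_measurable M"
    using assms[of j] by (intro borel_measurable_divide borel_measurable_indicator) auto
  then show "(\<lambda>x. of_bool (b j x) / 4 ^ Suc j :: real) \<in> borel_measurable M"
    by (rule measurable_cong[THEN iffD1, rotated]) (simp add: indicator_def)
qed

text \<open>A point \<open>(y, s)\<close> is described by the countably many bits \<open>y g < q\<close> and \<open>s < q\<close>; the shift
  merely relabels these bits. The extra real \<open>s\<close> removes the atoms.\<close>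

fun threshold :: "'g option \<times> rat \<Rightarrow> ('g \<Rightarrow> real) \<times> real \<Rightarrow> bool" where
  "threshold (Some g, q) (y, s) \<longleftrightarrow> y g < of_rat q"
| "threshold (None, q) (y, s) \<longleftrightarrow> s < of_rat q"

fun relabel :: "'g::plus \<Rightarrow> 'g option \<times> rat \<Rightarrow> 'g option \<times> rat" where
  "relabel \<gamma> (Some g, q) = (Some (g + \<gamma>), q)"
| "relabel \<gamma> (None, q) = (None, q)"

definition point_code :: "('g::countable \<Rightarrow> real) \<times> real \<Rightarrow> real" where
  "point_code z = bit_code (\<lambda>j. threshold (from_nat j) z)"

text \<open>The coordinate is rounded down to a multiple of \<open>1 / n\<close>, and the code of
  the whole point is hidden in the remaining fraction. The rounding is a count of thresholds
  \<open>k / n\<close> because each of them is one of the coded bits, which lets a decoder compute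
  it for every translate.\<close>

definition coded_coordinate :: "nat \<Rightarrow> ('g::{group_add,countable} \<Rightarrow> real) \<times> real \<Rightarrow> real" where
  "coded_coordinate n z = ((\<Sum>k\<in>{1..n}. of_bool (real k / real n \<le> fst z 0)) + point_code z) / real n"

definition shift_fst :: "'g::group_add \<Rightarrow> ('g \<Rightarrow> real) \<times> real \<Rightarrow> ('g \<Rightarrow> real) \<times> real" where
  "shift_fst \<gamma> z = (coord_shift \<gamma> (fst z), snd z)"

lemma threshold_shift: "threshold i (shift_fst \<gamma> z) \<longleftrightarrow> threshold (relabel \<gamma> i) z"
  by (cases "(\<gamma>, i)" rule: relabel.cases; cases z) (simp_all add: shift_fst_def coord_shift_def)

lemma of_bool_sum_Ints: "(\<Sum>k\<in>A. of_bool (P k)) \<in> (\<int> :: real set)"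
  by (intro Ints_sum) simp

lemma frac_coded_coordinate:
  assumes "0 < n"
  shows "frac (real n * coded_coordinate n z) = point_code z"
  unfolding frac_unique_iff
proof (intro conjI)
  have "real n * coded_coordinate n z - point_code z = (\<Sum>k\<in>{1..n}. of_bool (real k / real n \<le> fst z 0))"
    using assms by (simp add: coded_coordinate_def del: sum_of_bool_eq)
  then show "real n * coded_coordinate n z - point_code z \<in> \<int>" by (simp only: of_bool_sum_Ints)
  show "0 \<le> point_code z" "point_code z < 1"
    using bit_code_bounds[of "\<lambda>j. threshold (from_nat j) z"] by (auto simp: point_code_def)
qed

lemma threshold_coded_coordinate:
  assumes "0 < n"
  shows "threshold i z \<longleftrightarrow> odd \<lfloor>4 ^ Suc (to_nat i) * frac (real n * coded_coordinate n z)\<rfloor>"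
  unfolding frac_coded_coordinate[OF assms] point_code_def bit_code_digit by simp

lemma coded_coordinate_bounds:
  assumes n: "0 < n" and z: "0 \<le> fst z 0" "fst z 0 < 1"
  shows "0 \<le> coded_coordinate n z" "coded_coordinate n z < 1" "\<bar>coded_coordinate n z - fst z 0\<bar> \<le> 2 / real n"
proof -
  have c: "0 \<le> point_code z" "point_code z \<le> 1 / 3"
    using bit_code_bounds[of "\<lambda>j. threshold (from_nat j) z"] by (auto simp: point_code_def)
  let ?S = "\<Sum>k\<in>{1..n}. of_bool (real k / real n \<le> fst z 0) :: real"
  have "0 \<le> ?S" by (intro sum_nonneg) simp
  then show "0 \<le> coded_coordinate n z" using c n unfolding coded_coordinate_def by (intro divide_nonneg_nonneg) auto
  \<comment> \<open>The summand \<open>k = n\<close> vanishes as the coordinate is below 1; this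
    leaves room for the code below the upper end.\<close>
  have "?S = (\<Sum>k\<in>{1..<n}. of_bool (real k / real n \<le> fst z 0))"
    using z n by (intro sum.mono_neutral_right) auto
  also have "\<dots> \<le> (\<Sum>k\<in>{1..<n}. 1)" by (intro sum_mono) simp
  also have "\<dots> = real n - 1" using n by simp
  finally have "?S + point_code z < real n" using c by linarith
  then show "coded_coordinate n z < 1" using n unfolding coded_coordinate_def by (simp add: divide_less_eq del: sum_of_bool_eq)
  have "\<bar>fst z 0 - ?S / real n\<bar> \<le> 1 / real n" by (rule discretization_error) (use z n in auto)
  moreover have "0 \<le> point_code z / real n" "point_code z / real n \<le> 1 / real n"
    using c n by (auto intro!: divide_right_mono)
  moreover have "coded_coordinate n z = ?S / real n + point_code z / real n"
    by (simp only: coded_coordinate_def add_divide_distrib)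
  ultimately show "\<bar>coded_coordinate n z - fst z 0\<bar> \<le> 2 / real n" unfolding abs_le_iff by simp
qed

text \<open>The decoder reads off the bits of \<open>z\<close> from \<open>w = coded_coordinate n z\<close> and re-assembles the
  coordinate of the shifted point.\<close>

definition decode_shift :: "nat \<Rightarrow> 'g::{group_add,countable} \<Rightarrow> real \<Rightarrow> real" where
  "decode_shift n \<gamma> w = clip (((\<Sum>k\<in>{1..n}. of_bool (even \<lfloor>4 ^ Suc (to_nat (Some \<gamma>, of_nat k / of_nat n :: rat)) * frac (real n * w)\<rfloor>))
     + bit_code (\<lambda>j. odd \<lfloor>4 ^ Suc (to_nat (relabel \<gamma> (from_nat j))) * frac (real n * w)\<rfloor>)) / real n)"

lemma measurable_odd_floor:
  "{w \<in> space Y_measure. odd \<lfloor>a * frac (b * w)\<rfloor>} \<in> sets Y_measure"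
proof -
  have "(\<lambda>w :: real. a * (b * w - of_int \<lfloor>b * w\<rfloor>)) \<in> borel_measurable borel" by measurable
  then have "(\<lambda>w :: real. \<lfloor>a * frac (b * w)\<rfloor>) \<in> borel \<rightarrow>\<^sub>M count_space UNIV"
    unfolding frac_def by (rule measurable_compose[OF _ measurable_real_floor])
  then have "(\<lambda>w. \<lfloor>a * frac (b * w)\<rfloor>) -` {z. odd z} \<inter> space borel \<in> sets borel"
    by (rule measurable_sets) simp
  then show ?thesis
    unfolding sets_Y_measure_restrict sets_restrict_space
    by (intro image_eqI[of _ _ "(\<lambda>w. \<lfloor>a * frac (b * w)\<rfloor>) -` {z. odd z} \<inter> space borel"]) auto
qed

lemma measurable_decode_shift: "decode_shift n \<gamma> \<in> Y_measure \<rightarrow>\<^sub>M Y_measure"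
proof -
  have 1: "(\<lambda>w. bit_code (\<lambda>j. odd \<lfloor>4 ^ Suc (to_nat (relabel \<gamma> (from_nat j))) * frac (real n * w)\<rfloor>)) \<in> borel_measurable Y_measure"
    by (rule borel_measurable_bit_code) (rule measurable_odd_floor)
  have 2: "(\<lambda>w. of_bool (even \<lfloor>a * frac (real n * w)\<rfloor>) :: real) \<in> borel_measurable Y_measure" for a
  proof -
    have "(\<lambda>w. 1 - indicator {w \<in> space Y_measure. odd \<lfloor>a * frac (real n * w)\<rfloor>} w :: real) \<in> borel_measurable Y_measure"
      using measurable_odd_floor[of a "real n"] by (intro borel_measurable_diff borel_measurable_indicator) auto
    then show ?thesis
      by (rule measurable_cong[THEN iffD1, rotated]) (simp add: indicator_def)
  qed
  have "(\<lambda>w. ((\<Sum>k\<in>{1..n}. of_bool (even \<lfloor>4 ^ Suc (to_nat (Some \<gamma>, of_nat k / of_nat n :: rat)) * frac (real n * w)\<rfloor>))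
     + bit_code (\<lambda>j. odd \<lfloor>4 ^ Suc (to_nat (relabel \<gamma> (from_nat j))) * frac (real n * w)\<rfloor>)) / real n) \<in> borel_measurable Y_measure"
    by (intro borel_measurable_divide borel_measurable_add borel_measurable_sum 1 2) simp
  from measurable_compose[OF this measurable_clip]
  show ?thesis unfolding measurable_Y_measure_iff decode_shift_def[abs_def] by (auto simp: clip_def)
qed

text \<open>Both parts of the coded coordinate of the shifted point depend on bits of
  \<open>z\<close> only: the rounding on thresholds at \<gamma>, the code on relabelled bits. All
  bits of \<open>z\<close> can be read from its coded coordinate.\<close>

lemma decode_shift_coded_coordinate:
  assumes n: "0 < n" and z: "z \<in> topspace Y_hat \<times> {0..<1}"
  shows "coded_coordinate n (shift_fst \<gamma> z) = decode_shift n \<gamma> (coded_coordinate n z)"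
proof -
  \<comment> \<open>The bit stores a strict inequality below the threshold, whereas the rounding
    counts thresholds reached; hence \<open>even\<close>.\<close>
  have b: "even \<lfloor>4 ^ Suc (to_nat (Some \<gamma>, of_nat k / of_nat n :: rat)) * frac (real n * coded_coordinate n z)\<rfloor>
      \<longleftrightarrow> real k / real n \<le> fst (shift_fst \<gamma> z) 0" for k
    using threshold_coded_coordinate[OF n, of "(Some \<gamma>, of_nat k / of_nat n)" z]
    by (cases z) (auto simp: shift_fst_def coord_shift_def of_rat_divide not_less)
  have p: "bit_code (\<lambda>j. odd \<lfloor>4 ^ Suc (to_nat (relabel \<gamma> (from_nat j))) * frac (real n * coded_coordinate n z)\<rfloor>)
      = point_code (shift_fst \<gamma> z)"
    unfolding point_code_def threshold_shift
    by (rule arg_cong[of _ _ bit_code], rule ext) (rule threshold_coded_coordinate[OF n, symmetric])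
  have "0 \<le> fst (shift_fst \<gamma> z) 0" "fst (shift_fst \<gamma> z) 0 < 1"
    using z by (auto simp: mem_topspace_Y_hat mem_Times_iff shift_fst_def coord_shift_def)
  from coded_coordinate_bounds(1,2)[OF n this] show ?thesis
    unfolding decode_shift_def b p coded_coordinate_def[symmetric] by simp
qed

text \<open>The bits labelled \<open>None\<close> locate the extra real among the rationals. Level
  sets of the coded coordinate thus lie in slices with fixed second component, which are
  null.\<close>

lemma coded_coordinate_determines_snd:
  fixes z z' :: "('g::{group_add,countable} \<Rightarrow> real) \<times> real"
  assumes n: "0 < n" and eq: "coded_coordinate n z = coded_coordinate n z'"
  shows "snd z = snd z'"
proof (rule ccontr)
  have t: "threshold i z \<longleftrightarrow> threshold i z'" for i
    unfolding threshold_coded_coordinate[OF n] eq ..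
  have t': "snd z < of_rat q \<longleftrightarrow> snd z' < of_rat q" for q
    using t[of "(None, q)"] by (cases z; cases z') simp
  assume "snd z \<noteq> snd z'"
  then consider "snd z < snd z'" | "snd z' < snd z" by linarith
  then show False
  proof cases
    case 1
    obtain q where "snd z < of_rat q" "of_rat q < snd z'" using of_rat_dense[OF 1] by auto
    then show False using t'[of q] by simp
  next
    case 2
    obtain q where "snd z' < of_rat q" "of_rat q < snd z" using of_rat_dense[OF 2] by auto
    then show False using t'[of q] by simp
  qed
qed

section \<open>Approximating an invariant measure by codings\<close>

definition coded_approximation :: "nat \<Rightarrow> ('g::{group_add,countable} \<Rightarrow> real) measure \<Rightarrow> ('g \<Rightarrow> real) measure" where
  "coded_approximation n \<mu> = distr (\<mu> \<Otimes>\<^sub>M Y_measure) (borel_of Y_hat) (\<lambda>z g. coded_coordinate n (shift_fst g z))"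

lemma shift_fst_preserving:
  assumes \<mu>: "\<mu> \<in> SIM"
  shows "measure_preserving (\<mu> \<Otimes>\<^sub>M Y_measure) (\<mu> \<Otimes>\<^sub>M Y_measure) (shift_fst \<gamma>)"
proof -
  interpret Y: prob_space Y_measure by (rule prob_space_Y_measure)
  have S: "coord_shift \<gamma> \<in> \<mu> \<rightarrow>\<^sub>M \<mu>" "distr \<mu> \<mu> (coord_shift \<gamma>) = \<mu>"
    using SIM_D(3)[OF \<mu>, of \<gamma>] by (auto simp: measure_preserving_def)
  have eq: "shift_fst \<gamma> = (\<lambda>(x, y). (coord_shift \<gamma> x, y))" by (auto simp: shift_fst_def)
  have d: "distr Y_measure Y_measure (\<lambda>y. y) = Y_measure" by (simp add: distr_id2)
  have "distr \<mu> \<mu> (coord_shift \<gamma>) \<Otimes>\<^sub>M distr Y_measure Y_measure (\<lambda>y. y)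
      = distr (\<mu> \<Otimes>\<^sub>M Y_measure) (\<mu> \<Otimes>\<^sub>M Y_measure) (\<lambda>(x, y). (coord_shift \<gamma> x, y))"
    by (rule pair_measure_distr[OF S(1) measurable_ident_sets[OF refl]])
       (unfold d, rule Y.sigma_finite_measure_axioms)
  then have "distr (\<mu> \<Otimes>\<^sub>M Y_measure) (\<mu> \<Otimes>\<^sub>M Y_measure) (shift_fst \<gamma>) = \<mu> \<Otimes>\<^sub>M Y_measure"
    unfolding eq S(2) d by simp
  moreover have "shift_fst \<gamma> \<in> \<mu> \<Otimes>\<^sub>M Y_measure \<rightarrow>\<^sub>M \<mu> \<Otimes>\<^sub>M Y_measure"
    unfolding shift_fst_def[abs_def]
    by (intro measurable_Pair measurable_compose[OF measurable_fst S(1)] measurable_snd)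
  ultimately show ?thesis by (simp add: measure_preserving_def)
qed

lemma measurable_coded_coordinate:
  assumes \<mu>: "\<mu> \<in> SIM" and n: "0 < n"
  shows "coded_coordinate n \<in> \<mu> \<Otimes>\<^sub>M Y_measure \<rightarrow>\<^sub>M Y_measure"
proof -
  let ?M = "\<mu> \<Otimes>\<^sub>M Y_measure"
  have c: "(\<lambda>z. fst z g) \<in> borel_measurable ?M" for g
    by (rule measurable_compose[OF measurable_fst measurable_SIM_coordinate(2)[OF \<mu>]])
  have s: "snd \<in> borel_measurable ?M"
    using measurable_snd[of \<mu> Y_measure] by (simp add: measurable_Y_measure_iff)
  have "{z \<in> space ?M. threshold i z} \<in> sets ?M" for i
  proof (cases i)
    case (Pair o' q)
    show ?thesis
    proof (cases o')
      case None
      have "{z \<in> space ?M. snd z < of_rat q} \<in> sets ?M" using s by measurable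
      moreover have "threshold i z \<longleftrightarrow> snd z < of_rat q" for z using Pair None by (cases z) simp
      ultimately show ?thesis by simp
    next
      case (Some g)
      have "{z \<in> space ?M. fst z g < of_rat q} \<in> sets ?M" using c[of g] by measurable
      moreover have "threshold i z \<longleftrightarrow> fst z g < of_rat q" for z using Pair Some by (cases z) simp
      ultimately show ?thesis by simp
    qed
  qed
  then have 1: "point_code \<in> borel_measurable ?M"
    unfolding point_code_def[abs_def] by (intro borel_measurable_bit_code)
  have 2: "(\<lambda>z. of_bool (a \<le> fst z 0) :: real) \<in> borel_measurable ?M" for a
  proof -
    have "{z \<in> space ?M. a \<le> fst z 0} \<in> sets ?M" using c[of 0] by measurable
    then have "(\<lambda>z. indicator {z \<in> space ?M. a \<le> fst z 0} z :: real) \<in> borel_measurable ?M" by simp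
    then show ?thesis by (rule measurable_cong[THEN iffD1, rotated]) (simp add: indicator_def)
  qed
  have "coded_coordinate n \<in> borel_measurable ?M"
    unfolding coded_coordinate_def[abs_def]
    by (intro borel_measurable_divide borel_measurable_add borel_measurable_sum 1 2) simp
  moreover have "coded_coordinate n z \<in> {0..<1}" if "z \<in> space ?M" for z
    using coded_coordinate_bounds(1,2)[OF n, of z] that SIM_D(4)[OF \<mu>]
    by (auto simp: space_pair_measure mem_topspace_Y_hat)
  ultimately show ?thesis by (auto simp: measurable_Y_measure_iff)
qed

lemma measurable_coded_name:
  fixes \<mu> :: "('g::{group_add,countable} \<Rightarrow> real) measure"
  assumes \<mu>: "\<mu> \<in> SIM" and n: "0 < n"
  shows "(\<lambda>z g. coded_coordinate n (shift_fst g z)) \<in> \<mu> \<Otimes>\<^sub>M Y_measure \<rightarrow>\<^sub>M borel_of Y_hat"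
proof (rule measurable_into_Y_hat)
  fix g
  have "shift_fst g \<in> \<mu> \<Otimes>\<^sub>M Y_measure \<rightarrow>\<^sub>M \<mu> \<Otimes>\<^sub>M Y_measure"
    using shift_fst_preserving[OF \<mu>] by (simp add: measure_preserving_def)
  then show "(\<lambda>z. coded_coordinate n (shift_fst g z)) \<in> \<mu> \<Otimes>\<^sub>M Y_measure \<rightarrow>\<^sub>M Y_measure"
    by (rule measurable_compose[OF _ measurable_coded_coordinate[OF \<mu> n]])
qed

lemma shift_fst_zero: "shift_fst 0 z = z"
  by (simp add: shift_fst_def coord_shift_def)

text \<open>The criterion for codings applies: a level set of the zeroth coordinate lies in a null
  slice, and \<open>decode_shift\<close> expresses the other coordinates through the zeroth
  one.\<close>

lemma coded_approximation_coded:
  fixes \<mu> :: "('g::{group_add,countable} \<Rightarrow> real) measure"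
  assumes \<mu>: "\<mu> \<in> SIM" and n: "0 < n"
  shows "coded_approximation n \<mu> \<in> coded_measures"
proof (rule coded_measuresI)
  let ?M = "\<mu> \<Otimes>\<^sub>M Y_measure" and ?n = "\<lambda>z g. coded_coordinate n (shift_fst g z)"
  interpret \<mu>: prob_space \<mu> by (rule SIM_D(2)[OF \<mu>])
  interpret Y: prob_space Y_measure by (rule prob_space_Y_measure)
  interpret P: pair_prob_space \<mu> Y_measure ..
  note nm = measurable_coded_name[OF \<mu> n]
  have spM: "space ?M = topspace Y_hat \<times> {0..<1}" by (simp add: space_pair_measure SIM_D(4)[OF \<mu>])
  show S: "coded_approximation n \<mu> \<in> SIM"
    unfolding coded_approximation_def
  proof (rule distr_name_in_SIM[OF P.prob_space_axioms shift_fst_preserving[OF \<mu>] _ measurable_coded_coordinate[OF \<mu> n]])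
    show "AE x in ?M. shift_fst (b + a) x = shift_fst b (shift_fst a x)" for a b
      by (rule AE_I2) (simp add: shift_fst_def coord_shift_coord_shift)
  qed
  note cm = measurable_coordinate[of "0 :: 'g"] measurable_coordinate_real
  show "measure (coded_approximation n \<mu>) {y \<in> space (coded_approximation n \<mu>). y 0 = x} = 0" for x
  proof -
    let ?A = "{y \<in> space (borel_of Y_hat). y (0 :: 'g) = x}"
    have A: "?A \<in> sets (borel_of Y_hat)" using measurable_coordinate_real[of "0 :: 'g"] by measurable
    have sp: "space (coded_approximation n \<mu>) = space (borel_of Y_hat)" by (simp add: coded_approximation_def)
    have "measure (coded_approximation n \<mu>) ?A = measure ?M (?n -` ?A \<inter> space ?M)"
      unfolding coded_approximation_def by (rule measure_distr[OF nm A])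
    also have "\<dots> = 0"
    proof (cases "?n -` ?A \<inter> space ?M = {}")
      case False
      then obtain z0 where z0: "z0 \<in> space ?M" "coded_coordinate n z0 = x" by (auto simp: shift_fst_zero)
      let ?B = "topspace Y_hat \<times> {snd z0}"
      have s0: "{snd z0} \<in> sets Y_measure"
        using z0(1) unfolding sets_Y_measure_restrict sets_restrict_space spM
        by (intro image_eqI[of _ _ "{snd z0}"]) auto
      have t: "topspace Y_hat \<in> sets \<mu>" unfolding SIM_D(4)[OF \<mu>, symmetric] by (rule sets.top)
      have sub: "?n -` ?A \<inter> space ?M \<subseteq> ?B"
      proof
        fix z assume z: "z \<in> ?n -` ?A \<inter> space ?M"
        then have "coded_coordinate n z = coded_coordinate n z0" using z0(2) by (simp add: shift_fst_zero)
        then have "snd z = snd z0" by (rule coded_coordinate_determines_snd[OF n])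
        then show "z \<in> ?B" using z unfolding spM by (auto simp: mem_Times_iff)
      qed
      have "emeasure Y_measure {snd z0} = 0"
        using z0(1) unfolding spM by (subst emeasure_Y_measure) auto
      then have "emeasure ?M ?B = 0" by (simp add: Y.emeasure_pair_measure_Times[OF t s0])
      then have "measure ?M ?B = 0" by (simp add: measure_def)
      moreover have "measure ?M (?n -` ?A \<inter> space ?M) \<le> measure ?M ?B"
        by (rule P.finite_measure_mono[OF sub]) (intro pair_measureI t s0)
      ultimately show ?thesis using measure_nonneg[of ?M "?n -` ?A \<inter> space ?M"] by linarith
    qed simp
    finally show ?thesis unfolding sp .
  qed
  show "\<exists>\<phi>. \<phi> \<in> Y_measure \<rightarrow>\<^sub>M Y_measure \<and> (AE y in coded_approximation n \<mu>. y \<gamma> = \<phi> (y 0))" for \<gamma>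
  proof (intro exI conjI)
    show "decode_shift n \<gamma> \<in> Y_measure \<rightarrow>\<^sub>M Y_measure" by (rule measurable_decode_shift)
    have P: "{y \<in> space (borel_of Y_hat). y \<gamma> = decode_shift n \<gamma> (y 0)} \<in> sets (borel_of Y_hat)"
    proof (rule AE_eq_real_measurable[OF measurable_coordinate_real])
      show "(\<lambda>y. decode_shift n \<gamma> (y (0 :: 'g))) \<in> borel_measurable (borel_of Y_hat)"
        using measurable_compose[OF cm(1) measurable_decode_shift[of n \<gamma>]]
        by (simp add: measurable_Y_measure_iff)
    qed
    show "AE y in coded_approximation n \<mu>. y \<gamma> = decode_shift n \<gamma> (y 0)"
      unfolding coded_approximation_def AE_distr_iff[OF nm P]
      by (rule AE_I2) (simp add: shift_fst_zero decode_shift_coded_coordinate[OF n] spM)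
  qed
qed

text \<open>Every coordinate moves by at most \<open>2 / n\<close>, uniformly in the point, so the
  modulus of a continuous function bounds the change of its integral.\<close>

lemma coded_approximation_limit:
  fixes \<mu> :: "('g::{group_add,countable} \<Rightarrow> real) measure"
  assumes \<mu>: "\<mu> \<in> SIM"
  shows "limitin weak_star_topology (\<lambda>n. coded_approximation (Suc n) \<mu>) \<mu> sequentially"
  unfolding limitin_weak_star_topology
proof (intro conjI allI impI \<mu> always_eventually)
  show "coded_approximation (Suc n) \<mu> \<in> SIM" for n
    using coded_approximation_coded[OF \<mu>] coded_measures_subset_SIM by blast
  let ?M = "\<mu> \<Otimes>\<^sub>M Y_measure" and ?n = "\<lambda>n z g. coded_coordinate (Suc n) (shift_fst g z)"
  interpret \<mu>: prob_space \<mu> by (rule SIM_D(2)[OF \<mu>])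
  interpret Y: prob_space Y_measure by (rule prob_space_Y_measure)
  interpret P: pair_prob_space \<mu> Y_measure ..
  have spM: "space ?M = topspace Y_hat \<times> {0..<1}" by (simp add: space_pair_measure SIM_D(4)[OF \<mu>])
  fix f :: "('g \<Rightarrow> real) \<Rightarrow> real" assume f: "continuous_map Y_hat euclideanreal f"
  have fm: "f \<in> borel_measurable (borel_of Y_hat)" by (rule borel_measurable_continuous_map[OF f])
  have f\<mu>: "f \<in> borel_measurable \<mu>" using fm by (simp add: measurable_cong_sets[OF SIM_D(1)[OF \<mu>] refl])
  obtain Bd where Bd: "\<And>y. y \<in> topspace Y_hat \<Longrightarrow> \<bar>f y\<bar> \<le> Bd"
    using continuous_map_bounded[OF compact_space_Y_hat f] by blast
  have close: "\<bar>?n n z g - fst z g\<bar> \<le> 2 / real (Suc n)" "0 \<le> ?n n z g \<and> ?n n z g < 1"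
    if "z \<in> space ?M" for n z g
  proof -
    have "0 \<le> fst (shift_fst g z) 0" "fst (shift_fst g z) 0 < 1"
      using that unfolding spM by (auto simp: mem_topspace_Y_hat mem_Times_iff shift_fst_def coord_shift_def)
    from coded_coordinate_bounds[OF zero_less_Suc this, of n]
    show "\<bar>?n n z g - fst z g\<bar> \<le> 2 / real (Suc n)" "0 \<le> ?n n z g \<and> ?n n z g < 1"
      by (auto simp: shift_fst_def coord_shift_def)
  qed
  have top: "?n n z \<in> topspace Y_hat" "fst z \<in> topspace Y_hat" if "z \<in> space ?M" for n z
    using close(2)[OF that] that spM by (auto simp: mem_topspace_Y_hat mem_Times_iff)
  have i0: "integrable ?M (\<lambda>z. f (fst z))"
    using measurable_compose[OF measurable_fst f\<mu>] Bd top(2)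
    by (intro P.integrable_const_bound[where B = Bd]) auto
  have i1: "integrable ?M (\<lambda>z. f (?n n z))" for n
    using measurable_compose[OF measurable_coded_name[OF \<mu> zero_less_Suc] fm] Bd top(1)
    by (intro P.integrable_const_bound[where B = Bd]) auto
  have e0: "(\<integral>y. f y \<partial>\<mu>) = (\<integral>z. f (fst z) \<partial>?M)"
    using integral_distr[OF measurable_fst f\<mu>, of Y_measure] by (simp add: Y.distr_pair_fst)
  have e1: "(\<integral>y. f y \<partial>coded_approximation (Suc n) \<mu>) = (\<integral>z. f (?n n z) \<partial>?M)" for n
    unfolding coded_approximation_def
    by (rule integral_distr[OF measurable_coded_name[OF \<mu> zero_less_Suc] fm])
  show "(\<lambda>n. \<integral>y. f y \<partial>coded_approximation (Suc n) \<mu>) \<longlonglongrightarrow> (\<integral>y. f y \<partial>\<mu>)"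
  proof (rule tendstoI)
    fix \<epsilon> :: real assume \<epsilon>: "0 < \<epsilon>"
    obtain G C where G: "finite G" "0 \<le> C" "\<And>x y. x \<in> topspace Y_hat \<Longrightarrow> y \<in> topspace Y_hat \<Longrightarrow>
        \<bar>f x - f y\<bar> \<le> \<epsilon> / 2 + C * (\<Sum>g\<in>G. \<bar>x g - y g\<bar>)"
      using continuous_Y_hat_modulus[OF f, of "\<epsilon> / 2"] \<epsilon> by auto
    have "(\<lambda>n. C * (\<Sum>g\<in>G. 2 * inverse (real (Suc n)))) \<longlonglongrightarrow> C * (\<Sum>g\<in>G. 2 * 0)"
      by (intro tendsto_mult_left tendsto_sum LIMSEQ_inverse_real_of_nat)
    then have "eventually (\<lambda>n. C * (\<Sum>g\<in>G. 2 * inverse (real (Suc n))) < \<epsilon> / 2) sequentially"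
      by (rule order_tendstoD(2)) (use \<epsilon> in simp)
    then show "eventually (\<lambda>n. dist (\<integral>y. f y \<partial>coded_approximation (Suc n) \<mu>) (\<integral>y. f y \<partial>\<mu>) < \<epsilon>) sequentially"
    proof eventually_elim
      case (elim n)
      have "\<bar>(\<integral>z. f (?n n z) \<partial>?M) - (\<integral>z. f (fst z) \<partial>?M)\<bar> = \<bar>\<integral>z. f (?n n z) - f (fst z) \<partial>?M\<bar>"
        using i0 i1 by simp
      also have "\<dots> \<le> (\<integral>z. \<bar>f (?n n z) - f (fst z)\<bar> \<partial>?M)" by (rule integral_abs_bound)
      also have "\<dots> \<le> (\<integral>z. \<epsilon> / 2 + C * (\<Sum>g\<in>G. 2 / real (Suc n)) \<partial>?M)"
      proof (rule integral_mono)
        show "integrable ?M (\<lambda>z. \<bar>f (?n n z) - f (fst z)\<bar>)" using i0 i1 by auto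
        fix z assume z: "z \<in> space ?M"
        have "(\<Sum>g\<in>G. \<bar>?n n z g - fst z g\<bar>) \<le> (\<Sum>g\<in>G. 2 / real (Suc n))"
          by (rule sum_mono) (rule close(1)[OF z])
        from mult_left_mono[OF this G(2)] G(3)[OF top(1)[OF z] top(2)[OF z], of n]
        show "\<bar>f (?n n z) - f (fst z)\<bar> \<le> \<epsilon> / 2 + C * (\<Sum>g\<in>G. 2 / real (Suc n))"
          by linarith
      qed (rule P.integrable_const)
      also have "\<dots> = \<epsilon> / 2 + C * (\<Sum>g\<in>G. 2 / real (Suc n))"
        by (simp only: lebesgue_integral_const P.prob_space scaleR_one)
      also have "\<dots> < \<epsilon>" using elim unfolding divide_inverse[of 2 "real (Suc n)", symmetric] by linarith
      finally show ?case unfolding e0 e1 by (simp add: dist_real_def)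
    qed
  qed
qed

lemma dense_coded_measures:
  assumes "openin weak_star_topology U" "U \<noteq> {}"
  shows "U \<inter> (coded_measures :: ('g::{group_add,countable} \<Rightarrow> real) measure set) \<noteq> {}"
proof -
  obtain \<mu> where \<mu>: "\<mu> \<in> U" using assms(2) by auto
  then have S: "\<mu> \<in> SIM" using openin_subset[OF assms(1)] by auto
  have "eventually (\<lambda>n. coded_approximation (Suc n) \<mu> \<in> U) sequentially"
    using coded_approximation_limit[OF S] assms(1) \<mu> unfolding limitin_def by blast
  then obtain n where "coded_approximation (Suc n) \<mu> \<in> U" by (auto simp: eventually_sequentially)
  then show ?thesis using coded_approximation_coded[OF S, of "Suc n"] by auto
qed

section \<open>The space of distribution functions\<close>

lemma unit_cdf_ident: "unit_cdf (\<lambda>x. max 0 (min 1 x))"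
  by (auto simp: unit_cdf_def mono_def intro!: continuous_intros)

lemma cdfs_nonempty: "cdfs \<noteq> {}"
proof -
  let ?F = "\<lambda>x :: real. max 0 (min 1 x)"
  have "?F \<in> bcontfun" by (rule bcontfun_normI[of _ 1]) (auto intro!: continuous_intros)
  then have "apply_bcontfun (Bcontfun ?F) = ?F" by (rule Bcontfun_inverse)
  then have "Bcontfun ?F \<in> cdfs" using unit_cdf_ident by (simp add: cdfs_def)
  then show ?thesis by blast
qed

lemma closed_cdfs: "closed cdfs"
  unfolding closed_sequential_limits
proof (intro allI impI, elim conjE)
  fix F :: "nat \<Rightarrow> real \<Rightarrow>\<^sub>C real" and G
  assume F: "\<forall>n. F n \<in> cdfs" and lim: "F \<longlonglongrightarrow> G"
  have pt: "(\<lambda>n. F n x) \<longlonglongrightarrow> G x" for x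
  proof (rule tendstoI)
    fix e :: real assume "0 < e"
    from tendstoD[OF lim this] show "eventually (\<lambda>n. dist (F n x) (G x) < e) sequentially"
      by eventually_elim (rule dist_fun_lt_imp_dist_val_lt)
  qed
  have u: "unit_cdf (apply_bcontfun (F n))" for n using F by (simp add: cdfs_def)
  have "G x \<le> G y" if "x \<le> y" for x y
    by (rule LIMSEQ_le[OF pt pt]) (use u that in \<open>auto simp: unit_cdf_def mono_def\<close>)
  moreover have "G x = 0" if "x \<le> 0" for x
    using LIMSEQ_unique[OF pt[of x], of 0] u that by (simp add: unit_cdf_def)
  moreover have "G x = 1" if "1 \<le> x" for x
    using LIMSEQ_unique[OF pt[of x], of 1] u that by (simp add: unit_cdf_def)
  ultimately show "G \<in> cdfs" by (simp add: cdfs_def unit_cdf_def mono_def)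
qed

text \<open>The distribution functions form a closed subset of a complete metric space. The closures
  of the given nowhere dense sets are used because the Baire category theorem speaks of closed
  sets.\<close>

lemma not_meager_in_cdfs:
  assumes U: "openin (top_of_set cdfs) U" "U \<noteq> {}"
  shows "\<not> meager_in (top_of_set cdfs) U"
proof
  let ?X = "top_of_set cdfs"
  assume "meager_in ?X U"
  then obtain N :: "nat \<Rightarrow> _" where N: "\<And>n. nowhere_dense_in ?X (N n)" "U = (\<Union>n. N n)"
    by (auto simp: meager_in_def)
  have "completely_metrizable_space ?X"
    by (rule completely_metrizable_space_closedin[OF completely_metrizable_space_euclidean])
       (simp add: closed_cdfs)
  then have "?X interior_of \<Union>(range (\<lambda>n. ?X closure_of N n)) = {}"
    by (intro Baire_category_alt) (use N(1) in \<open>auto simp: nowhere_dense_in_def\<close>)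
  moreover have "N n \<subseteq> ?X closure_of N n" for n
    by (rule closure_of_subset) (use N(1)[of n] in \<open>simp add: nowhere_dense_in_def\<close>)
  then have "U \<subseteq> \<Union>(range (\<lambda>n. ?X closure_of N n))" unfolding N(2) by fast
  ultimately show False using interior_of_maximal[OF _ U(1)] U(2) by blast
qed

section \<open>A countable base for the distribution functions\<close>

text \<open>Bounded continuous functions on the line are not separable in the supremum metric; here
  monotonicity lets finitely many approximate values determine a function up to a small error. One
  number serves as grid size and as inverse tolerance. For \<open>fst p = 0\<close> the tolerance is
  0 by convention and the cell is empty.\<close>

definition cdf_cell :: "nat \<times> rat list \<Rightarrow> (real \<Rightarrow>\<^sub>C real) set" where
  "cdf_cell p = {G \<in> cdfs. \<forall>k\<le>fst p. \<bar>G (real k / real (fst p)) - of_rat (snd p ! k)\<bar> < 1 / real (fst p)}"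

lemma openin_cdf_cell: "openin (top_of_set cdfs) (cdf_cell p)"
proof -
  have "open {G :: real \<Rightarrow>\<^sub>C real. \<bar>G x - a\<bar> < e}" for x a e
  proof (rule open_dist[THEN iffD2], intro ballI)
    fix G :: "real \<Rightarrow>\<^sub>C real" assume "G \<in> {G. \<bar>apply_bcontfun G x - a\<bar> < e}"
    then have G: "\<bar>G x - a\<bar> < e" by simp
    show "\<exists>d>0. \<forall>G'. dist G' G < d \<longrightarrow> G' \<in> {G. \<bar>apply_bcontfun G x - a\<bar> < e}"
    proof (intro exI conjI allI impI)
      show "0 < e - \<bar>G x - a\<bar>" using G by simp
      fix G' :: "real \<Rightarrow>\<^sub>C real" assume "dist G' G < e - \<bar>G x - a\<bar>"
      from dist_fun_lt_imp_dist_val_lt[OF this, of x] show "G' \<in> {G. \<bar>apply_bcontfun G x - a\<bar> < e}"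
        by (simp add: dist_real_def)
    qed
  qed
  then have "open (\<Inter>k\<in>{..fst p}. {G :: real \<Rightarrow>\<^sub>C real. \<bar>G (real k / real (fst p)) - of_rat (snd p ! k)\<bar> < 1 / real (fst p)})"
    by (intro open_INT) auto
  moreover have "cdf_cell p = cdfs \<inter> (\<Inter>k\<in>{..fst p}. {G :: real \<Rightarrow>\<^sub>C real. \<bar>G (real k / real (fst p)) - of_rat (snd p ! k)\<bar> < 1 / real (fst p)})"
    by (auto simp: cdf_cell_def)
  ultimately show ?thesis by (simp add: openin_open_Int)
qed

lemma cdf_cell_neighbourhood:
  assumes U: "openin (top_of_set cdfs) U" and F: "F \<in> U"
  shows "\<exists>p. F \<in> cdf_cell p \<and> cdf_cell p \<subseteq> U"
proof -
  have Fc: "F \<in> cdfs" using U F openin_subset by fastforce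
  then have uF: "unit_cdf (apply_bcontfun F)" by (simp add: cdfs_def)
  obtain e where e: "0 < e" "ball F e \<inter> cdfs \<subseteq> U"
    using U F unfolding openin_contains_ball by blast
  have e4: "0 < e / 4" using e(1) by simp
  obtain N0 where N0: "0 < N0" "\<forall>N\<ge>N0. \<forall>G. unit_cdf G \<longrightarrow>
      (\<forall>k\<le>N. \<bar>G (real k / real N) - F (real k / real N)\<bar> \<le> e / 4) \<longrightarrow> (\<forall>x. \<bar>G x - F x\<bar> \<le> 2 * (e / 4))"
    using unit_cdf_grid[OF uF e4] by (elim exE conjE)
  \<comment> \<open>Two members of a cell differ by less than \<open>2 / N\<close> on the grid, thus
    by less than \<open>e / 4\<close>, and the grid lemma doubles this bound to
    \<open>e / 2\<close>.\<close>
  obtain m where m: "1 / real (Suc m) < e / 8" using nat_approx_posE[of "e / 8"] e(1) by auto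
  define N where "N = max N0 (Suc m)"
  have N: "N \<ge> N0" "0 < N" by (auto simp: N_def)
  have "1 / real N \<le> 1 / real (Suc m)" by (rule frac_le) (auto simp: N_def)
  then have N8: "1 / real N < e / 8" using m by linarith
  have "\<exists>q. \<bar>F (real k / real N) - of_rat q\<bar> < 1 / real N" for k
  proof -
    obtain q where "F (real k / real N) < of_rat q" "of_rat q < F (real k / real N) + 1 / real N"
      using of_rat_dense[of "F (real k / real N)" "F (real k / real N) + 1 / real N"] N(2) by auto
    then show ?thesis by (intro exI[of _ q]) (simp add: abs_less_iff)
  qed
  then obtain q where q: "\<And>k. \<bar>F (real k / real N) - of_rat (q k)\<bar> < 1 / real N" by metis
  define p where "p = (N, map q [0..<Suc N])"
  have p: "fst p = N" "k \<le> N \<Longrightarrow> snd p ! k = q k" for k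
    by (auto simp: p_def simp del: upt_Suc)
  have "F \<in> cdf_cell p" using Fc q p by (simp add: cdf_cell_def)
  moreover have "cdf_cell p \<subseteq> U"
  proof
    fix G assume G: "G \<in> cdf_cell p"
    then have Gc: "G \<in> cdfs" and uG: "unit_cdf (apply_bcontfun G)" by (auto simp: cdf_cell_def cdfs_def)
    have "\<bar>G (real k / real N) - F (real k / real N)\<bar> \<le> e / 4" if "k \<le> N" for k
    proof -
      have "\<bar>G (real k / real N) - of_rat (q k)\<bar> < 1 / real N"
        using G that p by (simp add: cdf_cell_def)
      then show ?thesis using q[of k] N8 by linarith
    qed
    then have "\<bar>G x - F x\<bar> \<le> 2 * (e / 4)" for x
      using N0(2)[rule_format, OF N(1) uG] by blast
    then have "dist G F \<le> 2 * (e / 4)" by (intro dist_bound) (simp add: dist_real_def)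
    then have "G \<in> ball F e" using e(1) by (simp add: dist_commute)
    then show "G \<in> U" using e(2) Gc by blast
  qed
  ultimately show ?thesis by blast
qed

section \<open>Transfer of isomorphism-invariant properties\<close>

lemma isomorphism_invariant_coding_map:
  fixes P :: "'g::{group_add,countable} system \<Rightarrow> bool"
  assumes P: "isomorphism_invariant P" and p: "p \<in> cdfs \<times> Y_actions"
  shows "P (Fun_System (coding_map p) coord_shift) \<longleftrightarrow> P (Real_System Y_measure (rep (snd p)))"
proof -
  have F: "unit_cdf (apply_bcontfun (fst p))" and c: "snd p \<in> Y_actions"
    using p by (auto simp: cdfs_def)
  have "is_action (Real_System Y_measure (rep (snd p)))" using gaction_rep[OF c] by simp
  moreover have "is_action (Fun_System (coding_map p) coord_shift)"
    using is_action_SIM_setting[of "coding_map p"] coding_in_SIM[OF F c]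
    by (simp add: SIM_setting_def coding_map_def)
  moreover have "isomorphic (Real_System Y_measure (rep (snd p))) (Fun_System (coding_map p) coord_shift)"
    unfolding coding_map_def by (rule isomorphic_coding[OF F c])
  ultimately show ?thesis using P unfolding isomorphism_invariant_def by blast
qed

lemma having_transfer:
  fixes P :: "'g::{group_add,countable} system \<Rightarrow> bool"
  assumes P: "isomorphism_invariant P"
  shows "meager_in (fst (Y_setting :: (('g \<Rightarrow> real \<Rightarrow> real) set, 'g) setting)) (having Y_setting P)
      \<longleftrightarrow> meager_in (fst (SIM_setting :: (('g \<Rightarrow> real) measure, 'g) setting)) (having SIM_setting P)"
    and "Baire_set_in (fst (Y_setting :: (('g \<Rightarrow> real \<Rightarrow> real) set, 'g) setting)) (having Y_setting P)
      \<longleftrightarrow> Baire_set_in (fst (SIM_setting :: (('g \<Rightarrow> real) measure, 'g) setting)) (having SIM_setting P)"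
proof -
  let ?B = "having (Y_setting :: (('g \<Rightarrow> real \<Rightarrow> real) set, 'g) setting) P"
  let ?C = "having (SIM_setting :: (('g \<Rightarrow> real) measure, 'g) setting) P"
  have B: "?B \<subseteq> topspace (coarse_topology :: ('g \<Rightarrow> real \<Rightarrow> real) set topology)"
    and C: "?C \<subseteq> topspace (weak_star_topology :: ('g \<Rightarrow> real) measure topology)"
    by (auto simp: having_def Y_setting_def SIM_setting_def)
  \<comment> \<open>Invariance enters only here: whether a coding has \<open>P\<close> is decided by
    its action and not by its distribution function.\<close>
  have CB: "?C \<inter> coded_measures = coding_map ` (topspace (top_of_set cdfs) \<times> ?B)"
  proof (intro equalityI subsetI)
    fix \<mu> assume \<mu>: "\<mu> \<in> ?C \<inter> coded_measures"
    then obtain p where p: "p \<in> cdfs \<times> Y_actions" "\<mu> = coding_map p" by (auto simp: coded_measures_def)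
    have "P (Fun_System \<mu> coord_shift)" using \<mu> by (simp add: having_def SIM_setting_def)
    then have "P (Real_System Y_measure (rep (snd p)))"
      using isomorphism_invariant_coding_map[OF P p(1)] p(2) by simp
    then have "p \<in> topspace (top_of_set cdfs) \<times> ?B"
      using p(1) by (simp add: having_def Y_setting_def mem_Times_iff)
    then show "\<mu> \<in> coding_map ` (topspace (top_of_set cdfs) \<times> ?B)" using p(2) by blast
  next
    fix \<mu> assume "\<mu> \<in> coding_map ` (topspace (top_of_set cdfs) \<times> ?B)"
    then obtain p where p: "p \<in> topspace (top_of_set cdfs) \<times> ?B" "\<mu> = coding_map p" by blast
    then have pc: "p \<in> cdfs \<times> Y_actions" and "P (Real_System Y_measure (rep (snd p)))"
      by (auto simp: having_def Y_setting_def)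
    then have "P (Fun_System \<mu> coord_shift)"
      using isomorphism_invariant_coding_map[OF P pc] p(2) by simp
    moreover have "\<mu> \<in> coded_measures" using pc p(2) by (simp add: coded_measures_def)
    ultimately show "\<mu> \<in> ?C \<inter> coded_measures"
      using coded_measures_subset_SIM by (auto simp: having_def SIM_setting_def)
  qed
  let ?\<B> = "{cdf_cell p | p. cdf_cell p \<noteq> {}}"
  have cnt: "countable ?\<B>"
    by (rule countable_subset[of _ "range cdf_cell"]) auto
  have opn: "openin (top_of_set cdfs) u \<and> u \<noteq> {}" if "u \<in> ?\<B>" for u
    using that openin_cdf_cell by auto
  have pi: "\<exists>u\<in>?\<B>. u \<subseteq> U" if U: "openin (top_of_set cdfs) U" "U \<noteq> {}" for U
  proof -
    obtain F where "F \<in> U" using U(2) by auto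
    from cdf_cell_neighbourhood[OF U(1) this] show ?thesis by blast
  qed
  have ne: "topspace (top_of_set cdfs) \<noteq> {}" using cdfs_nonempty by simp
  note transfer = category_transfer[OF cnt opn pi not_meager_in_cdfs ne homeomorphic_map_coding
      residual_in_coded_measures[OF dense_coded_measures] dense_coded_measures B C CB]
  show "meager_in (fst (Y_setting :: (('g \<Rightarrow> real \<Rightarrow> real) set, 'g) setting)) ?B
      \<longleftrightarrow> meager_in (fst (SIM_setting :: (('g \<Rightarrow> real) measure, 'g) setting)) ?C"
    using transfer(1) by (simp add: Y_setting_def SIM_setting_def)
  show "Baire_set_in (fst (Y_setting :: (('g \<Rightarrow> real \<Rightarrow> real) set, 'g) setting)) ?B
      \<longleftrightarrow> Baire_set_in (fst (SIM_setting :: (('g \<Rightarrow> real) measure, 'g) setting)) ?C"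
    using transfer(2) by (simp add: Y_setting_def SIM_setting_def)
qed

text \<open>The complement of the set cut out by \<open>P\<close> is cut out by its negation, which
  is invariant as well, so the residual case becomes the meager case.\<close>

lemma residual_in_having_iff:
  "residual_in (fst \<Omega>) (having \<Omega> P) \<longleftrightarrow> meager_in (fst \<Omega>) (having \<Omega> (\<lambda>A. \<not> P A))"
proof -
  have "topspace (fst \<Omega>) - having \<Omega> P = having \<Omega> (\<lambda>A. \<not> P A)" by (auto simp: having_def)
  then show ?thesis by (auto simp: residual_in_def having_def)
qed

theorem mainTheorem3:
  shows "dynamically_generically_equivalent
           (Y_setting :: (('g::{group_add,countable} \<Rightarrow> real \<Rightarrow> real) set, 'g) setting)
           (SIM_setting :: (('g \<Rightarrow> real) measure, 'g) setting)"
  unfolding dynamically_generically_equivalent_def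
proof (intro allI impI)
  fix P :: "'g system \<Rightarrow> bool"
  assume P: "isomorphism_invariant P"
  then have nP: "isomorphism_invariant (\<lambda>A. \<not> P A)" by (auto simp: isomorphism_invariant_def)
  show "(Baire_set_in (fst Y_setting) (having Y_setting P) \<longleftrightarrow> Baire_set_in (fst SIM_setting) (having SIM_setting P)) \<and>
      (meager_in (fst Y_setting) (having Y_setting P) \<longleftrightarrow> meager_in (fst SIM_setting) (having SIM_setting P)) \<and>
      (residual_in (fst Y_setting) (having Y_setting P) \<longleftrightarrow> residual_in (fst SIM_setting) (having SIM_setting P))"
    unfolding residual_in_having_iff
    by (intro conjI having_transfer P nP)
qed

end
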